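(* Let $\Gamma\subset\mathrm{SL}(2,\mathbb Z)$ be a finite index subgroup, let $n\ge 0$ be an integer and let $\rho_n:\Gamma\to\mathrm{SL}(V^n)$ be the restriction to $\Gamma$ of the representation $\bar\rho_n$ of $\mathrm{SL}(2,\mathbb C)$ on $V^n=\mathrm{Sym}^n\mathbb C^2$. Grade $V^n=\bigoplus_k V^n_k$ by the eigenvalues $k\in\{-n,-n+2,\dots,n\}$ of $H$. Then the operator $\Phi_n$ is an isomorphism of graded $M_\ast(\Gamma)$-modules $$\Phi_n: V^n\otimes_{\mathbb C}M_\ast(\Gamma)\longrightarrow M_\ast(\rho_n).$$ In particular, $M_\ast(\rho_n)$ is a free $M_\ast(\Gamma)$-module of rank $n+1$ with Hilbert series $$H(M_\ast(\rho_n),t)=(t^{-n}+t^{-n+2}+\cdots+t^n)\,H(M_\ast(\Gamma),t).$$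
   Context: $\mathbb H^2$ is the upper half-plane with $\gamma\tau=\frac{a\tau+b}{c\tau+d}$ for $\gamma=\begin{pmatrix}a&b\\c&d\end{pmatrix}$. For a cusp $s\in\mathbb Q\cup\{\infty\}$ choose $g\in\mathrm{SL}(2,\mathbb Z)$ with $gs=\infty$ and put $\tau_s=g\tau$; a function $f:\mathbb H^2\to V$ into a finite-dimensional normed space has polynomial growth at $s$ if there are constants $C,N$ with $\|f(\tau)\|<C|\tau_s|^N$ whenever $\operatorname{Im}\tau_s$ is large enough. For a representation $\rho:\Gamma\to\mathrm{GL}(V)$, $M_k(\rho)$ is the space of holomorphic $f:\mathbb H^2\to V$ with $f(\gamma\tau)=(c\tau+d)^k\rho(\gamma)f(\tau)$ for all $\gamma\in\Gamma$, of polynomial growth at every cusp; $M_\ast(\rho)=\bigoplus_{k\in\mathbb Z}M_k(\rho)$. $M_k(\Gamma)$, $M_\ast(\Gamma)$ denote the case of the trivial one-dimensional representation (usual holomorphic modular forms). The Hilbert series of a graded module $M=\bigoplus_k M_k$ is $H(M,t)=\sum_{k}\dim M_k\,t^k$. $H,E,F$ are the images under $\mathrm d\bar\rho_n:\mathfrak{sl}(2,\mathbb C)\to\mathfrak{sl}(V^n)$ of $\begin{pmatrix}1&0\\0&-1\end{pmatrix},\begin{pmatrix}0&1\\0&0\end{pmatrix},\begin{pmatrix}0&0\\1&0\end{pmatrix}$. $E_2(\tau)=1-24\sum_{m\ge1}\sigma_1(m)e^{2\pi i m\tau}$. The operator is $\Phi_n(\tau)=\exp(\tau E)\exp\!\big(2\pi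 i\tfrac{E_2(\tau)}{12}F\big)\exp(\ln(\mathrm d\tau^{1/2})H)$, where the last factor multiplies the $H$-eigenspace of eigenvalue $k$ by $\mathrm d\tau^{k/2}$ and a form $f\,\mathrm d\tau^{k/2}$ is a form of weight $k$. Concretely, for $v\in V^n_k$ and $f\in M_l(\Gamma)$, $\Phi_n(v\otimes f)$ is the form of weight $k+l$ given by $\tau\mapsto f(\tau)\exp(\tau E)\exp\!\big(2\pi i\tfrac{E_2(\tau)}{12}F\big)v$. The element $v\otimes f$ has degree $k+l$. *)

theory Defs
  imports
    "HOL-Library.Poly_Mapping"
    "HOL-Library.Function_Algebras"
    "HOL-Library.Product_Plus"
    "HOL-Analysis.Analysis"
    "HOL-Computational_Algebra.Formal_Laurent_Series"
    "HOL-Algebra.Coset"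
    "HOL-Algebra.AbelCoset"
    "HOL-Algebra.Module"
begin

unbundle no Formal_Power_Series.fps_syntax

section \<open>Upper half-plane, modular group, cusps\<close>

text \<open>
  The upper half-plane is a type of its own, so that equality of functions on it is equality
  of HOL functions, and so that functions from it to a ring form a ring under the pointwise
  operations.
\<close>

typedef uhp = "{z::complex. Im z > 0}"
  morphisms of_uhp Abs_uhp
  by (rule exI[of _ \<i>]) simp

definition SL2Z :: "(int^2^2) monoid" where
  "SL2Z = \<lparr>carrier = {A. det A = 1}, monoid.mult = (**), one = mat 1\<rparr>"

definition automorphy_factor :: "int^2^2 \<Rightarrow> uhp \<Rightarrow> complex" where
  "automorphy_factor \<gamma> \<tau> = of_int (\<gamma>$2$1) * of_uhp \<tau> + of_int (\<gamma>$2$2)"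

definition moebius_uhp :: "int^2^2 \<Rightarrow> uhp \<Rightarrow> uhp" where
  "moebius_uhp \<gamma> \<tau> =
     Abs_uhp ((of_int (\<gamma>$1$1) * of_uhp \<tau> + of_int (\<gamma>$1$2)) / automorphy_factor \<gamma> \<tau>)"

text \<open>A cusp is an element of \<^term>\<open>UNIV :: rat option set\<close>, where \<^term>\<open>None\<close> is \<open>\<infinity>\<close>.\<close>

definition moebius_cusp :: "int^2^2 \<Rightarrow> rat option \<Rightarrow> rat option" where
  "moebius_cusp \<gamma> s = (case s of
     None \<Rightarrow> if \<gamma>$2$1 = 0 then None else Some (of_int (\<gamma>$1$1) / of_int (\<gamma>$2$1))
   | Some r \<Rightarrow> if of_int (\<gamma>$2$1) * r + of_int (\<gamma>$2$2) = 0 then None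
               else Some ((of_int (\<gamma>$1$1) * r + of_int (\<gamma>$1$2)) /
                          (of_int (\<gamma>$2$1) * r + of_int (\<gamma>$2$2))))"


section \<open>Modular forms with values in a representation\<close>

text \<open>
  A finite-dimensional complex vector space is presented by a scalar multiplication \<open>scl\<close>, a
  carrier \<open>V\<close> and linear coordinates \<open>crd\<close>.  Holomorphy is holomorphy of all coordinates.  All
  norms on \<open>V\<close> are equivalent, and the one used in the growth condition is the maximum norm of
  the coordinates, so \<open>\<parallel>v\<parallel> < B\<close> reads \<open>\<forall>i. \<bar>crd v i\<bar> < B\<close>.

  Two elements \<open>g\<close> of the modular group taking the cusp \<open>s\<close> to \<open>\<infinity>\<close> give values of \<open>\<tau>\<^sub>s\<close> that
  differ by an integer translation, so the growth condition does not depend on the choice of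
  \<open>g\<close>; it is required here for each choice.
\<close>

definition polynomial_growth_at ::
    "('v \<Rightarrow> 'i \<Rightarrow> complex) \<Rightarrow> (uhp \<Rightarrow> 'v) \<Rightarrow> rat option \<Rightarrow> bool" where
  "polynomial_growth_at crd f s \<longleftrightarrow>
     (\<forall>g\<in>carrier SL2Z. moebius_cusp g s = None \<longrightarrow>
       (\<exists>(C::real) (N::real) (Y::real). \<forall>\<tau>. Im (of_uhp (moebius_uhp g \<tau>)) > Y \<longrightarrow>
          (\<forall>i. cmod (crd (f \<tau>) i) < C * cmod (of_uhp (moebius_uhp g \<tau>)) powr N)))"

definition modular_forms ::
    "(complex \<Rightarrow> 'v \<Rightarrow> 'v) \<Rightarrow> 'v set \<Rightarrow> ('v \<Rightarrow> 'i \<Rightarrow> complex) \<Rightarrow>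
     (int^2^2) set \<Rightarrow> (int^2^2 \<Rightarrow> 'v \<Rightarrow> 'v) \<Rightarrow> int \<Rightarrow> (uhp \<Rightarrow> 'v) set" where
  "modular_forms scl V crd \<Gamma> \<rho> k = {f.
     (\<forall>\<tau>. f \<tau> \<in> V) \<and>
     (\<forall>i. (\<lambda>z. crd (f (Abs_uhp z)) i) holomorphic_on {z. Im z > 0}) \<and>
     (\<forall>\<gamma>\<in>\<Gamma>. \<forall>\<tau>. f (moebius_uhp \<gamma> \<tau>) = scl (automorphy_factor \<gamma> \<tau> powi k) (\<rho> \<gamma> (f \<tau>))) \<and>
     (\<forall>s. polynomial_growth_at crd f s)}"

definition scalar_modular_forms :: "(int^2^2) set \<Rightarrow> int \<Rightarrow> (uhp \<Rightarrow> complex) set" where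
  "scalar_modular_forms \<Gamma> =
     modular_forms (*) UNIV (\<lambda>z (_::unit). z) \<Gamma> (\<lambda>_ v. v)"


section \<open>Symmetric powers of the standard representation\<close>

text \<open>
  The symmetric algebra of \<open>\<complex>\<^sup>2\<close> is the polynomial ring in the standard basis vectors
  \<open>e\<^sub>1, e\<^sub>2\<close>; the key \<open>(i, j)\<close> is the monomial \<open>e\<^sub>1\<^sup>i e\<^sub>2\<^sup>j\<close>.  The symmetric power \<open>Sym\<^sup>n \<complex>\<^sup>2\<close> is its
  homogeneous part of degree \<open>n\<close>.
\<close>

type_synonym sym = "(nat \<times> nat) \<Rightarrow>\<^sub>0 complex"

definition Sym :: "nat \<Rightarrow> sym set" where
  "Sym n = {v. \<forall>m\<in>Poly_Mapping.keys v. fst m + snd m = n}"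

definition scale_sym :: "complex \<Rightarrow> sym \<Rightarrow> sym" where
  "scale_sym c v = Poly_Mapping.map ((*) c) v"

definition sym_linear :: "complex \<Rightarrow> complex \<Rightarrow> sym" where
  "sym_linear x y = Poly_Mapping.single (1, 0) x + Poly_Mapping.single (0, 1) y"

text \<open>
  Functoriality of the symmetric algebra: \<open>e\<^sub>1\<close> and \<open>e\<^sub>2\<close> are replaced by \<open>A e\<^sub>1\<close> and \<open>A e\<^sub>2\<close>, the
  columns of \<open>A\<close>.  This makes sense for all 2-by-2 matrices \<open>A\<close>, and preserves each
  \<^term>\<open>Sym n\<close>; for \<open>A\<close> of determinant one it is the representation on \<^term>\<open>Sym n\<close>.
\<close>

definition sym_rep :: "complex^2^2 \<Rightarrow> sym \<Rightarrow> sym" where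
  "sym_rep A v = (\<Sum>m\<in>Poly_Mapping.keys v. scale_sym (Poly_Mapping.lookup v m)
     (sym_linear (A$1$1) (A$2$1) ^ fst m * sym_linear (A$1$2) (A$2$2) ^ snd m))"

definition rho :: "int^2^2 \<Rightarrow> sym \<Rightarrow> sym" where
  "rho \<gamma> = sym_rep (map_matrix of_int \<gamma>)"

definition rho_modular_forms :: "(int^2^2) set \<Rightarrow> nat \<Rightarrow> int \<Rightarrow> (uhp \<Rightarrow> sym) set" where
  "rho_modular_forms \<Gamma> n = modular_forms scale_sym (Sym n) Poly_Mapping.lookup \<Gamma> rho"

text \<open>
  The differential of the representation at the identity in the direction of a traceless
  matrix \<open>X\<close>.  As \<^const>\<open>sym_rep\<close> is polynomial in the matrix entries, the derivative can be
  taken along the line \<open>1 + t X\<close>, which is tangent at the identity to the curve \<open>exp (t X)\<close> in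
  the special linear group.
\<close>

definition d_sym_rep :: "complex^2^2 \<Rightarrow> sym \<Rightarrow> sym" where
  "d_sym_rep X v = Abs_poly_mapping (\<lambda>m.
     deriv (\<lambda>t. Poly_Mapping.lookup (sym_rep (\<chi> i j. mat 1 $ i $ j + t * X $ i $ j) v) m) 0)"

definition H_op :: "sym \<Rightarrow> sym" where
  "H_op = d_sym_rep (vector [vector [1, 0], vector [0, -1]])"

definition E_op :: "sym \<Rightarrow> sym" where
  "E_op = d_sym_rep (vector [vector [0, 1], vector [0, 0]])"

definition F_op :: "sym \<Rightarrow> sym" where
  "F_op = d_sym_rep (vector [vector [0, 0], vector [1, 0]])"

definition weights :: "nat \<Rightarrow> int set" where
  "weights n = (\<lambda>j. 2 * int j - int n) ` {..n}"

definition weight_space :: "nat \<Rightarrow> int \<Rightarrow> sym set" where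
  "weight_space n k = {v \<in> Sym n. H_op v = scale_sym (of_int k) v}"

definition weight_components :: "nat \<Rightarrow> sym \<Rightarrow> int \<Rightarrow> sym" where
  "weight_components n v = (THE c. (\<forall>k. c k \<in> weight_space n k) \<and> v = (\<Sum>k\<in>weights n. c k))"

definition exp_op :: "(sym \<Rightarrow> sym) \<Rightarrow> sym \<Rightarrow> sym" where
  "exp_op A v = Abs_poly_mapping (\<lambda>m. suminf (\<lambda>j. Poly_Mapping.lookup ((A ^^ j) v) m / fact j))"

definition Eisenstein_E2 :: "complex \<Rightarrow> complex" where
  "Eisenstein_E2 \<tau> =
     1 - 24 * suminf (\<lambda>m. of_nat (\<Sum>{d. d dvd Suc m}) * exp (2 * pi * \<i> * of_nat (Suc m) * \<tau>))"


section \<open>Graded rings and modules\<close>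

definition grading :: "('a, 'c) ring_scheme \<Rightarrow> (int \<Rightarrow> 'a set) \<Rightarrow> bool" where
  "grading M Mg \<longleftrightarrow>
     (\<forall>k. additive_subgroup (Mg k) M) \<and>
     (\<forall>x\<in>carrier M. \<exists>!c. (\<forall>k. c k \<in> Mg k) \<and> finite {k. c k \<noteq> \<zero>\<^bsub>M\<^esub>} \<and>
        x = finsum M c {k. c k \<noteq> \<zero>\<^bsub>M\<^esub>})"

definition graded_ring :: "('a, 'c) ring_scheme \<Rightarrow> (int \<Rightarrow> 'a set) \<Rightarrow> bool" where
  "graded_ring R Rg \<longleftrightarrow> cring R \<and> grading R Rg \<and> \<one>\<^bsub>R\<^esub> \<in> Rg 0 \<and>
     (\<forall>i j. \<forall>r\<in>Rg i. \<forall>s\<in>Rg j. r \<otimes>\<^bsub>R\<^esub> s \<in> Rg (i + j))"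

definition graded_module ::
    "('a, 'c) ring_scheme \<Rightarrow> (int \<Rightarrow> 'a set) \<Rightarrow> ('a, 'b, 'd) module_scheme \<Rightarrow> (int \<Rightarrow> 'b set) \<Rightarrow> bool"
  where
  "graded_module R Rg M Mg \<longleftrightarrow> graded_ring R Rg \<and> Module.module R M \<and> grading M Mg \<and>
     (\<forall>i j. \<forall>r\<in>Rg i. \<forall>x\<in>Mg j. r \<odot>\<^bsub>M\<^esub> x \<in> Mg (i + j))"

definition graded_module_iso ::
    "('a, 'c) ring_scheme \<Rightarrow> (int \<Rightarrow> 'a set) \<Rightarrow>
     ('a, 'b, 'd) module_scheme \<Rightarrow> (int \<Rightarrow> 'b set) \<Rightarrow>
     ('a, 'e, 'f) module_scheme \<Rightarrow> (int \<Rightarrow> 'e set) \<Rightarrow> ('b \<Rightarrow> 'e) \<Rightarrow> bool" where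
  "graded_module_iso R Rg M Mg N Ng \<phi> \<longleftrightarrow>
     graded_module R Rg M Mg \<and> graded_module R Rg N Ng \<and>
     bij_betw \<phi> (carrier M) (carrier N) \<and>
     (\<forall>x\<in>carrier M. \<forall>y\<in>carrier M. \<phi> (x \<oplus>\<^bsub>M\<^esub> y) = \<phi> x \<oplus>\<^bsub>N\<^esub> \<phi> y) \<and>
     (\<forall>r\<in>carrier R. \<forall>x\<in>carrier M. \<phi> (r \<odot>\<^bsub>M\<^esub> x) = r \<odot>\<^bsub>N\<^esub> \<phi> x) \<and>
     (\<forall>k. \<phi> ` Mg k = Ng k)"

definition free_module_of_rank ::
    "('a, 'c) ring_scheme \<Rightarrow> ('a, 'b, 'd) module_scheme \<Rightarrow> nat \<Rightarrow> bool" where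
  "free_module_of_rank R M r \<longleftrightarrow> Module.module R M \<and>
     (\<exists>b. (\<forall>i<r. b i \<in> carrier M) \<and>
        (\<forall>x\<in>carrier M. \<exists>!c. c \<in> {..<r} \<rightarrow>\<^sub>E carrier R \<and>
           x = finsum M (\<lambda>i. c i \<odot>\<^bsub>M\<^esub> b i) {..<r}))"

text \<open>
  The graded vector spaces here have finite-dimensional components that vanish in all
  sufficiently negative degrees, as is needed for the dimensions to form a Laurent series.
\<close>

definition hilbert_series ::
    "(complex \<Rightarrow> 'b \<Rightarrow> 'b) \<Rightarrow> (int \<Rightarrow> 'b::ab_group_add set) \<Rightarrow> int fls" where
  "hilbert_series scl Mg = Abs_fls (\<lambda>k. int (vector_space.dim scl (Mg k)))"


section \<open>The ring and the module of modular forms of all weights\<close>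

text \<open>
  Elements of \<open>\<Oplus>\<^sub>k M\<^sub>k\<close> are finitely supported families indexed by the weight \<open>k\<close>.  The
  multiplication of \<open>\<int> \<Rightarrow>\<^sub>0 R\<close> for a ring \<open>R\<close> is convolution.
\<close>

definition direct_sum :: "(int \<Rightarrow> 'a::zero set) \<Rightarrow> (int \<Rightarrow>\<^sub>0 'a) set" where
  "direct_sum M = {F. \<forall>k. Poly_Mapping.lookup F k \<in> M k}"

definition homogeneous_part :: "(int \<Rightarrow> 'a::zero set) \<Rightarrow> int \<Rightarrow> (int \<Rightarrow>\<^sub>0 'a) set" where
  "homogeneous_part M k = Poly_Mapping.single k ` M k"

definition scale_fun :: "complex \<Rightarrow> (uhp \<Rightarrow> complex) \<Rightarrow> uhp \<Rightarrow> complex" where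
  "scale_fun c f = (\<lambda>\<tau>. c * f \<tau>)"

definition scale_sym_fun :: "complex \<Rightarrow> (uhp \<Rightarrow> sym) \<Rightarrow> uhp \<Rightarrow> sym" where
  "scale_sym_fun c f = (\<lambda>\<tau>. scale_sym c (f \<tau>))"

definition modular_ring :: "(int^2^2) set \<Rightarrow> (int \<Rightarrow>\<^sub>0 (uhp \<Rightarrow> complex)) ring" where
  "modular_ring \<Gamma> = \<lparr>carrier = direct_sum (scalar_modular_forms \<Gamma>),
     monoid.mult = (*), one = 1, zero = 0, add = (+)\<rparr>"

definition modular_act ::
    "(int \<Rightarrow>\<^sub>0 (uhp \<Rightarrow> complex)) \<Rightarrow> (int \<Rightarrow>\<^sub>0 (uhp \<Rightarrow> sym)) \<Rightarrow> (int \<Rightarrow>\<^sub>0 (uhp \<Rightarrow> sym))" where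
  "modular_act f F = (\<Sum>i\<in>Poly_Mapping.keys f. \<Sum>j\<in>Poly_Mapping.keys F.
     Poly_Mapping.single (i + j)
       (\<lambda>\<tau>. scale_sym (Poly_Mapping.lookup f i \<tau>) (Poly_Mapping.lookup F j \<tau>)))"

text \<open>The fields \<open>mult\<close> and \<open>one\<close> of a module record play no role in modules.\<close>

definition rho_module ::
    "(int^2^2) set \<Rightarrow> nat \<Rightarrow> (int \<Rightarrow>\<^sub>0 (uhp \<Rightarrow> complex), int \<Rightarrow>\<^sub>0 (uhp \<Rightarrow> sym)) module" where
  "rho_module \<Gamma> n = \<lparr>carrier = direct_sum (rho_modular_forms \<Gamma> n),
     monoid.mult = undefined, one = undefined, zero = 0, add = (+), smult = modular_act\<rparr>"


section \<open>Tensor products over the complex numbers\<close>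

text \<open>
  \<open>V \<otimes> M\<close> is the free vector space on \<open>V \<times> M\<close> modulo the subspace generated by the bilinearity
  relations; its elements are cosets of that subspace.
\<close>

definition scale_coeffs :: "(complex \<Rightarrow> 'a \<Rightarrow> 'a) \<Rightarrow> complex \<Rightarrow> ('k \<Rightarrow>\<^sub>0 'a) \<Rightarrow> ('k \<Rightarrow>\<^sub>0 'a::zero)" where
  "scale_coeffs scl c x = Poly_Mapping.map (scl c) x"

definition free_space :: "'v set \<Rightarrow> 'm set \<Rightarrow> ('v \<times> 'm \<Rightarrow>\<^sub>0 complex) set" where
  "free_space V M = {x. Poly_Mapping.keys x \<subseteq> V \<times> M}"

definition tensor_relations ::
    "(complex \<Rightarrow> 'v \<Rightarrow> 'v) \<Rightarrow> 'v::plus set \<Rightarrow> (complex \<Rightarrow> 'm \<Rightarrow> 'm) \<Rightarrow> 'm::plus set \<Rightarrow>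
     ('v \<times> 'm \<Rightarrow>\<^sub>0 complex) set" where
  "tensor_relations sv V sm M = (let \<delta> = (\<lambda>v m. Poly_Mapping.single (v, m) (1::complex)) in
     Modules.module.span (scale_coeffs (*))
       ({\<delta> (v + v') m - \<delta> v m - \<delta> v' m | v v' m. v \<in> V \<and> v' \<in> V \<and> m \<in> M} \<union>
        {\<delta> v (m + m') - \<delta> v m - \<delta> v m' | v m m'. v \<in> V \<and> m \<in> M \<and> m' \<in> M} \<union>
        {\<delta> (sv c v) m - scale_coeffs (*) c (\<delta> v m) | c v m. v \<in> V \<and> m \<in> M} \<union>
        {\<delta> v (sm c m) - scale_coeffs (*) c (\<delta> v m) | c v m. v \<in> V \<and> m \<in> M}))"

definition add_coset :: "'x::plus \<Rightarrow> 'x set \<Rightarrow> 'x set" where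
  "add_coset x R = (\<lambda>r. x + r) ` R"


section \<open>The graded module \<open>V\<^sup>n \<otimes> M\<^sub>*(\<Gamma>)\<close>\<close>

definition Vn_tensor_relations ::
    "(int^2^2) set \<Rightarrow> nat \<Rightarrow> (sym \<times> (int \<Rightarrow>\<^sub>0 (uhp \<Rightarrow> complex)) \<Rightarrow>\<^sub>0 complex) set" where
  "Vn_tensor_relations \<Gamma> n =
     tensor_relations scale_sym (Sym n)
       (scale_coeffs scale_fun) (direct_sum (scalar_modular_forms \<Gamma>))"

definition free_act ::
    "(int \<Rightarrow>\<^sub>0 (uhp \<Rightarrow> complex)) \<Rightarrow>
     (sym \<times> (int \<Rightarrow>\<^sub>0 (uhp \<Rightarrow> complex)) \<Rightarrow>\<^sub>0 complex) \<Rightarrow>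
     (sym \<times> (int \<Rightarrow>\<^sub>0 (uhp \<Rightarrow> complex)) \<Rightarrow>\<^sub>0 complex)" where
  "free_act r x = (\<Sum>p\<in>Poly_Mapping.keys x.
     Poly_Mapping.single (fst p, r * snd p) (Poly_Mapping.lookup x p))"

definition tensor_module ::
    "(int^2^2) set \<Rightarrow> nat \<Rightarrow>
     (int \<Rightarrow>\<^sub>0 (uhp \<Rightarrow> complex),
      (sym \<times> (int \<Rightarrow>\<^sub>0 (uhp \<Rightarrow> complex)) \<Rightarrow>\<^sub>0 complex) set) module" where
  "tensor_module \<Gamma> n = (let K = Vn_tensor_relations \<Gamma> n in
     \<lparr>carrier = (\<lambda>x. add_coset x K) ` free_space (Sym n) (direct_sum (scalar_modular_forms \<Gamma>)),
      monoid.mult = undefined, one = undefined,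
      zero = K,
      add = (\<lambda>X Y. {x + y | x y. x \<in> X \<and> y \<in> Y}),
      smult = (\<lambda>r X. \<Union>x\<in>X. add_coset (free_act r x) K)\<rparr>)"

definition tensor_part ::
    "(int^2^2) set \<Rightarrow> nat \<Rightarrow> int \<Rightarrow>
     (sym \<times> (int \<Rightarrow>\<^sub>0 (uhp \<Rightarrow> complex)) \<Rightarrow>\<^sub>0 complex) set set" where
  "tensor_part \<Gamma> n d = {add_coset x (Vn_tensor_relations \<Gamma> n) | x.
     \<forall>p\<in>Poly_Mapping.keys x. \<exists>k l. k + l = d \<and> fst p \<in> weight_space n k \<and>
       snd p \<in> homogeneous_part (scalar_modular_forms \<Gamma>) l}"


section \<open>The operator \<open>\<Phi>\<^sub>n\<close>\<close>

definition Phi_point :: "uhp \<Rightarrow> sym \<Rightarrow> sym" where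
  "Phi_point \<tau> v =
     exp_op (\<lambda>w. scale_sym (of_uhp \<tau>) (E_op w))
       (exp_op (\<lambda>w. scale_sym (2 * pi * \<i> * (Eisenstein_E2 (of_uhp \<tau>) / 12)) (F_op w)) v)"

text \<open>
  The factor \<open>exp (ln (d\<tau>\<^bsup>1/2\<^esup>) H)\<close> multiplies the component of \<open>v\<close> of weight \<open>k\<close> by \<open>d\<tau>\<^bsup>k/2\<^esup>\<close>,
  and \<open>f d\<tau>\<^bsup>k/2\<^esup>\<close> is \<open>f\<close> regarded as a form of weight \<open>k\<close>.  Thus it shifts the weight of a form
  by \<open>k\<close>.
\<close>

definition Phi_pure :: "nat \<Rightarrow> sym \<Rightarrow> (int \<Rightarrow>\<^sub>0 (uhp \<Rightarrow> complex)) \<Rightarrow> (int \<Rightarrow>\<^sub>0 (uhp \<Rightarrow> sym))" where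
  "Phi_pure n v f = (\<Sum>k\<in>weights n. \<Sum>l\<in>Poly_Mapping.keys f.
     Poly_Mapping.single (k + l)
       (\<lambda>\<tau>. scale_sym (Poly_Mapping.lookup f l \<tau>) (Phi_point \<tau> (weight_components n v k))))"

text \<open>The linear extension, which has the same value on all representatives of a coset.\<close>

definition Phi ::
    "nat \<Rightarrow> (sym \<times> (int \<Rightarrow>\<^sub>0 (uhp \<Rightarrow> complex)) \<Rightarrow>\<^sub>0 complex) set \<Rightarrow> (int \<Rightarrow>\<^sub>0 (uhp \<Rightarrow> sym))" where
  "Phi n X = (THE F. \<forall>x\<in>X. F = (\<Sum>p\<in>Poly_Mapping.keys x.
     scale_coeffs scale_sym_fun (Poly_Mapping.lookup x p) (Phi_pure n (fst p) (snd p))))"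

end

theory Submission
  imports Defs "HOL-Complex_Analysis.Complex_Analysis"
begin

text \<open>
  Write \<open>w = 2 \<pi> i E\<^sub>2 / 12\<close> and let \<open>U(\<tau>)\<close> be the product of the upper unipotent matrix with entry
  \<open>\<tau>\<close> and the lower unipotent matrix with entry \<open>w(\<tau>)\<close>, so that \<open>\<Phi>\<^sub>n\<close> acts pointwise as \<open>Sym\<^sup>n U(\<tau>)\<close>.
  The quasi-modularity of \<open>E\<^sub>2\<close> says exactly that \<open>U(\<gamma>\<tau>) = \<gamma> U(\<tau>) diag(j, j\<^sup>-\<^sup>1)\<close> with \<open>j = c\<tau> + d\<close>.
  Hence a vector-valued function \<open>F\<close> transforms with weight \<open>d\<close> under \<open>\<rho>\<^sub>n\<close> iff the coordinate of weight
  \<open>k\<close> of \<open>Sym\<^sup>n U(\<tau>)\<^sup>-\<^sup>1 F(\<tau>)\<close> transforms with weight \<open>d - k\<close>.  As the entries of \<open>U\<close> and of its inverse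
  are holomorphic of polynomial growth at all cusps, so is \<open>F\<close> iff these coordinates are.

  The inversion formula for \<open>E\<^sub>2\<close> comes from a quasi-periodic function in \<open>z\<close> (a Weierstrass zeta
  function up to a linear term) whose linear Taylor coefficient at 0 is a multiple of \<open>E\<^sub>2\<close>.

  For the Hilbert series one needs that the spaces of scalar forms have finite dimension and vanish
  in negative weight.  The function \<open>|f| (Im \<tau>)\<^bsup>k/2\<^esup>\<close> is \<open>\<Gamma>\<close>-invariant; if \<open>f\<close> vanishes to sufficiently
  high order at all cusps (to order 0 suffices if \<open>k < 0\<close>), the maximum principle for the
  \<open>q\<close>-expansions bounds its supremum by a proper fraction of itself.
\<close>

text \<open>Why 1/12: the lower unipotent entry must satisfy w(\<gamma>\<tau>) = j^2 w + c j, and 2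
  \<pi> i / 12 is the scale at which the defect -(6 i / \<pi>) c j of \<open>E\<^sub>2\<close>
  becomes c j. The zeta function is given by a cotangent and two Lambert series that converge
  absolutely in a strip, so its behaviour under the periods is read off from geometric series
  instead of a conditionally convergent lattice sum. Growth conditions rather than boundedness are
  what admit \<tau> itself and \<open>E\<^sub>2\<close>, hence the entries of U and of its inverse.
  The tensor product is a quotient of a huge free space; a coset is determined by its n + 1
  coordinates in the ring of modular forms, and the module axioms are pulled back along \<Phi>
  instead of being checked on cosets. In the finiteness argument Dirichlet approximation takes the
  place of a fundamental domain: every point has a translate of height at least 1/5, which is
  compared with the line of height 1/10 below it. The gap between the two heights produces the
  proper fraction.\<close>

unbundle no Formal_Power_Series.fps_syntax

section \<open>A zeta function and the inversion formula for \<open>E\<^sub>2\<close>\<close>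

text \<open>The term for \<open>m = 0\<close> is 0 because it has the denominator \<open>1 - 1\<close>.\<close>

definition lambert :: "complex \<Rightarrow> complex \<Rightarrow> complex" where
  "lambert q u = suminf (\<lambda>m. q ^ m / (1 - q ^ m) * u ^ m)"

text \<open>The numerator \<open>q ^ m\<close> enlarges the disc of convergence from |u| < 1 to |u|
  < 1/|q|. For u = exp(2 \<pi> i z) and q = exp(2 \<pi> i \<tau>) this is the half-plane Im z > - Im
  \<tau>, so u and 1/u are both admissible in a strip around the real axis.\<close>

lemma summable_lambert:
  fixes q u :: complex
  assumes q: "norm q < 1" and u: "norm (q * u) < 1"
  shows "summable (\<lambda>m. q ^ m / (1 - q ^ m) * u ^ m)"
proof (rule summable_comparison_test')
  show "summable (\<lambda>m. (1 / (1 - norm q)) * norm (q * u) ^ m)"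
    by (intro summable_mult summable_geometric) (use u in auto)
  fix m :: nat assume m: "m \<ge> 1"
  have "norm q ^ m \<le> norm q"
    using power_decreasing[of 1 m "norm q"] m q by simp
  then have "1 - norm q \<le> norm (1 - q ^ m)"
    using norm_triangle_ineq2[of 1 "q ^ m"] by (simp add: norm_power)
  then have "1 / norm (1 - q ^ m) \<le> 1 / (1 - norm q)"
    using q by (intro divide_left_mono) (auto intro!: mult_pos_pos)
  then have "norm (q * u) ^ m * (1 / norm (1 - q ^ m)) \<le> norm (q * u) ^ m * (1 / (1 - norm q))"
    by (intro mult_left_mono) auto
  then show "norm (q ^ m / (1 - q ^ m) * u ^ m) \<le> (1 / (1 - norm q)) * norm (q * u) ^ m"
    by (simp add: norm_mult norm_divide norm_power power_mult_distrib mult_ac)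
qed

lemma power_neq_one:
  fixes q :: complex
  assumes "norm q < 1" "m \<noteq> 0"
  shows "q ^ m \<noteq> 1"
  using assms power_eq_1_iff by fastforce

text \<open>Replacing u by q u multiplies the m-th term by \<open>q ^ m\<close>, so in the
  difference the denominator \<open>1 - q ^ m\<close> cancels and a geometric series remains,
  without its term at m = 0.\<close>

lemma lambert_shift:
  assumes q: "norm q < 1" and u: "norm (q * u) < 1"
  shows "lambert q (q * u) = lambert q u - q * u / (1 - q * u)"
proof -
  have qqu: "norm (q * (q * u)) < 1"
    using mult_strict_mono[of "norm q" 1 "norm (q * u)" 1] q u by (simp add: norm_mult)
  have "lambert q u - lambert q (q * u) =
     suminf (\<lambda>m. q ^ m / (1 - q ^ m) * u ^ m - q ^ m / (1 - q ^ m) * (q * u) ^ m)"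
    unfolding lambert_def
    by (intro suminf_diff summable_lambert q u qqu)
  also have "\<dots> = suminf (\<lambda>m. if m = 0 then 0 else (q * u) ^ m)"
  proof (rule suminf_cong)
    fix m
    have "q ^ m / (1 - q ^ m) * u ^ m - q ^ m / (1 - q ^ m) * (q * u) ^ m
        = (q * u) ^ m" if "m \<noteq> 0"
      using power_neq_one[OF q that] by (simp add: divide_simps power_mult_distrib) (simp add: algebra_simps)
    then show "q ^ m / (1 - q ^ m) * u ^ m - q ^ m / (1 - q ^ m) * (q * u) ^ m
        = (if m = 0 then 0 else (q * u) ^ m)"
      by simp
  qed
  also have "\<dots> = q * u / (1 - q * u)"
  proof -
    have "(\<lambda>m. (q * u) * (q * u) ^ m) sums ((q * u) * (1 / (1 - q * u)))"
      by (intro sums_mult geometric_sums u)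
    then have "(\<lambda>m. (\<lambda>m. if m = 0 then 0 else (q * u) ^ m) (Suc m)) sums (q * u / (1 - q * u))"
      by simp
    then have "(\<lambda>m. if m = 0 then 0 else (q * u) ^ m) sums (q * u / (1 - q * u) + 0)"
      by (subst (asm) sums_Suc_iff) simp
    then show ?thesis
      by (simp add: sums_iff)
  qed
  finally show ?thesis by (simp add: algebra_simps)
qed

definition sigma_series :: "complex \<Rightarrow> complex" where
  "sigma_series q = suminf (\<lambda>m. of_nat (\<Sum>{d. d dvd Suc m}) * q ^ Suc m)"

lemma has_sum_geometric_Suc:
  fixes x :: "'a :: {banach, real_normed_field}"
  assumes "norm x < 1"
  shows "((\<lambda>k. c * x ^ Suc k) has_sum (c * (x / (1 - x)))) UNIV"
proof -
  have "((\<lambda>k. x ^ k) has_sum (1 / (1 - x))) UNIV"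
    using assms by (intro norm_summable_imp_has_sum geometric_sums)
      (auto intro!: summable_geometric simp: norm_power)
  then show ?thesis
    using has_sum_cmult_right[of _ _ _ "c * x"] by (force simp: mult_ac)
qed

text \<open>Both series sum \<open>n * q ^ (n * k)\<close> over all pairs of positive n and k: for
  fixed n the sum over k is geometric, and collecting the pairs with the same product n k gives the
  divisor sums.\<close>

lemma lambert_sigma:
  fixes q :: complex
  assumes q: "norm q < 1"
  shows "(\<lambda>m. of_nat (\<Sum>{d. d dvd Suc m}) * q ^ Suc m) sums
           suminf (\<lambda>m. of_nat (Suc m) * (q ^ Suc m / (1 - q ^ Suc m)))"
proof -
  define g where "g = (\<lambda>(m, k). of_nat (Suc m) * q ^ (Suc m * Suc k))"
  define b where "b = (\<lambda>m. of_nat (Suc m) * (q ^ Suc m / (1 - q ^ Suc m)))"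
  have nq: "norm q ^ Suc m \<le> norm q" for m
    using power_decreasing[of 1 "Suc m" "norm q"] q by simp
  have inner: "((\<lambda>k. g (m, k)) has_sum b m) UNIV" for m
    using has_sum_geometric_Suc[of "q ^ Suc m" "of_nat (Suc m)"] nq[of m] q
    unfolding g_def b_def by (simp add: norm_power del: of_nat_Suc power_Suc flip: power_mult)
  have inner_norm: "((\<lambda>k. norm (g (m, k))) has_sum
      (of_nat (Suc m) * (norm q ^ Suc m / (1 - norm q ^ Suc m)))) UNIV" for m
    using has_sum_geometric_Suc[of "norm q ^ Suc m" "of_nat (Suc m)"] nq[of m] q
    unfolding g_def by (simp add: norm_power norm_mult del: of_nat_Suc power_Suc flip: power_mult)
  have outer: "summable (\<lambda>m. real (Suc m) * (norm q ^ Suc m / (1 - norm q ^ Suc m)))"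
  proof (rule summable_comparison_test')
    show "summable (\<lambda>m. norm q / (1 - norm q) * (real (Suc m) * norm q ^ m))"
      using geometric_deriv_sums[of "norm q"] q by (intro summable_mult) (auto simp: sums_iff)
    fix m :: nat
    have "norm q ^ Suc m / (1 - norm q ^ Suc m) \<le> norm q ^ Suc m / (1 - norm q)"
      using nq[of m] q by (intro divide_left_mono mult_pos_pos) auto
    then have "real (Suc m) * (norm q ^ Suc m / (1 - norm q ^ Suc m)) \<le> real (Suc m) * (norm q ^ Suc m / (1 - norm q))"
      by (intro mult_left_mono) auto
    then show "norm (real (Suc m) * (norm q ^ Suc m / (1 - norm q ^ Suc m))) \<le> norm q / (1 - norm q) * (real (Suc m) * norm q ^ m)"
      using nq[of m] q by (simp add: mult_ac abs_mult)
  qed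
  \<comment> \<open>Absolute summability over pairs permits both orders of summation.\<close>
  have "(\<lambda>p. norm (g p)) summable_on (UNIV \<times> UNIV)"
    unfolding Infinite_Sum.abs_summable_on_Sigma_iff
  proof (intro conjI ballI)
    fix m :: nat
    show "(\<lambda>k. norm (g (m, k))) summable_on UNIV"
      using inner_norm[of m] by (auto simp: summable_on_def)
    have "norm (infsum (\<lambda>k. norm (g (m, k))) UNIV) = real (Suc m) * (norm q ^ Suc m / (1 - norm q ^ Suc m))" for m
      using infsumI[OF inner_norm[of m]] infsum_nonneg[of UNIV "\<lambda>k. norm (g (m, k))"] by (metis abs_of_nonneg norm_ge_zero real_norm_def)
    moreover have "(\<lambda>m. real (Suc m) * (norm q ^ Suc m / (1 - norm q ^ Suc m))) summable_on UNIV"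
      using outer order.trans[OF nq less_imp_le[OF q]]
      by (subst summable_on_UNIV_nonneg_real_iff) (auto intro!: divide_nonneg_nonneg mult_nonneg_nonneg)
    ultimately show "(\<lambda>m. norm (infsum (\<lambda>k. norm (g (m, k))) UNIV)) summable_on UNIV"
      by simp
  qed
  then obtain s where s: "(g has_sum s) (UNIV \<times> UNIV)"
    using Infinite_Sum.abs_summable_summable summable_on_def by blast
  have "(b has_sum s) UNIV"
    using has_sum_SigmaD[OF s] inner by auto
  then have b: "b sums s" by (rule has_sum_imp_sums)
  \<comment> \<open>All indices are off by one: \<open>(m, k)\<close> stands for the factors
    \<open>Suc m\<close> and \<open>Suc k\<close>, whose product is \<open>Suc N\<close> with
    \<open>N = m * k + m + k\<close>, and the divisor \<open>d\<close> is
    \<open>Suc m\<close>.\<close>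
  have "((\<lambda>(N, d). of_nat d * q ^ Suc N) has_sum s) (SIGMA N:UNIV. {d. d dvd Suc N})"
  proof (rule has_sum_reindex_bij_witness[where j = "\<lambda>(m, k). (m * k + m + k, Suc m)"
        and i = "\<lambda>(N, d). (d - 1, Suc N div d - 1)" and g = g and S = "UNIV \<times> UNIV", THEN iffD1], goal_cases)
    case (1 a)
    have "Suc (m * k + m + k) div Suc m = Suc k" for m k
      using nonzero_mult_div_cancel_left[of "Suc m" "Suc k"] by (simp add: algebra_simps)
    then show ?case by (auto split: prod.splits)
  next
    case (2 a)
    have "Suc m dvd Suc (m * k + m + k)" for m k
      using dvd_triv_left[of "Suc m" "Suc k"] by (simp add: algebra_simps)
    then show ?case by (auto split: prod.splits)
  next
    case (3 b)
    then obtain N d where b: "b = (N, d)" "d dvd Suc N" by auto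
    then obtain k where k: "Suc N = d * k" by (auto elim: dvdE)
    then obtain d' k' where "d = Suc d'" "k = Suc k'" by (cases d; cases k) auto
    with k b show ?case using nonzero_mult_div_cancel_left[of "Suc d'" "Suc k'"] by (simp add: algebra_simps)
  qed (use s in \<open>auto simp: g_def algebra_simps\<close>)
  then have "((\<lambda>N. \<Sum>d | d dvd Suc N. of_nat d * q ^ Suc N) has_sum s) UNIV"
    by (rule has_sum_SigmaD) auto
  then have "(\<lambda>N. \<Sum>d | d dvd Suc N. of_nat d * q ^ Suc N) sums s"
    by (rule has_sum_imp_sums)
  then show ?thesis
    using b by (simp add: b_def sums_iff sum_distrib_right)
qed

section \<open>The cotangent with its pole at 0 removed\<close>

definition sin_pi_quot :: "complex \<Rightarrow> complex" where
  "sin_pi_quot z = (if z = 0 then of_real pi else sin (of_real pi * z) / z)"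

lemma holomorphic_sin_pi_quot: "sin_pi_quot holomorphic_on A"
proof -
  have "((\<lambda>z. sin (of_real pi * z)) has_field_derivative of_real pi) (at (0::complex))"
    by (auto intro!: derivative_eq_intros)
  then have "deriv (\<lambda>z::complex. sin (of_real pi * z)) 0 = of_real pi"
    by (rule DERIV_imp_deriv)
  moreover have "(\<lambda>z. if z = 0 then deriv (\<lambda>z. sin (of_real pi * z)) 0
      else (sin (of_real pi * z) - sin (of_real pi * 0)) / (z - 0)) holomorphic_on (UNIV :: complex set)"
    by (intro pole_lemma holomorphic_intros) auto
  ultimately have "sin_pi_quot holomorphic_on UNIV"
    by (simp add: sin_pi_quot_def[abs_def] cong: if_cong)
  then show ?thesis by (rule holomorphic_on_subset) auto
qed

lemma sin_pi_quot_mult: "z * sin_pi_quot z = sin (of_real pi * z)"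
  by (simp add: sin_pi_quot_def)

text \<open>Repeated differentiation of z s(z) = sin(\<pi> z), where s is
  \<open>sin_pi_quot\<close>. At z = 0 the factor z removes the highest derivative in each identity,
  so the values at 0 come out one order at a time.\<close>

lemma sin_pi_quot_derivs:
  shows "sin_pi_quot z + z * deriv sin_pi_quot z = of_real pi * cos (of_real pi * z)" (is ?th1)
    and "deriv sin_pi_quot 0 = 0" (is ?th2)
    and "deriv (deriv sin_pi_quot) 0 = - (of_real pi ^ 3) / 3" (is ?th3)
proof -
  let ?s = sin_pi_quot and ?s1 = "deriv sin_pi_quot" and ?s2 = "deriv (deriv sin_pi_quot)"
    and ?s3 = "deriv (deriv (deriv sin_pi_quot))"
  have hol: "?s holomorphic_on UNIV" "?s1 holomorphic_on UNIV" "?s2 holomorphic_on UNIV"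
    by (intro holomorphic_deriv holomorphic_sin_pi_quot open_UNIV)+
  have D: "(?s has_field_derivative ?s1 z) (at z)" "(?s1 has_field_derivative ?s2 z) (at z)"
    "(?s2 has_field_derivative ?s3 z) (at z)" for z
    using hol by (auto intro!: holomorphic_derivI[of _ UNIV])
  have 1: "?s z + z * ?s1 z = of_real pi * cos (of_real pi * z)" for z
  proof (rule DERIV_unique)
    show "((\<lambda>z. z * ?s z) has_field_derivative (?s z + z * ?s1 z)) (at z)"
      by (auto intro!: derivative_eq_intros D)
    show "((\<lambda>z. z * ?s z) has_field_derivative (of_real pi * cos (of_real pi * z))) (at z)"
      unfolding sin_pi_quot_mult by (auto intro!: derivative_eq_intros)
  qed
  then show ?th1 .
  have 2: "2 * ?s1 z + z * ?s2 z = - (of_real pi ^ 2) * sin (of_real pi * z)" for z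
  proof (rule DERIV_unique)
    show "((\<lambda>z. ?s z + z * ?s1 z) has_field_derivative (2 * ?s1 z + z * ?s2 z)) (at z)"
      by (auto intro!: derivative_eq_intros D)
    show "((\<lambda>z. ?s z + z * ?s1 z) has_field_derivative - (of_real pi ^ 2) * sin (of_real pi * z)) (at z)"
      unfolding 1 by (auto intro!: derivative_eq_intros simp: power2_eq_square)
  qed
  from 2[of 0] show ?th2 by simp
  have 3: "3 * ?s2 z + z * ?s3 z = - (of_real pi ^ 3) * cos (of_real pi * z)" for z
  proof (rule DERIV_unique)
    show "((\<lambda>z. 2 * ?s1 z + z * ?s2 z) has_field_derivative (3 * ?s2 z + z * ?s3 z)) (at z)"
      by (auto intro!: derivative_eq_intros D)
    show "((\<lambda>z. 2 * ?s1 z + z * ?s2 z) has_field_derivative - (of_real pi ^ 3) * cos (of_real pi * z)) (at z)"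
      unfolding 2 by (auto intro!: derivative_eq_intros simp: power2_eq_square power3_eq_cube)
  qed
  from 3[of 0] show ?th3 by (simp add: field_simps)
qed

text \<open>The logarithmic derivative of sin(\<pi> z) / z, that is \<pi> cot(\<pi> z) - 1/z
  continued over 0; the poles at the other integers remain.\<close>

definition cot_regular :: "complex \<Rightarrow> complex" where
  "cot_regular z = deriv sin_pi_quot z / sin_pi_quot z"

lemma sin_pi_eq_0_iff: "sin (of_real pi * z) = 0 \<longleftrightarrow> z \<in> \<int>" for z :: complex
proof -
  have "sin (of_real pi * z) = 0 \<longleftrightarrow> (\<exists>n::int. of_real pi * z = of_real (of_int n * pi))"
    by (simp add: sin_eq_0)
  also have "\<dots> \<longleftrightarrow> (\<exists>n::int. z = of_int n)" by auto
  finally show ?thesis by (auto simp: Ints_def)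
qed

lemma sin_pi_quot_nonzero: "z \<in> - (\<int> - {0}) \<Longrightarrow> sin_pi_quot z \<noteq> 0"
  by (auto simp: sin_pi_quot_def sin_pi_eq_0_iff)

lemma cot_regular_eq:
  assumes "z \<notin> \<int>"
  shows "cot_regular z = of_real pi * cot (of_real pi * z) - 1 / z"
proof -
  have z: "z \<noteq> 0" "sin (of_real pi * z) \<noteq> 0" using assms sin_pi_eq_0_iff[of z] by auto
  have "deriv sin_pi_quot z = (of_real pi * cos (of_real pi * z) - sin (of_real pi * z) / z) / z"
    using sin_pi_quot_derivs(1)[of z] z by (simp add: sin_pi_quot_def field_simps)
  then show ?thesis
    using z by (simp add: cot_regular_def sin_pi_quot_def cot_def field_simps)
qed

lemma holomorphic_cot_regular: "A \<subseteq> - (\<int> - {0}) \<Longrightarrow> cot_regular holomorphic_on A"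
  unfolding cot_regular_def[abs_def]
  by (intro holomorphic_on_divide holomorphic_sin_pi_quot
      holomorphic_on_subset[OF holomorphic_deriv[OF holomorphic_sin_pi_quot[of UNIV]], of A])
    (use sin_pi_quot_nonzero in auto)

lemma cot_regular_deriv_0: "(cot_regular has_field_derivative - (of_real pi ^ 2) / 3) (at 0)"
proof -
  have hol: "sin_pi_quot holomorphic_on UNIV" "deriv sin_pi_quot holomorphic_on UNIV"
    by (intro holomorphic_deriv holomorphic_sin_pi_quot open_UNIV)+
  have "(cot_regular has_field_derivative
    (deriv (deriv sin_pi_quot) 0 * sin_pi_quot 0 - deriv sin_pi_quot 0 * deriv sin_pi_quot 0)
       / (sin_pi_quot 0 * sin_pi_quot 0)) (at 0)"
    unfolding cot_regular_def[abs_def]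
    by (intro DERIV_divide holomorphic_derivI[of _ UNIV] hol sin_pi_quot_nonzero) auto
  then show ?thesis
    by (simp add: sin_pi_quot_derivs sin_pi_quot_def power2_eq_square power3_eq_cube)
qed

lemma cot_pi_exp:
  assumes "z \<notin> \<int>"
  shows "cot (of_real pi * z) = - \<i> * (1 + 2 * (exp (2 * of_real pi * \<i> * z) / (1 - exp (2 * of_real pi * \<i> * z))))"
proof -
  define e where "e = exp (\<i> * (of_real pi * z))"
  have e: "e \<noteq> 0" by (simp add: e_def)
  have e2: "exp (2 * of_real pi * \<i> * z) = e\<^sup>2"
    by (simp add: e_def mult_ac flip: exp_double)
  have s: "sin (of_real pi * z) = (e - 1 / e) / (2 * \<i>)" and c: "cos (of_real pi * z) = (e + 1 / e) / 2"
    by (simp_all add: sin_exp_eq cos_exp_eq e_def exp_minus field_simps)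
  have "e\<^sup>2 \<noteq> 1"
    using assms s e sin_pi_eq_0_iff[of z] by (auto simp: field_simps power2_eq_square)
  then show ?thesis
    unfolding cot_def s c e2 using e
    by (simp add: divide_simps power2_eq_square)
qed

section \<open>The quasi-periodic zeta function and its behaviour under the periods 1 and
  \<tau>\<close>

definition nome :: "complex \<Rightarrow> complex" where
  "nome z = exp (2 * of_real pi * \<i> * z)"

lemma nome_nonzero [simp]: "nome z \<noteq> 0"
  by (simp add: nome_def)

lemma nome_add: "nome (z + w) = nome z * nome w"
  by (simp add: nome_def exp_add algebra_simps)

lemma nome_minus: "nome (- z) = inverse (nome z)"
  by (simp add: nome_def exp_minus)

lemma norm_nome: "norm (nome z) = exp (- (2 * pi * Im z))"
  by (simp add: nome_def)

lemma norm_nome_less_1_iff: "norm (nome z) < 1 \<longleftrightarrow> Im z > 0"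
  by (simp add: norm_nome zero_less_mult_iff)

lemma nome_of_1 [simp]: "nome 1 = 1"
  by (simp add: nome_def)

lemma nome_0 [simp]: "nome 0 = 1"
  by (simp add: nome_def)

lemma nome_eq_1_iff: "nome z = 1 \<longleftrightarrow> z \<in> \<int>"
proof -
  have "nome z = 1 \<longleftrightarrow> (\<exists>n::int. Im z = 0 \<and> Re z = of_int n)"
    by (auto simp: nome_def exp_eq_1)
  also have "\<dots> \<longleftrightarrow> z \<in> \<int>"
    by (auto simp: Ints_def complex_eq_iff)
  finally show ?thesis .
qed

lemma E2_eq: "Eisenstein_E2 z = 1 - 24 * sigma_series (nome z)"
  by (simp add: Eisenstein_E2_def sigma_series_def nome_def mult_ac flip: exp_of_nat_mult del: of_nat_Suc power_Suc)

text \<open>After adding 1/z this is the Weierstrass zeta function of the lattice spanned by 1 and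
  \<tau>, minus (\<pi>^2/3) \<open>E\<^sub>2\<close> z. Removing that linear term makes 1 an exact
  period and moves the whole defect to the period \<tau>.\<close>

definition zeta_regular :: "complex \<Rightarrow> complex \<Rightarrow> complex" where
  "zeta_regular \<tau> z = cot_regular z -
     2 * of_real pi * \<i> * (lambert (nome \<tau>) (nome z) - lambert (nome \<tau>) (nome (- z)))"

lemma lambert_DERIV:
  assumes q: "norm q < 1" "q \<noteq> 0" and u: "norm (q * u) < 1"
  shows "(lambert q has_field_derivative deriv (lambert q) u) (at u)"
    and "deriv (lambert q) u = suminf (\<lambda>m. diffs (\<lambda>m. q ^ m / (1 - q ^ m)) m * u ^ m)"
proof -
  have "((\<lambda>u. suminf (\<lambda>m. q ^ m / (1 - q ^ m) * u ^ m)) has_field_derivative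
      suminf (\<lambda>m. diffs (\<lambda>m. q ^ m / (1 - q ^ m)) m * u ^ m)) (at u)"
  proof (rule termdiffs_strong'[where K = "1 / norm q"])
    show "summable (\<lambda>m. q ^ m / (1 - q ^ m) * z ^ m)" if "norm z < 1 / norm q" for z
      using that q by (intro summable_lambert) (auto simp: field_simps norm_mult)
  qed (use u q in \<open>auto simp: field_simps norm_mult\<close>)
  then show "(lambert q has_field_derivative deriv (lambert q) u) (at u)"
    "deriv (lambert q) u = suminf (\<lambda>m. diffs (\<lambda>m. q ^ m / (1 - q ^ m)) m * u ^ m)"
    by (simp_all add: DERIV_imp_deriv lambert_def[abs_def])
qed

text \<open>Differentiation at u = 1 brings the factor m into the series, which then is the Lambert
  form of the divisor series.\<close>

lemma deriv_lambert_1: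
  assumes "norm q < 1" "q \<noteq> 0"
  shows "deriv (lambert q) 1 = sigma_series q"
  using lambert_DERIV(2)[of q 1] lambert_sigma[OF assms(1)] assms
  by (simp add: sigma_series_def sums_iff diffs_def)

lemma nome_mult_less_1:
  "norm (nome \<tau> * nome z) < 1 \<longleftrightarrow> Im z > - Im \<tau>"
  by (simp flip: nome_add add: norm_nome_less_1_iff) linarith

lemma zeta_regular_holomorphic:
  assumes \<tau>: "Im \<tau> > 0"
  shows "zeta_regular \<tau> holomorphic_on ({z. \<bar>Im z\<bar> < Im \<tau>} - (\<int> - {0}))"
proof -
  have L: "lambert (nome \<tau>) holomorphic_on {u. norm (nome \<tau> * u) < 1}"
  proof (intro holomorphic_onI)
    fix u assume "u \<in> {u. norm (nome \<tau> * u) < 1}"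
    then show "lambert (nome \<tau>) field_differentiable at u within {u. norm (nome \<tau> * u) < 1}"
      using lambert_DERIV(1)[of "nome \<tau>" u] \<tau>
      by (auto simp: field_differentiable_def norm_nome_less_1_iff intro: DERIV_subset)
  qed
  have n: "nome holomorphic_on A" "(\<lambda>z. nome (- z)) holomorphic_on A" for A
    unfolding nome_def by (intro holomorphic_intros)+
  have "(\<lambda>z. lambert (nome \<tau>) (nome z)) holomorphic_on ({z. \<bar>Im z\<bar> < Im \<tau>} - (\<int> - {0}))"
    "(\<lambda>z. lambert (nome \<tau>) (nome (- z))) holomorphic_on ({z. \<bar>Im z\<bar> < Im \<tau>} - (\<int> - {0}))"
    by (rule holomorphic_on_compose_gen[OF n(1) L, unfolded o_def] holomorphic_on_compose_gen[OF n(2) L, unfolded o_def];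
        auto simp: nome_mult_less_1 norm_nome_less_1_iff \<tau>)+
  then show ?thesis
    unfolding zeta_regular_def by (intro holomorphic_intros holomorphic_cot_regular) auto
qed

text \<open>The cotangent contributes -\<pi>^2/3, the two Lambert series together 8 \<pi>^2 times
  the divisor series; the ratio -24 is the coefficient in \<open>E\<^sub>2\<close>.\<close>

lemma zeta_regular_deriv_0:
  assumes \<tau>: "Im \<tau> > 0"
  shows "(zeta_regular \<tau> has_field_derivative - (of_real pi ^ 2 / 3) * Eisenstein_E2 \<tau>) (at 0)"
proof -
  have q: "norm (nome \<tau>) < 1" using \<tau> by (simp add: norm_nome_less_1_iff)
  have n: "(nome has_field_derivative 2 * of_real pi * \<i>) (at 0)"
    unfolding nome_def[abs_def] by (auto intro!: derivative_eq_intros)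
  have n': "((\<lambda>z. nome (- z)) has_field_derivative - (2 * of_real pi * \<i>)) (at 0)"
    unfolding nome_def[abs_def] by (auto intro!: derivative_eq_intros)
  have l: "(lambert (nome \<tau>) has_field_derivative sigma_series (nome \<tau>)) (at 1)"
    using lambert_DERIV(1)[of "nome \<tau>" 1] q by (simp add: deriv_lambert_1)
  have 1: "((\<lambda>z. lambert (nome \<tau>) (nome z)) has_field_derivative
      sigma_series (nome \<tau>) * (2 * of_real pi * \<i>)) (at 0)"
    by (rule DERIV_chain2[OF _ n]) (use l in simp)
  have 2: "((\<lambda>z. lambert (nome \<tau>) (nome (- z))) has_field_derivative
      sigma_series (nome \<tau>) * - (2 * of_real pi * \<i>)) (at 0)"
    by (rule DERIV_chain2[OF _ n']) (use l in simp)
  have "(zeta_regular \<tau> has_field_derivative - (of_real pi ^ 2 / 3) -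
     2 * of_real pi * \<i> * (sigma_series (nome \<tau>) * (2 * of_real pi * \<i>) - sigma_series (nome \<tau>) * - (2 * of_real pi * \<i>))) (at 0)"
    unfolding zeta_regular_def[abs_def]
    by (intro DERIV_diff DERIV_cmult cot_regular_deriv_0[unfolded minus_divide_left[symmetric]] 1 2)
  moreover have "- (of_real pi ^ 2 / 3) -
     2 * of_real pi * \<i> * (sigma_series (nome \<tau>) * (2 * of_real pi * \<i>) - sigma_series (nome \<tau>) * - (2 * of_real pi * \<i>))
     = - (of_real pi ^ 2 / 3) * Eisenstein_E2 \<tau>"
    by (simp add: E2_eq algebra_simps power2_eq_square)
  ultimately show ?thesis by simp
qed

lemma zeta_regular_plus_1:
  assumes "z \<notin> \<int>"
  shows "zeta_regular \<tau> (z + 1) + 1 / (z + 1) = zeta_regular \<tau> z + 1 / z"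
proof -
  have z1: "z + 1 \<notin> \<int>" using assms Ints_diff[of "z + 1" 1] by auto
  have "nome (- (z + 1)) = nome (- z)" "nome (z + 1) = nome z"
    unfolding nome_minus nome_add by simp_all
  moreover from this have "cot (of_real pi * (z + 1)) = cot (of_real pi * z)"
    using cot_pi_exp[OF assms] cot_pi_exp[OF z1] by (simp add: nome_def)
  ultimately show ?thesis
    using assms z1 by (simp add: zeta_regular_def cot_regular_eq)
qed

text \<open>The hypotheses put z and z + \<tau> into the strip of convergence, on opposite sides of
  the real axis. The Lambert shift at u cancels the cotangent term at z + \<tau>; the shift for the
  inverse argument leaves u/(1 - u) - 1/(1 - u) = -1 against the cotangent term at z, whence the
  constant 2 \<pi> i.\<close>

lemma zeta_regular_plus_period:
  assumes \<tau>: "Im \<tau> > 0" and z: "- Im \<tau> < Im z" "Im z < 0"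
  shows "zeta_regular \<tau> (z + \<tau>) + 1 / (z + \<tau>) = zeta_regular \<tau> z + 1 / z - 2 * of_real pi * \<i>"
proof -
  have nz: "z \<notin> \<int>" "z + \<tau> \<notin> \<int>" using z by (auto elim!: Ints_cases simp: complex_eq_iff)
  define u q where "u = nome z" and "q = nome \<tau>"
  have [simp]: "u \<noteq> 0" "q \<noteq> 0" by (auto simp: u_def q_def)
  have u1: "u \<noteq> 1" "q * u \<noteq> 1"
    using nz by (auto simp: u_def q_def add.commute nome_eq_1_iff simp flip: nome_add)
  have q1: "norm q < 1" using \<tau> by (simp add: q_def norm_nome_less_1_iff)
  have "norm (q * u) < 1" using z by (simp add: u_def q_def nome_mult_less_1)
  then have l1: "lambert q (q * u) = lambert q u - q * u / (1 - q * u)"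
    by (intro lambert_shift q1)
  have e: "nome (- (z + \<tau>)) = 1 / (q * u)"
    unfolding nome_minus nome_add by (simp add: u_def q_def field_simps)
  have "norm (q * (1 / (q * u))) < 1"
    using z by (simp add: u_def norm_divide norm_nome mult_less_0_iff)
  then have l2: "lambert q (1 / u) = lambert q (1 / (q * u)) - (1 / u) / (1 - 1 / u)"
    using lambert_shift[OF q1, of "1 / (q * u)"] by simp
  have c: "cot (of_real pi * z) = - \<i> * (1 + 2 * (u / (1 - u)))"
    "cot (of_real pi * (z + \<tau>)) = - \<i> * (1 + 2 * ((q * u) / (1 - q * u)))"
    using cot_pi_exp[OF nz(1)] cot_pi_exp[OF nz(2)]
    unfolding nome_def[symmetric] nome_add u_def q_def by (simp_all only: mult.commute)
  have A: "zeta_regular \<tau> (z + \<tau>) + 1 / (z + \<tau>) =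
     of_real pi * (- \<i> * (1 + 2 * ((q * u) / (1 - q * u)))) -
     2 * of_real pi * \<i> * (lambert q (q * u) - lambert q (1 / (q * u)))"
    using nz(2) unfolding zeta_regular_def e
    by (simp add: cot_regular_eq c nome_add q_def[symmetric] u_def[symmetric] mult.commute[of u])
  have B: "zeta_regular \<tau> z + 1 / z =
     of_real pi * (- \<i> * (1 + 2 * (u / (1 - u)))) -
     2 * of_real pi * \<i> * (lambert q u - lambert q (1 / u))"
    using nz(1) by (simp add: zeta_regular_def cot_regular_eq c q_def[symmetric] u_def[symmetric] nome_minus inverse_eq_divide)
  show ?thesis
    unfolding A B l1 l2 using u1 by (simp add: divide_simps) (simp add: algebra_simps)
qed

lemma Im_divide_self:
  assumes "\<tau> \<noteq> 0"
  shows "Im ((of_real x + of_real y * \<tau>) / \<tau>) = x * Im (1 / \<tau>)"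
proof -
  have "(of_real x + of_real y * \<tau>) / \<tau> = of_real x * (1 / \<tau>) + of_real y"
    using assms by (simp add: field_simps)
  then show ?thesis
    by (simp only: plus_complex.simps times_complex.simps Re_complex_of_real Im_complex_of_real)
qed

text \<open>
  The zeta functions for \<open>\<tau>\<close> and \<open>-1/\<tau>\<close> agree up to scaling and a linear term: the difference is
  regular on a neighbourhood of a period parallelogram and doubly periodic, so its modulus attains
  its maximum there at an interior point.
\<close>
lemma zeta_regular_inversion:
  fixes \<tau> :: complex
  assumes \<tau>: "Im \<tau> > 0"
  defines "\<tau>' \<equiv> - 1 / \<tau>"
  defines "R \<equiv> {z. \<bar>Im z\<bar> < Im \<tau>} \<inter> {z. \<bar>Im (z / \<tau>)\<bar> < Im \<tau>'}"
  defines "L \<equiv> \<lambda>z. zeta_regular \<tau>' (z / \<tau>) / \<tau> - zeta_regular \<tau> z - 2 * of_real pi * \<i> * z / \<tau>"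
  shows "L constant_on R" "open R" "0 \<in> R"
proof -
  have \<tau>0 [simp]: "\<tau> \<noteq> 0" using \<tau> by auto
  have \<tau>': "Im \<tau>' > 0"
    using \<tau> by (simp add: \<tau>'_def Im_divide divide_simps sum_power2_gt_zero_iff)
  have Im1: "Im (1 / \<tau>) = - Im \<tau>'" by (simp add: \<tau>'_def)
  \<comment> \<open>Im z measures y and Im (z/\<tau>) measures x, so \<open>R\<close> is the open
    parallelogram |x|, |y| < 1, whose only lattice point is 0.\<close>
  have R_iff: "of_real x + of_real y * \<tau> \<in> R \<longleftrightarrow> \<bar>x\<bar> < 1 \<and> \<bar>y\<bar> < 1" for x y
  proof -
    have "\<bar>Im (of_real x + of_real y * \<tau>)\<bar> < Im \<tau> \<longleftrightarrow> \<bar>y\<bar> < 1"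
      using \<tau> by (simp add: abs_mult)
    moreover have "\<bar>Im ((of_real x + of_real y * \<tau>) / \<tau>)\<bar> < Im \<tau>' \<longleftrightarrow> \<bar>x\<bar> < 1"
      using \<tau>' by (simp add: Im_divide_self Im1 abs_mult)
    ultimately show ?thesis unfolding R_def by blast
  qed
  have coords: "\<exists>x y. z = of_real x + of_real y * \<tau>" for z
    by (rule exI[of _ "Re z - Im z / Im \<tau> * Re \<tau>"], rule exI[of _ "Im z / Im \<tau>"])
       (use \<tau> in \<open>simp add: complex_eq_iff\<close>)
  have opn1: "open {z. \<bar>Im z\<bar> < Im \<tau>}" "open {z. \<bar>Im (z / \<tau>)\<bar> < Im \<tau>'}"
    by (intro open_Collect_less continuous_intros; simp)+
  then show opn: "open R" unfolding R_def by blast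
  show "0 \<in> R" using \<tau> \<tau>' by (simp add: R_def)
  have R_Int: "z = 0" if "z \<in> R" "z \<in> \<int>" for z
  proof -
    from \<open>z \<in> \<int>\<close> obtain n where n: "z = of_int n" by (rule Ints_cases)
    have "\<bar>real_of_int n\<bar> < 1"
      using R_iff[of "of_int n" 0] that n by simp
    then show ?thesis using n by simp
  qed
  have R_Int': "z = 0" if "z \<in> R" "z / \<tau> \<in> \<int>" for z
  proof -
    from \<open>z / \<tau> \<in> \<int>\<close> obtain n where n: "z / \<tau> = of_int n" by (rule Ints_cases)
    then have "z = of_int n * \<tau>" by (simp add: field_simps)
    then have "\<bar>real_of_int n\<bar> < 1"
      using R_iff[of 0 "of_int n"] that by simp
    then have "n = 0" by linarith
    then show ?thesis using n by simp
  qed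
  have hol: "L holomorphic_on R"
  proof -
    have "zeta_regular \<tau> holomorphic_on R"
      by (rule holomorphic_on_subset[OF zeta_regular_holomorphic[OF \<tau>]]) (use R_Int in \<open>auto simp: R_def\<close>)
    moreover have "(zeta_regular \<tau>' \<circ> (\<lambda>z. z / \<tau>)) holomorphic_on R"
      by (rule holomorphic_on_compose_gen[OF _ zeta_regular_holomorphic[OF \<tau>']])
         (use R_Int' in \<open>auto simp: R_def intro!: holomorphic_intros\<close>)
    ultimately show ?thesis
      unfolding L_def o_def by (intro holomorphic_intros) auto
  qed
  \<comment> \<open>Along \<tau> the rescaled zeta function moves by its exact period 1 while the
    one for \<tau> drops by 2 \<pi> i, and the linear term of \<open>L\<close> compensates. The
    polar terms 1/z cancel in \<open>L\<close>.\<close>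
  have per_tau: "L (z + \<tau>) = L z" if "z \<in> R" "z + \<tau> \<in> R" "Im z < 0" for z
  proof -
    have "z \<noteq> 0" "z + \<tau> \<noteq> 0" using that \<tau> R_iff[of 0 "-1"] R_iff[of 0 1] by (auto simp: add_eq_0_iff2)
    then have "z / \<tau> \<notin> \<int>" using R_Int' that by blast
    moreover have e: "(z + \<tau>) / \<tau> = z / \<tau> + 1" by (simp add: field_simps)
    moreover have "1 / ((z + \<tau>) / \<tau>) = \<tau> / (z + \<tau>)" "1 / (z / \<tau>) = \<tau> / z" by simp_all
    ultimately have 1: "zeta_regular \<tau>' ((z + \<tau>) / \<tau>) = zeta_regular \<tau>' (z / \<tau>) + \<tau> / z - \<tau> / (z + \<tau>)"
      using zeta_regular_plus_1[of "z / \<tau>" \<tau>'] by (simp only: eq_diff_eq not_False_eq_True)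
    have 2: "zeta_regular \<tau> (z + \<tau>) = zeta_regular \<tau> z + 1 / z - 2 * of_real pi * \<i> - 1 / (z + \<tau>)"
      using zeta_regular_plus_period[OF \<tau>, of z] that by (simp add: R_def algebra_simps)
    have "L (z + \<tau>) = L z + (\<tau> / z - \<tau> / (z + \<tau>)) / \<tau> - (1 / z - 1 / (z + \<tau>))
      + 2 * of_real pi * \<i> - 2 * of_real pi * \<i> * \<tau> / \<tau>"
      unfolding L_def 1 2 by (simp add: add_divide_distrib diff_divide_distrib ring_distribs)
    then show ?thesis
      by (simp add: diff_divide_distrib)
  qed
  \<comment> \<open>Division by \<tau> turns the step 1 into a step by - \<tau>', so the
    quasi-period is applied at (z + 1)/\<tau>; the condition \<open>Im (z / \<tau>) > 0\<close>
    keeps that point above - Im \<tau>'.\<close>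
  have per_1: "L (z + 1) = L z" if "z \<in> R" "z + 1 \<in> R" "Im (z / \<tau>) > 0" for z
  proof -
    have nz: "z \<noteq> 0" "z + 1 \<noteq> 0" using that R_iff[of "-1" 0] R_iff[of 1 0] by (auto simp: add_eq_0_iff2)
    then have zi: "z \<notin> \<int>" using R_Int that by blast
    have 1: "zeta_regular \<tau> (z + 1) = zeta_regular \<tau> z + 1 / z - 1 / (z + 1)"
      using zeta_regular_plus_1[OF zi, of \<tau>] by (simp add: algebra_simps)
    have e: "(z + 1) / \<tau> + \<tau>' = z / \<tau>" by (simp add: \<tau>'_def field_simps)
    then have "Im ((z + 1) / \<tau>) = Im (z / \<tau>) - Im \<tau>'" by (metis add_diff_cancel minus_complex.simps(2))
    moreover have "Im (z / \<tau>) < Im \<tau>'" using that by (auto simp: R_def)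
    ultimately have "zeta_regular \<tau>' (z / \<tau>) + \<tau> / z = zeta_regular \<tau>' ((z + 1) / \<tau>) + \<tau> / (z + 1) - 2 * of_real pi * \<i>"
      using zeta_regular_plus_period[OF \<tau>', of "(z + 1) / \<tau>"] that by (simp add: e)
    then have 2: "zeta_regular \<tau>' ((z + 1) / \<tau>) = zeta_regular \<tau>' (z / \<tau>) + \<tau> / z - \<tau> / (z + 1) + 2 * of_real pi * \<i>"
      by (simp add: algebra_simps)
    have "L (z + 1) = L z + (\<tau> / z - \<tau> / (z + 1)) / \<tau> - (1 / z - 1 / (z + 1))"
      unfolding L_def 1 2 by (simp add: add_divide_distrib diff_divide_distrib ring_distribs)
    then show ?thesis
      by (simp add: diff_divide_distrib)
  qed
  \<comment> \<open>A compact fundamental parallelogram inside the open set \<open>R\<close>.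
    Periodicity carries every value on \<open>R\<close> to \<open>Q\<close>, so a maximum over
    \<open>Q\<close> is a maximum over \<open>R\<close> at an interior point.\<close>
  define Q where "Q = (\<lambda>(x, y). of_real x + of_real y * \<tau>) ` ({-1/2..1/2} \<times> {-1/2..1/2})"
  have "compact Q" unfolding Q_def
    by (intro compact_continuous_image compact_Times compact_Icc)
       (auto simp: case_prod_unfold intro!: continuous_intros)
  have QR: "Q \<subseteq> R" by (auto simp: Q_def R_iff)
  have "0 \<in> Q" by (auto simp: Q_def intro!: image_eqI[of _ _ "(0, 0)"])
  have "continuous_on Q (\<lambda>z. norm (L z))"
    by (intro continuous_intros holomorphic_on_imp_continuous_on holomorphic_on_subset[OF hol QR])
  with \<open>compact Q\<close> \<open>0 \<in> Q\<close> obtain m where m: "m \<in> Q" "\<And>z. z \<in> Q \<Longrightarrow> norm (L z) \<le> norm (L m)"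
    using continuous_attains_sup[of Q "\<lambda>z. norm (L z)"] by auto
  \<comment> \<open>Im (z/\<tau>) is a negative multiple of x, so \<open>per_1\<close> must start at
    a point with x < 0: this is x - 1 when x > 1/2, and x itself when x < -1/2.\<close>
  have redx: "\<exists>x'. \<bar>x'\<bar> \<le> 1/2 \<and> L (of_real x' + of_real y * \<tau>) = L (of_real x + of_real y * \<tau>)"
    if xy: "\<bar>x\<bar> < 1" "\<bar>y\<bar> < 1" for x y :: real
  proof -
    let ?z = "\<lambda>x. of_real x + of_real y * \<tau>"
    consider "\<bar>x\<bar> \<le> 1/2" | "x > 1/2" | "x < -1/2" by linarith
    then show ?thesis
    proof cases
      case 2
      have "L (?z (x - 1) + 1) = L (?z (x - 1))"
      proof (rule per_1)
        show "?z (x - 1) \<in> R" unfolding R_iff using xy 2 by auto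
        have "?z (x - 1) + 1 = ?z x" by simp
        then show "?z (x - 1) + 1 \<in> R" using R_iff xy by metis
        show "Im (?z (x - 1) / \<tau>) > 0"
          using Im_divide_self[OF \<tau>0, of "x - 1" y] xy \<tau>' Im1 by (simp add: mult_neg_pos)
      qed
      then have "L (?z (x - 1)) = L (?z x)" by (simp add: algebra_simps)
      moreover have "\<bar>x - 1\<bar> \<le> 1/2" using xy 2 by linarith
      ultimately show ?thesis by blast
    next
      case 3
      have e: "?z (x + 1) = ?z x + 1" by simp
      have "L (?z x + 1) = L (?z x)"
      proof (rule per_1)
        show "?z x \<in> R" unfolding R_iff using xy by auto
        show "?z x + 1 \<in> R" unfolding e[symmetric] R_iff using xy 3 by auto
        show "Im (?z x / \<tau>) > 0"
          using Im_divide_self[OF \<tau>0, of "x" y] xy 3 \<tau>' Im1 by (simp add: mult_neg_neg mult_neg_pos)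
      qed
      then have "L (?z (x + 1)) = L (?z x)" by (simp only: e)
      moreover have "\<bar>x + 1\<bar> \<le> 1/2" using xy 3 by linarith
      ultimately show ?thesis by blast
    qed auto
  qed
  have redy: "\<exists>y'. \<bar>y'\<bar> \<le> 1/2 \<and> L (of_real x + of_real y' * \<tau>) = L (of_real x + of_real y * \<tau>)"
    if xy: "\<bar>x\<bar> < 1" "\<bar>y\<bar> < 1" for x y :: real
  proof -
    let ?z = "\<lambda>y. of_real x + of_real y * \<tau>"
    consider "\<bar>y\<bar> \<le> 1/2" | "y > 1/2" | "y < -1/2" by linarith
    then show ?thesis
    proof cases
      case 2
      have e: "?z (y - 1) + \<tau> = ?z y" by (simp add: algebra_simps)
      have "L (?z (y - 1) + \<tau>) = L (?z (y - 1))"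
      proof (rule per_tau)
        show "?z (y - 1) \<in> R" unfolding R_iff using xy 2 by auto
        show "?z (y - 1) + \<tau> \<in> R" unfolding e R_iff using xy by auto
        show "Im (?z (y - 1)) < 0" using xy \<tau> by (simp add: mult_neg_pos)
      qed
      then have "L (?z (y - 1)) = L (?z y)" by (simp only: e)
      moreover have "\<bar>y - 1\<bar> \<le> 1/2" using xy 2 by linarith
      ultimately show ?thesis by blast
    next
      case 3
      have e: "?z (y + 1) = ?z y + \<tau>" by (simp add: algebra_simps)
      have "L (?z y + \<tau>) = L (?z y)"
      proof (rule per_tau)
        show "?z y \<in> R" unfolding R_iff using xy by auto
        show "?z y + \<tau> \<in> R" unfolding e[symmetric] R_iff using xy 3 by auto
        show "Im (?z y) < 0" using xy 3 \<tau> by (simp add: mult_neg_pos)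
      qed
      then have "L (?z (y + 1)) = L (?z y)" by (simp only: e)
      moreover have "\<bar>y + 1\<bar> \<le> 1/2" using xy 3 by linarith
      ultimately show ?thesis by blast
    qed auto
  qed
  have max: "norm (L z) \<le> norm (L m)" if "z \<in> R" for z
  proof -
    obtain x y where z: "z = of_real x + of_real y * \<tau>" using coords by blast
    have xy: "\<bar>x\<bar> < 1" "\<bar>y\<bar> < 1" using R_iff that z by auto
    obtain x' where x': "\<bar>x'\<bar> \<le> 1/2" "L (of_real x' + of_real y * \<tau>) = L z"
      using redx[OF xy] z by auto
    obtain y' where y': "\<bar>y'\<bar> \<le> 1/2" "L (of_real x' + of_real y' * \<tau>) = L z"
      using redy[of x' y] x' xy by auto
    have "of_real x' + of_real y' * \<tau> \<in> Q"
      using x' y' by (auto simp: Q_def intro!: image_eqI[of _ _ "(x', y')"])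
    then show ?thesis using m(2) y' by metis
  qed
  \<comment> \<open>Convexity supplies the connectedness required by the maximum modulus
    principle.\<close>
  have "convex R"
  proof -
    have "convex ((\<lambda>z. Im z) -` {- Im \<tau> <..< Im \<tau>})" "convex ((\<lambda>z. Im (z / \<tau>)) -` {- Im \<tau>' <..< Im \<tau>'})"
      by (intro convex_linear_vimage convex_real_interval linearI;
          simp add: divide_inverse algebra_simps)+
    moreover have "R = ((\<lambda>z. Im z) -` {- Im \<tau> <..< Im \<tau>}) \<inter> ((\<lambda>z. Im (z / \<tau>)) -` {- Im \<tau>' <..< Im \<tau>'})"
      by (auto simp: R_def)
    ultimately show ?thesis by (simp add: convex_Int)
  qed
  then show "L constant_on R"
    using maximum_modulus_principle[OF hol opn _ opn order_refl, of m] max m(1) QR convex_connected by blast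
qed

text \<open>The difference of the two zeta functions is constant near 0, so its derivative at 0
  vanishes; this is a linear relation between the two values of \<open>Eisenstein_E2\<close>, with
  the inhomogeneous part 2 \<pi> i/\<tau> from the linear correction.\<close>

lemma E2_inversion:
  assumes \<tau>: "Im \<tau> > 0"
  shows "Eisenstein_E2 (- 1 / \<tau>) = \<tau>\<^sup>2 * Eisenstein_E2 \<tau> - 6 * \<i> * \<tau> / of_real pi"
proof -
  have \<tau>0 [simp]: "\<tau> \<noteq> 0" using \<tau> by auto
  have \<tau>': "Im (- 1 / \<tau>) > 0"
    using \<tau> by (simp add: Im_divide divide_simps sum_power2_gt_zero_iff)
  define L where "L = (\<lambda>z. zeta_regular (- 1 / \<tau>) (z / \<tau>) / \<tau> - zeta_regular \<tau> z - 2 * of_real pi * \<i> * z / \<tau>)"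
  obtain R where R: "L constant_on R" "open R" "0 \<in> R"
    using zeta_regular_inversion[OF \<tau>] unfolding L_def by blast
  then obtain c where c: "\<And>z. z \<in> R \<Longrightarrow> L z = c" by (auto simp: constant_on_def)
  have 1: "(L has_field_derivative 0) (at 0)"
    by (rule has_field_derivative_transform_within_open[OF DERIV_const[of c] R(2,3)]) (use c in auto)
  have "((\<lambda>z. zeta_regular (- 1 / \<tau>) (z / \<tau>)) has_field_derivative
      - (of_real pi ^ 2 / 3) * Eisenstein_E2 (- 1 / \<tau>) * (1 / \<tau>)) (at 0)"
    by (rule DERIV_chain2[where g = "\<lambda>z. z / \<tau>"])
       (use zeta_regular_deriv_0[OF \<tau>'] in \<open>auto intro!: derivative_eq_intros\<close>)
  then have "(L has_field_derivative
      - (of_real pi ^ 2 / 3) * Eisenstein_E2 (- 1 / \<tau>) * (1 / \<tau>) / \<tau>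
      - - (of_real pi ^ 2 / 3) * Eisenstein_E2 \<tau> - 2 * of_real pi * \<i> / \<tau>) (at 0)"
    unfolding L_def
    by (intro DERIV_diff DERIV_cdivide zeta_regular_deriv_0[OF \<tau>])
       (auto intro!: derivative_eq_intros)
  from DERIV_unique[OF 1 this]
  have 0: "- (of_real pi ^ 2 / 3) * Eisenstein_E2 (- 1 / \<tau>) * (1 / \<tau>) / \<tau>
      - - (of_real pi ^ 2 / 3) * Eisenstein_E2 \<tau> - 2 * of_real pi * \<i> / \<tau> = 0"
    by simp
  \<comment> \<open>The relation \<open>0\<close> times -3 \<tau>^2/\<pi> is the claim times
    \<pi>.\<close>
  have "of_real pi * Eisenstein_E2 (- 1 / \<tau>) - (of_real pi * \<tau>\<^sup>2 * Eisenstein_E2 \<tau> - 6 * \<i> * \<tau>) =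
      - (3 * \<tau>\<^sup>2 / of_real pi) * (- (of_real pi ^ 2 / 3) * Eisenstein_E2 (- 1 / \<tau>) * (1 / \<tau>) / \<tau>
      - - (of_real pi ^ 2 / 3) * Eisenstein_E2 \<tau> - 2 * of_real pi * \<i> / \<tau>)"
    by (simp add: field_simps power2_eq_square)
  then show ?thesis
    unfolding 0 by (simp add: field_simps)
qed

section \<open>Transformation of \<open>Eisenstein_E2\<close> under the whole modular group\<close>

lemma E2_periodic: "Eisenstein_E2 (z + of_int k) = Eisenstein_E2 z"
proof -
  have "nome (of_int k) = 1" by (simp add: nome_eq_1_iff)
  then show ?thesis by (simp add: E2_eq nome_add)
qed

lemma Im_moebius:
  fixes z :: complex
  assumes "a * d - b * c = (1::int)" "Im z > 0"
  shows "Im ((of_int a * z + of_int b) / (of_int c * z + of_int d)) = Im z / (norm (of_int c * z + of_int d))\<^sup>2"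
    and "of_int c * z + of_int d \<noteq> 0"
proof -
  show nz: "of_int c * z + of_int d \<noteq> 0"
  proof
    assume "of_int c * z + of_int d = 0"
    then have "c = 0" "d = 0" using assms(2) by (auto simp: complex_eq_iff)
    then show False using assms by simp
  qed
  have det: "real_of_int a * d - b * c = 1" using assms(1) by (metis of_int_1 of_int_diff of_int_mult)
  have "Im ((of_int a * z + of_int b) * cnj (of_int c * z + of_int d)) = (real_of_int a * d - b * c) * Im z"
    by (simp add: algebra_simps)
  then show "Im ((of_int a * z + of_int b) / (of_int c * z + of_int d)) = Im z / (norm (of_int c * z + of_int d))\<^sup>2"
    by (subst complex_div_cnj) (simp only: det Im_divide_of_real mult_1 flip: of_real_power)
qed

text \<open>The weight 2 defect obeys a cocycle rule. Here w is the automorphy factor of the inner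
  transformation (a translation followed by inversion), - j / w that of the outer one, and j - c w
  the lower left entry of the outer matrix.\<close>

lemma quasi_cocycle:
  fixes j w E K c :: "'a :: field"
  assumes "w \<noteq> 0"
  shows "(- j / w)\<^sup>2 * (w\<^sup>2 * E - K * w) - K * (j - c * w) * (- j / w) = j\<^sup>2 * E - K * c * j"
proof -
  have "(- j / w)\<^sup>2 * (w\<^sup>2 * E - K * w) = j\<^sup>2 * E - K * (j\<^sup>2 / w)"
    using assms by (simp add: power2_eq_square field_simps)
  moreover have "K * (j - c * w) * (- j / w) = - K * (j\<^sup>2 / w) + K * c * j"
    using assms by (simp add: power2_eq_square field_simps)
  ultimately show ?thesis by simp
qed

text \<open>Euclid's algorithm on the bottom row: with \<open>q = d div c\<close> the matrix factors
  into one with lower left entry \<open>d mod c\<close>, the inversion, and the translation by q. So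
  |c| shrinks until a translation is left.\<close>

lemma E2_moebius:
  fixes z :: complex
  assumes "a * d - b * c = (1::int)" "Im z > 0"
  shows "Eisenstein_E2 ((of_int a * z + of_int b) / (of_int c * z + of_int d)) =
    (of_int c * z + of_int d)\<^sup>2 * Eisenstein_E2 z
      - 6 * \<i> / of_real pi * of_int c * (of_int c * z + of_int d)"
  using assms
proof (induction "nat \<bar>c\<bar>" arbitrary: a b c d z rule: less_induct)
  case less
  show ?case
  proof (cases "c = 0")
    case True
    then have "a * d = 1" using less.prems by simp
    then have "(a = 1 \<and> d = 1) \<or> (a = -1 \<and> d = -1)" using zmult_eq_1_iff by blast
    \<comment> \<open>The matrix is a translation up to sign, and \<open>b * a\<close> is its amount
      for either sign.\<close>
    then have "(of_int a * z + of_int b) / (of_int c * z + of_int d) = z + of_int (b * a)" "(of_int d :: complex)\<^sup>2 = 1"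
      using True by auto
    then show ?thesis using True E2_periodic[of z "b * a"] by simp
  next
    case False
    define q where "q = d div c"
    define c' where "c' = d - q * c"
    define a' where "a' = b - q * a"
    have c': "c' = d mod c" by (simp add: c'_def q_def minus_div_mult_eq_mod)
    have lt: "nat \<bar>c'\<bar> < nat \<bar>c\<bar>" using False abs_mod_less[of c d] by (simp add: c')
    define s where "s = - 1 / (z + of_int q)"
    have zq: "Im (z + of_int q) > 0" using less.prems by simp
    then have zq0: "z + of_int q \<noteq> 0" by (metis less_irrefl zero_complex.simps(2))
    have s: "Im s > 0" using Im_moebius(1)[of 0 0 "-1" 1 "z + of_int q"] zq zq0
      by (simp add: s_def)
    have "a' * (- c) - (- a) * c' = 1" using less.prems by (simp add: a'_def c'_def algebra_simps)
    from less.hyps[OF lt this s] have IH: "Eisenstein_E2 ((of_int a' * s - of_int a) / (of_int c' * s - of_int c)) =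
      (of_int c' * s - of_int c)\<^sup>2 * Eisenstein_E2 s - 6 * \<i> / of_real pi * of_int c' * (of_int c' * s - of_int c)"
      by simp
    define j where "j = of_int c * z + of_int d"
    have j0: "j \<noteq> 0" unfolding j_def using Im_moebius(2)[OF less.prems] .
    have e1: "of_int c' * s - of_int c = - j / (z + of_int q)"
    proof -
      have "s * (z + of_int q) = - 1" using zq0 by (simp add: s_def)
      then have "(of_int c' * s - of_int c) * (z + of_int q) = - of_int c' - of_int c * (z + of_int q)"
        by (simp add: left_diff_distrib mult.assoc)
      also have "\<dots> = - j" by (simp add: j_def c'_def algebra_simps)
      finally show ?thesis using zq0 by (metis nonzero_eq_divide_eq)
    qed
    have e2: "of_int a' * s - of_int a = - (of_int a * z + of_int b) / (z + of_int q)"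
    proof -
      have "s * (z + of_int q) = - 1" using zq0 by (simp add: s_def)
      then have "(of_int a' * s - of_int a) * (z + of_int q) = - of_int a' - of_int a * (z + of_int q)"
        by (simp add: left_diff_distrib mult.assoc)
      also have "\<dots> = - (of_int a * z + of_int b)" by (simp add: a'_def algebra_simps)
      finally show ?thesis using zq0 by (metis nonzero_eq_divide_eq)
    qed
    define K where "K = 6 * \<i> / complex_of_real pi"
    have E2s: "Eisenstein_E2 s = (z + of_int q)\<^sup>2 * Eisenstein_E2 z - K * (z + of_int q)"
      using E2_inversion[OF zq] by (simp add: s_def E2_periodic K_def)
    have "(of_int a * z + of_int b) / j = (of_int a' * s - of_int a) / (of_int c' * s - of_int c)"
      unfolding e1 e2 minus_divide_left[symmetric] using zq0 j0 by simp
    then have "Eisenstein_E2 ((of_int a * z + of_int b) / j) =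
       (- j / (z + of_int q))\<^sup>2 * ((z + of_int q)\<^sup>2 * Eisenstein_E2 z - K * (z + of_int q))
        - K * of_int c' * (- j / (z + of_int q))"
      using IH unfolding e1 e2 E2s K_def by simp
    also have "\<dots> = j\<^sup>2 * Eisenstein_E2 z - K * of_int c * j"
    proof -
      have "of_int c' = j - of_int c * (z + of_int q)" by (simp add: j_def c'_def algebra_simps)
      then show ?thesis using quasi_cocycle[OF zq0, of j] by simp
    qed
    finally show ?thesis by (simp add: j_def K_def)
  qed
qed

section \<open>Holomorphy and boundedness of \<open>Eisenstein_E2\<close>\<close>

lemma sigma_series_summable:
  "norm q < 1 \<Longrightarrow> summable (\<lambda>m. of_nat (\<Sum>{d. d dvd Suc m}) * q ^ Suc m)" for q :: complex
  using lambert_sigma[of q] by (simp add: sums_iff)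

lemma sigma_series_holomorphic: "sigma_series holomorphic_on ball 0 1"
proof -
  define c :: "nat \<Rightarrow> complex" where "c m = (if m = 0 then 0 else of_nat (\<Sum>{d. d dvd m}))" for m
  have s: "summable (\<lambda>m. c m * q ^ m)" if "norm q < 1" for q
    using sigma_series_summable[OF that]
    by (subst summable_Suc_iff[symmetric]) (simp only: c_def nat.distinct if_False)
  have eq: "sigma_series q = suminf (\<lambda>m. c m * q ^ m)" if "norm q < 1" for q
  proof -
    have "sigma_series q = suminf (\<lambda>m. c (Suc m) * q ^ Suc m)"
      by (simp only: sigma_series_def c_def nat.distinct if_False)
    also have "\<dots> = suminf (\<lambda>m. c m * q ^ m) - c 0 * q ^ 0"
      by (rule suminf_split_head[OF s[OF that]])
    also have "c 0 = 0" by (simp only: c_def if_True simp_thms)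
    finally show ?thesis by (simp only: mult_zero_left diff_zero)
  qed
  have "(\<lambda>q. suminf (\<lambda>m. c m * q ^ m)) holomorphic_on ball 0 1"
  proof (rule holomorphic_onI, rule field_differentiable_at_within)
    fix q :: complex assume "q \<in> ball 0 1"
    then have q: "norm q < 1" by simp
    have "((\<lambda>q. suminf (\<lambda>m. c m * q ^ m)) has_field_derivative suminf (\<lambda>m. diffs c m * q ^ m)) (at q)"
      by (rule termdiffs_strong'[OF s q])
    then show "(\<lambda>q. suminf (\<lambda>m. c m * q ^ m)) field_differentiable at q"
      unfolding field_differentiable_def by blast
  qed
  then show ?thesis
    by (rule holomorphic_transform) (auto simp: eq)
qed

lemma E2_holomorphic: "Eisenstein_E2 holomorphic_on {z. Im z > 0}"
proof -
  have "nome holomorphic_on {z. Im z > 0}"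
    unfolding nome_def[abs_def] by (intro holomorphic_intros)
  then have "(sigma_series \<circ> nome) holomorphic_on {z. Im z > 0}"
    by (rule holomorphic_on_compose_gen[OF _ sigma_series_holomorphic])
       (auto simp: norm_nome_less_1_iff)
  then show ?thesis
    unfolding E2_eq[abs_def] o_def by (intro holomorphic_intros)
qed

text \<open>All terms are dominated by the convergent series at q = exp(-2 \<pi>). Together with the
  transformation law this one bound controls the growth at every cusp.\<close>

lemma E2_bounded: "\<exists>B. \<forall>z. Im z \<ge> 1 \<longrightarrow> norm (Eisenstein_E2 z) \<le> B"
proof (intro exI allI impI)
  fix z assume z: "Im z \<ge> 1"
  define r where "r = exp (- 2 * pi)"
  have r: "norm r < 1" by (simp add: r_def)
  have le: "norm (nome z) \<le> r" using z by (simp add: norm_nome r_def)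
  have "summable (\<lambda>m. complex_of_real (of_nat (\<Sum>{d. d dvd Suc m}) * r ^ Suc m))"
    using sigma_series_summable[of "of_real r"] r by simp
  then have sr: "summable (\<lambda>m. of_nat (\<Sum>{d. d dvd Suc m}) * r ^ Suc m)"
    by (simp only: summable_complex_of_real)
  have "norm (sigma_series (nome z)) \<le> suminf (\<lambda>m. of_nat (\<Sum>{d. d dvd Suc m}) * r ^ Suc m)"
    unfolding sigma_series_def
  proof (rule norm_suminf_le)
    fix m
    have "norm (nome z) ^ Suc m \<le> r ^ Suc m" using le by (intro power_mono) auto
    then show "norm (of_nat (\<Sum>{d. d dvd Suc m}) * nome z ^ Suc m) \<le> of_nat (\<Sum>{d. d dvd Suc m}) * r ^ Suc m"
      unfolding norm_mult norm_of_nat norm_power by (intro mult_left_mono) (auto simp del: of_nat_sum)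
  qed (rule sr)
  then show "norm (Eisenstein_E2 z) \<le> 1 + 24 * suminf (\<lambda>m. of_nat (\<Sum>{d. d dvd Suc m}) * r ^ Suc m)"
    unfolding E2_eq by (intro order.trans[OF norm_triangle_ineq4]) (simp add: norm_mult)
qed

section \<open>The modular group\<close>

lemma Im_of_uhp: "Im (of_uhp \<tau>) > 0"
  using of_uhp[of \<tau>] by simp

lemma SL2Z_iff: "g \<in> carrier SL2Z \<longleftrightarrow> g$1$1 * g$2$2 - g$1$2 * g$2$1 = 1"
  by (simp add: SL2Z_def det_2)

lemma SL2Z_mult_nth: "(A ** B) $ i $ j = A$i$1 * B$1$j + A$i$2 * B$2$j" for A B :: "'a::semiring_1^2^2"
  by (simp add: matrix_matrix_mult_def sum_2)

definition SL2Z_inv :: "int^2^2 \<Rightarrow> int^2^2" where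
  "SL2Z_inv g = vector [vector [g$2$2, - g$1$2], vector [- g$2$1, g$1$1]]"

lemma SL2Z_inv_nth [simp]:
  "SL2Z_inv g $ 1 $ 1 = g$2$2" "SL2Z_inv g $ 1 $ 2 = - g$1$2"
  "SL2Z_inv g $ 2 $ 1 = - g$2$1" "SL2Z_inv g $ 2 $ 2 = g$1$1"
  by (simp_all add: SL2Z_inv_def)

lemma mat2_eqI: "A$1$1 = B$1$1 \<Longrightarrow> A$1$2 = B$1$2 \<Longrightarrow> A$2$1 = B$2$1 \<Longrightarrow> A$2$2 = B$2$2 \<Longrightarrow> A = B"
  for A B :: "'a^2^2"
  unfolding vec_eq_iff forall_2 by blast

lemma SL2Z_inv_closed: "g \<in> carrier SL2Z \<Longrightarrow> SL2Z_inv g \<in> carrier SL2Z"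
  unfolding SL2Z_iff by (simp add: mult.commute)

lemma SL2Z_inv_mult:
  assumes "g \<in> carrier SL2Z"
  shows "SL2Z_inv g ** g = mat 1" "g ** SL2Z_inv g = mat 1"
  using assms unfolding SL2Z_iff
  by (intro mat2_eqI; simp add: SL2Z_mult_nth mat_def; simp add: mult.commute)+

lemma SL2Z_simps [simp]: "monoid.mult SL2Z = (**)" "one SL2Z = mat 1"
  by (simp_all add: SL2Z_def)

lemma SL2Z_mult_closed: "g \<in> carrier SL2Z \<Longrightarrow> h \<in> carrier SL2Z \<Longrightarrow> g ** h \<in> carrier SL2Z"
  by (simp add: SL2Z_def det_mul)

lemma SL2Z_group: "group SL2Z"
proof (rule groupI)
  show "\<exists>y\<in>carrier SL2Z. y \<otimes>\<^bsub>SL2Z\<^esub> x = \<one>\<^bsub>SL2Z\<^esub>" if "x \<in> carrier SL2Z" for x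
    using SL2Z_inv_closed[OF that] SL2Z_inv_mult[OF that] by auto
qed (auto simp: SL2Z_def det_mul matrix_mul_assoc)

lemma automorphy_factor_nonzero:
  "g \<in> carrier SL2Z \<Longrightarrow> automorphy_factor g \<tau> \<noteq> 0"
  unfolding automorphy_factor_def SL2Z_iff using Im_moebius(2) Im_of_uhp by blast

lemma of_uhp_moebius:
  assumes "g \<in> carrier SL2Z"
  shows "of_uhp (moebius_uhp g \<tau>) = (of_int (g$1$1) * of_uhp \<tau> + of_int (g$1$2)) / automorphy_factor g \<tau>"
    and "Im (of_uhp (moebius_uhp g \<tau>)) = Im (of_uhp \<tau>) / (norm (automorphy_factor g \<tau>))\<^sup>2"
proof -
  have I: "Im ((of_int (g$1$1) * of_uhp \<tau> + of_int (g$1$2)) / automorphy_factor g \<tau>) = Im (of_uhp \<tau>) / (norm (automorphy_factor g \<tau>))\<^sup>2"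
    using assms Im_moebius(1)[OF _ Im_of_uhp] unfolding automorphy_factor_def SL2Z_iff by blast
  have "Im (of_uhp \<tau>) / (norm (automorphy_factor g \<tau>))\<^sup>2 > 0"
    using automorphy_factor_nonzero[OF assms] Im_of_uhp by simp
  then show "of_uhp (moebius_uhp g \<tau>) = (of_int (g$1$1) * of_uhp \<tau> + of_int (g$1$2)) / automorphy_factor g \<tau>"
    unfolding moebius_uhp_def I[symmetric] by (simp add: Abs_uhp_inverse)
  then show "Im (of_uhp (moebius_uhp g \<tau>)) = Im (of_uhp \<tau>) / (norm (automorphy_factor g \<tau>))\<^sup>2"
    using I by simp
qed

lemma automorphy_factor_mult:
  assumes "g \<in> carrier SL2Z" "h \<in> carrier SL2Z"
  shows "automorphy_factor (g ** h) \<tau> = automorphy_factor g (moebius_uhp h \<tau>) * automorphy_factor h \<tau>"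
proof -
  let ?j = "automorphy_factor h \<tau>"
  let ?N = "of_int (h$1$1) * of_uhp \<tau> + of_int (h$1$2)"
  have j: "?j \<noteq> 0" using automorphy_factor_nonzero[OF assms(2)] .
  have "automorphy_factor g (moebius_uhp h \<tau>) * ?j = of_int (g$2$1) * ?N + of_int (g$2$2) * ?j"
    using j by (simp add: automorphy_factor_def[of g] of_uhp_moebius(1)[OF assms(2)] distrib_right)
  also have "\<dots> = automorphy_factor (g ** h) \<tau>"
    by (simp add: SL2Z_mult_nth automorphy_factor_def algebra_simps)
  finally show ?thesis ..
qed

lemma moebius_uhp_mult:
  assumes "g \<in> carrier SL2Z" "h \<in> carrier SL2Z"
  shows "moebius_uhp (g ** h) \<tau> = moebius_uhp g (moebius_uhp h \<tau>)"
proof -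
  let ?j = "automorphy_factor h \<tau>"
  have j: "?j \<noteq> 0" using automorphy_factor_nonzero[OF assms(2)] .
  have j': "automorphy_factor g (moebius_uhp h \<tau>) \<noteq> 0" using automorphy_factor_nonzero[OF assms(1)] .
  let ?N = "of_int (h$1$1) * of_uhp \<tau> + of_int (h$1$2)"
  have "of_uhp (moebius_uhp g (moebius_uhp h \<tau>)) =
    (of_int (g$1$1) * (?N / ?j) + of_int (g$1$2)) / automorphy_factor g (moebius_uhp h \<tau>)"
    unfolding of_uhp_moebius(1)[OF assms(1)] of_uhp_moebius(1)[OF assms(2)] ..
  also have "of_int (g$1$1) * (?N / ?j) + of_int (g$1$2) = (of_int (g$1$1) * ?N + of_int (g$1$2) * ?j) / ?j"
    using j by (simp add: field_simps)
  also have "of_int (g$1$1) * ?N + of_int (g$1$2) * ?j =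
     of_int ((g ** h)$1$1) * of_uhp \<tau> + of_int ((g ** h)$1$2)"
    by (simp add: SL2Z_mult_nth automorphy_factor_def algebra_simps)
  finally have "of_uhp (moebius_uhp (g ** h) \<tau>) = of_uhp (moebius_uhp g (moebius_uhp h \<tau>))"
    unfolding of_uhp_moebius(1)[OF SL2Z_mult_closed[OF assms]] automorphy_factor_mult[OF assms]
    by (simp add: mult.commute)
  then show ?thesis by (simp add: of_uhp_inject)
qed

lemma moebius_uhp_1 [simp]: "moebius_uhp (mat 1) \<tau> = \<tau>"
  by (simp add: moebius_uhp_def automorphy_factor_def mat_def of_uhp_inverse)

lemma moebius_uhp_inv [simp]:
  assumes "g \<in> carrier SL2Z"
  shows "moebius_uhp (SL2Z_inv g) (moebius_uhp g \<tau>) = \<tau>" "moebius_uhp g (moebius_uhp (SL2Z_inv g) \<tau>) = \<tau>"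
  using assms by (simp_all add: SL2Z_inv_closed SL2Z_inv_mult flip: moebius_uhp_mult)

lemma E2_moebius_uhp:
  assumes "g \<in> carrier SL2Z"
  shows "Eisenstein_E2 (of_uhp (moebius_uhp g \<tau>)) =
    automorphy_factor g \<tau> ^ 2 * Eisenstein_E2 (of_uhp \<tau>) - 6 * \<i> / of_real pi * of_int (g$2$1) * automorphy_factor g \<tau>"
  using assms E2_moebius[OF _ Im_of_uhp]
  unfolding of_uhp_moebius(1)[OF assms] unfolding automorphy_factor_def SL2Z_iff by blast

section \<open>Holomorphic functions of moderate growth\<close>

text \<open>Polynomial growth seen from infinity: each cusp is the image of infinity under some g,
  so the bound is put on F composed with each g. With natural exponents and
  \<open>Y \<ge> 1\<close>, which forces |\<tau>| \<ge> 1, these functions form a ring; it contains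
  \<tau> and \<open>Eisenstein_E2\<close>, which a boundedness condition would exclude.\<close>

definition tempered :: "(uhp \<Rightarrow> complex) set" where
  "tempered = {F. (\<lambda>z. F (Abs_uhp z)) holomorphic_on {z. Im z > 0} \<and>
     (\<forall>g\<in>carrier SL2Z. \<exists>C Y. \<exists>n::nat. C \<ge> 0 \<and> Y \<ge> 1 \<and> (\<forall>\<tau>. Im (of_uhp \<tau>) > Y \<longrightarrow>
        norm (F (moebius_uhp g \<tau>)) \<le> C * norm (of_uhp \<tau>) ^ n))}"

lemma norm_of_uhp_ge: "Im (of_uhp \<tau>) > Y \<Longrightarrow> norm (of_uhp \<tau>) \<ge> Y"
  using abs_Im_le_cmod[of "of_uhp \<tau>"] by linarith

lemma temperedD:
  assumes "F \<in> tempered" "g \<in> carrier SL2Z"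
  obtains C Y n where "C \<ge> 0" "Y \<ge> 1"
    "\<And>\<tau>. Im (of_uhp \<tau>) > Y \<Longrightarrow> norm (F (moebius_uhp g \<tau>)) \<le> C * norm (of_uhp \<tau>) ^ n"
  using assms unfolding tempered_def by blast

lemma tempered_holomorphic: "F \<in> tempered \<Longrightarrow> (\<lambda>z. F (Abs_uhp z)) holomorphic_on {z. Im z > 0}"
  by (simp add: tempered_def)

lemma temperedI:
  assumes "(\<lambda>z. F (Abs_uhp z)) holomorphic_on {z. Im z > 0}"
    and "\<And>g. g \<in> carrier SL2Z \<Longrightarrow> \<exists>C Y. \<exists>n::nat. C \<ge> 0 \<and> Y \<ge> 1 \<and> (\<forall>\<tau>. Im (of_uhp \<tau>) > Y \<longrightarrow>
        norm (F (moebius_uhp g \<tau>)) \<le> C * norm (of_uhp \<tau>) ^ n)"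
  shows "F \<in> tempered"
  using assms by (simp add: tempered_def)

lemma tempered_const: "(\<lambda>_. c) \<in> tempered"
  by (rule temperedI, simp, intro exI[of _ "norm c"] exI[of _ 1] exI[of _ 0]) auto

lemma tempered_add:
  assumes "F \<in> tempered" "G \<in> tempered"
  shows "(\<lambda>\<tau>. F \<tau> + G \<tau>) \<in> tempered"
proof (rule temperedI)
  fix g assume g: "g \<in> carrier SL2Z"
  obtain C1 Y1 n1 where 1: "C1 \<ge> 0" "Y1 \<ge> 1"
    "\<And>\<tau>. Im (of_uhp \<tau>) > Y1 \<Longrightarrow> norm (F (moebius_uhp g \<tau>)) \<le> C1 * norm (of_uhp \<tau>) ^ n1"
    using temperedD[OF assms(1) g] by blast
  obtain C2 Y2 n2 where 2: "C2 \<ge> 0" "Y2 \<ge> 1"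
    "\<And>\<tau>. Im (of_uhp \<tau>) > Y2 \<Longrightarrow> norm (G (moebius_uhp g \<tau>)) \<le> C2 * norm (of_uhp \<tau>) ^ n2"
    using temperedD[OF assms(2) g] by blast
  have "norm (F (moebius_uhp g \<tau>) + G (moebius_uhp g \<tau>)) \<le> (C1 + C2) * norm (of_uhp \<tau>) ^ (n1 + n2)"
    if "Im (of_uhp \<tau>) > max Y1 Y2" for \<tau>
  proof -
    let ?t = "norm (of_uhp \<tau>)"
    have t: "?t \<ge> 1" using norm_of_uhp_ge[OF that] 1 by simp
    have "?t ^ n1 \<le> ?t ^ (n1 + n2)" "?t ^ n2 \<le> ?t ^ (n1 + n2)"
      using t by (auto intro!: power_increasing)
    then have "C1 * ?t ^ n1 \<le> C1 * ?t ^ (n1 + n2)" "C2 * ?t ^ n2 \<le> C2 * ?t ^ (n1 + n2)"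
      using 1 2 by (auto intro!: mult_left_mono)
    moreover have "norm (F (moebius_uhp g \<tau>)) \<le> C1 * ?t ^ n1" "norm (G (moebius_uhp g \<tau>)) \<le> C2 * ?t ^ n2"
      using 1(3) 2(3) that by auto
    ultimately show ?thesis
      using norm_triangle_ineq[of "F (moebius_uhp g \<tau>)" "G (moebius_uhp g \<tau>)"]
      unfolding ring_distribs by linarith
  qed
  then show "\<exists>C Y. \<exists>n::nat. C \<ge> 0 \<and> Y \<ge> 1 \<and> (\<forall>\<tau>. Im (of_uhp \<tau>) > Y \<longrightarrow>
        norm (F (moebius_uhp g \<tau>) + G (moebius_uhp g \<tau>)) \<le> C * norm (of_uhp \<tau>) ^ n)"
    using 1 2 by (intro exI[of _ "C1 + C2"] exI[of _ "max Y1 Y2"] exI[of _ "n1 + n2"]) auto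
qed (use assms in \<open>auto intro!: holomorphic_intros dest: tempered_holomorphic\<close>)

lemma tempered_mult:
  assumes "F \<in> tempered" "G \<in> tempered"
  shows "(\<lambda>\<tau>. F \<tau> * G \<tau>) \<in> tempered"
proof (rule temperedI)
  fix g assume g: "g \<in> carrier SL2Z"
  obtain C1 Y1 n1 where 1: "C1 \<ge> 0" "Y1 \<ge> 1"
    "\<And>\<tau>. Im (of_uhp \<tau>) > Y1 \<Longrightarrow> norm (F (moebius_uhp g \<tau>)) \<le> C1 * norm (of_uhp \<tau>) ^ n1"
    using temperedD[OF assms(1) g] by blast
  obtain C2 Y2 n2 where 2: "C2 \<ge> 0" "Y2 \<ge> 1"
    "\<And>\<tau>. Im (of_uhp \<tau>) > Y2 \<Longrightarrow> norm (G (moebius_uhp g \<tau>)) \<le> C2 * norm (of_uhp \<tau>) ^ n2"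
    using temperedD[OF assms(2) g] by blast
  have "norm (F (moebius_uhp g \<tau>) * G (moebius_uhp g \<tau>)) \<le> (C1 * C2) * norm (of_uhp \<tau>) ^ (n1 + n2)"
    if "Im (of_uhp \<tau>) > max Y1 Y2" for \<tau>
    using mult_mono[OF 1(3) 2(3), of \<tau> \<tau>] that 1 by (simp add: norm_mult power_add mult_ac)
  then show "\<exists>C Y. \<exists>n::nat. C \<ge> 0 \<and> Y \<ge> 1 \<and> (\<forall>\<tau>. Im (of_uhp \<tau>) > Y \<longrightarrow>
        norm (F (moebius_uhp g \<tau>) * G (moebius_uhp g \<tau>)) \<le> C * norm (of_uhp \<tau>) ^ n)"
    using 1 2 by (intro exI[of _ "C1 * C2"] exI[of _ "max Y1 Y2"] exI[of _ "n1 + n2"]) auto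
qed (use assms in \<open>auto intro!: holomorphic_intros dest: tempered_holomorphic\<close>)

lemma tempered_power: "F \<in> tempered \<Longrightarrow> (\<lambda>\<tau>. F \<tau> ^ k) \<in> tempered"
  by (induction k) (auto intro: tempered_const tempered_mult)

lemma tempered_sum: "(\<And>i. i \<in> I \<Longrightarrow> F i \<in> tempered) \<Longrightarrow> (\<lambda>\<tau>. \<Sum>i\<in>I. F i \<tau>) \<in> tempered"
  by (induction I rule: infinite_finite_induct) (auto intro: tempered_const tempered_add)

lemma norm_automorphy_factor_le:
  assumes "norm (of_uhp \<tau>) \<ge> 1"
  shows "norm (automorphy_factor g \<tau>) \<le> (\<bar>of_int (g$2$1)\<bar> + \<bar>of_int (g$2$2)\<bar>) * norm (of_uhp \<tau>)"
proof -
  have "norm (automorphy_factor g \<tau>) \<le> \<bar>of_int (g$2$1)\<bar> * norm (of_uhp \<tau>) + \<bar>of_int (g$2$2)\<bar>"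
    unfolding automorphy_factor_def by (rule order.trans[OF norm_triangle_ineq]) (simp add: norm_mult)
  also have "\<bar>of_int (g$2$2)\<bar> \<le> \<bar>of_int (g$2$2)\<bar> * norm (of_uhp \<tau>)"
    using mult_left_mono[OF assms, of "\<bar>of_int (g$2$2)\<bar>"] by simp
  finally show ?thesis by (simp add: ring_distribs)
qed

text \<open>High in the half-plane, dividing by an automorphy factor does not enlarge a modulus;
  this lets numerators alone decide the growth of g \<tau>.\<close>

lemma norm_automorphy_factor_ge:
  assumes "g \<in> carrier SL2Z" "Im (of_uhp \<tau>) \<ge> 1"
  shows "norm (automorphy_factor g \<tau>) \<ge> 1"
proof (cases "g$2$1 = 0")
  case True
  then have "g$1$1 * g$2$2 = 1" using assms(1) by (simp add: SL2Z_iff)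
  then have "\<bar>g$2$2\<bar> = 1" using zmult_eq_1_iff by fastforce
  then show ?thesis using True by (auto simp: automorphy_factor_def)
next
  case False
  then have "1 \<le> \<bar>real_of_int (g$2$1)\<bar>" by linarith
  then have "1 * 1 \<le> \<bar>real_of_int (g$2$1)\<bar> * Im (of_uhp \<tau>)"
    using assms(2) by (intro mult_mono) auto
  also have "\<dots> = \<bar>Im (automorphy_factor g \<tau>)\<bar>"
    using Im_of_uhp[of \<tau>] by (simp add: automorphy_factor_def abs_mult)
  also have "\<dots> \<le> norm (automorphy_factor g \<tau>)" by (rule abs_Im_le_cmod)
  finally show ?thesis by simp
qed

lemma tempered_of_uhp: "of_uhp \<in> tempered"
proof (rule temperedI)
  show "(\<lambda>z. of_uhp (Abs_uhp z)) holomorphic_on {z. Im z > 0}"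
    by (rule holomorphic_transform[OF holomorphic_on_ident]) (simp add: Abs_uhp_inverse)
  fix g assume g: "g \<in> carrier SL2Z"
  define K where "K = \<bar>real_of_int (g$1$1)\<bar> + \<bar>real_of_int (g$1$2)\<bar>"
  have "norm (of_uhp (moebius_uhp g \<tau>)) \<le> K * norm (of_uhp \<tau>) ^ 1" if t: "Im (of_uhp \<tau>) > 1" for \<tau>
  proof -
    have n1: "norm (of_uhp \<tau>) \<ge> 1" using norm_of_uhp_ge[OF t] .
    have "norm (of_int (g$1$1) * of_uhp \<tau> + of_int (g$1$2)) \<le> \<bar>of_int (g$1$1)\<bar> * norm (of_uhp \<tau>) + \<bar>of_int (g$1$2)\<bar>"
      by (rule order.trans[OF norm_triangle_ineq]) (simp add: norm_mult)
    also have "\<dots> \<le> K * norm (of_uhp \<tau>)"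
      using mult_left_mono[OF n1, of "\<bar>of_int (g$1$2)\<bar>"] by (simp add: K_def ring_distribs)
    finally have "norm (of_int (g$1$1) * of_uhp \<tau> + of_int (g$1$2)) \<le> K * norm (of_uhp \<tau>)" .
    moreover have "norm (automorphy_factor g \<tau>) \<ge> 1" using norm_automorphy_factor_ge[OF g] t by simp
    ultimately have "norm (of_int (g$1$1) * of_uhp \<tau> + of_int (g$1$2)) / norm (automorphy_factor g \<tau>) \<le> K * norm (of_uhp \<tau>) / 1"
      by (intro frac_le) (auto simp: K_def)
    then show ?thesis unfolding of_uhp_moebius(1)[OF g] by (simp add: norm_divide)
  qed
  then show "\<exists>C Y. \<exists>n::nat. C \<ge> 0 \<and> Y \<ge> 1 \<and> (\<forall>\<tau>. Im (of_uhp \<tau>) > Y \<longrightarrow>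
        norm (of_uhp (moebius_uhp g \<tau>)) \<le> C * norm (of_uhp \<tau>) ^ n)"
    by (intro exI[of _ K] exI[of _ 1] exI[of _ "1::nat"]) (auto simp: K_def)
qed

text \<open>The exponent 2 comes from the factor j^2 of the transformation law; the defect c j is of
  lower order.\<close>

lemma tempered_E2: "(\<lambda>\<tau>. Eisenstein_E2 (of_uhp \<tau>)) \<in> tempered"
proof (rule temperedI)
  show "(\<lambda>z. Eisenstein_E2 (of_uhp (Abs_uhp z))) holomorphic_on {z. Im z > 0}"
    by (rule holomorphic_transform[OF E2_holomorphic]) (simp add: Abs_uhp_inverse)
  obtain B where B: "\<And>z. Im z \<ge> 1 \<Longrightarrow> norm (Eisenstein_E2 z) \<le> B" using E2_bounded by blast
  have B0: "B \<ge> 0" using order.trans[OF norm_ge_zero B[of \<i>]] by simp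
  fix g assume g: "g \<in> carrier SL2Z"
  define K where "K = \<bar>real_of_int (g$2$1)\<bar> + \<bar>real_of_int (g$2$2)\<bar>"
  define C where "C = K\<^sup>2 * B + 6 / pi * \<bar>real_of_int (g$2$1)\<bar> * K"
  have "norm (Eisenstein_E2 (of_uhp (moebius_uhp g \<tau>))) \<le> C * norm (of_uhp \<tau>) ^ 2" if t: "Im (of_uhp \<tau>) > 1" for \<tau>
  proof -
    let ?t = "norm (of_uhp \<tau>)" and ?j = "automorphy_factor g \<tau>"
    have n1: "?t \<ge> 1" using norm_of_uhp_ge[OF t] .
    have j: "norm ?j \<le> K * ?t" using norm_automorphy_factor_le[OF n1] by (simp add: K_def)
    have "norm (?j\<^sup>2 * Eisenstein_E2 (of_uhp \<tau>)) \<le> (K * ?t)\<^sup>2 * B"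
      unfolding norm_mult norm_power using t B0 by (intro mult_mono power_mono j B) auto
    moreover have "norm (6 * \<i> / of_real pi * of_int (g$2$1) * ?j) \<le> 6 / pi * \<bar>real_of_int (g$2$1)\<bar> * (K * ?t\<^sup>2)"
    proof -
      have "K * ?t \<le> K * ?t\<^sup>2"
        using n1 mult_right_mono[OF n1, of ?t] by (intro mult_left_mono) (auto simp: K_def power2_eq_square)
      then have "6 / pi * \<bar>real_of_int (g$2$1)\<bar> * norm ?j \<le> 6 / pi * \<bar>real_of_int (g$2$1)\<bar> * (K * ?t\<^sup>2)"
        using j by (intro mult_left_mono) auto
      then show ?thesis by (simp add: norm_mult norm_divide)
    qed
    ultimately have "norm (Eisenstein_E2 (of_uhp (moebius_uhp g \<tau>))) \<le> (K * ?t)\<^sup>2 * B + 6 / pi * \<bar>real_of_int (g$2$1)\<bar> * (K * ?t\<^sup>2)"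
      unfolding E2_moebius_uhp[OF g] by (intro order.trans[OF norm_triangle_ineq4]) linarith
    then show ?thesis by (simp add: C_def power_mult_distrib ring_distribs mult_ac)
  qed
  moreover have "C \<ge> 0" using B0 by (simp add: C_def K_def)
  ultimately show "\<exists>C Y. \<exists>n::nat. C \<ge> 0 \<and> Y \<ge> 1 \<and> (\<forall>\<tau>. Im (of_uhp \<tau>) > Y \<longrightarrow>
        norm (Eisenstein_E2 (of_uhp (moebius_uhp g \<tau>))) \<le> C * norm (of_uhp \<tau>) ^ n)"
    by (intro exI[of _ C] exI[of _ 1] exI[of _ "2::nat"]) auto
qed

text \<open>The cusp is the preimage of infinity under g. It converts growth conditions indexed by
  cusps into conditions indexed by group elements.\<close>

lemma moebius_cusp_surj:
  assumes "g \<in> carrier SL2Z"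
  shows "\<exists>s. moebius_cusp g s = None"
proof (cases "g$2$1 = 0")
  case False
  then have "moebius_cusp g (Some (- of_int (g$2$2) / of_int (g$2$1))) = None"
    by (simp add: moebius_cusp_def)
  then show ?thesis ..
qed (auto intro!: exI[of _ None] simp: moebius_cusp_def)

text \<open>The two conditions differ in reading g or its inverse, in real against natural
  exponents, and in uniformity over the coordinates. The last point is settled by the finite set
  \<open>I\<close>: the constants of its members are summed, and coordinates outside it
  vanish.\<close>

lemma tempered_iff_growth:
  assumes "finite I" and "\<And>\<tau> i. i \<notin> I \<Longrightarrow> crd (f \<tau>) i = 0"
  shows "(\<forall>i. (\<lambda>z. crd (f (Abs_uhp z)) i) holomorphic_on {z. Im z > 0}) \<and> (\<forall>s. polynomial_growth_at crd f s)
    \<longleftrightarrow> (\<forall>i. (\<lambda>\<tau>. crd (f \<tau>) i) \<in> tempered)"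
proof safe
  fix i assume hol: "\<forall>i. (\<lambda>z. crd (f (Abs_uhp z)) i) holomorphic_on {z. Im z > 0}"
    and gr: "\<forall>s. polynomial_growth_at crd f s"
  show "(\<lambda>\<tau>. crd (f \<tau>) i) \<in> tempered"
  proof (rule temperedI)
    fix g assume g: "g \<in> carrier SL2Z"
    then have g': "SL2Z_inv g \<in> carrier SL2Z" by (rule SL2Z_inv_closed)
    then obtain s where "moebius_cusp (SL2Z_inv g) s = None" using moebius_cusp_surj by blast
    with gr g' obtain C N Y where *: "\<And>\<tau>. Im (of_uhp (moebius_uhp (SL2Z_inv g) \<tau>)) > Y \<Longrightarrow>
       cmod (crd (f \<tau>) i) < C * cmod (of_uhp (moebius_uhp (SL2Z_inv g) \<tau>)) powr N"
      unfolding polynomial_growth_at_def by blast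
    have "norm (crd (f (moebius_uhp g \<tau>)) i) \<le> \<bar>C\<bar> * norm (of_uhp \<tau>) ^ nat \<lceil>N\<rceil>" if t: "Im (of_uhp \<tau>) > max Y 1" for \<tau>
    proof -
      have n1: "norm (of_uhp \<tau>) \<ge> 1" using norm_of_uhp_ge[OF t] by simp
      have "norm (crd (f (moebius_uhp g \<tau>)) i) \<le> C * norm (of_uhp \<tau>) powr N"
        using *[of "moebius_uhp g \<tau>"] t g by simp
      also have "\<dots> \<le> \<bar>C\<bar> * norm (of_uhp \<tau>) powr N" by (intro mult_right_mono) auto
      also have "norm (of_uhp \<tau>) powr N \<le> norm (of_uhp \<tau>) powr real (nat \<lceil>N\<rceil>)"
        using n1 by (intro powr_mono) linarith+
      also have "\<dots> = norm (of_uhp \<tau>) ^ nat \<lceil>N\<rceil>" using n1 by (subst powr_realpow) auto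
      finally show ?thesis by (simp add: mult_left_mono)
    qed
    then show "\<exists>C Y. \<exists>n::nat. C \<ge> 0 \<and> Y \<ge> 1 \<and> (\<forall>\<tau>. Im (of_uhp \<tau>) > Y \<longrightarrow>
        norm (crd (f (moebius_uhp g \<tau>)) i) \<le> C * norm (of_uhp \<tau>) ^ n)"
      by (intro exI[of _ "\<bar>C\<bar>"] exI[of _ "max Y 1"] exI[of _ "nat \<lceil>N\<rceil>"]) auto
  qed (use hol in auto)
next
  fix s assume T: "\<forall>i. (\<lambda>\<tau>. crd (f \<tau>) i) \<in> tempered"
  show "polynomial_growth_at crd f s"
    unfolding polynomial_growth_at_def
  proof (intro ballI impI)
    fix g assume g: "g \<in> carrier SL2Z"
    then have g': "SL2Z_inv g \<in> carrier SL2Z" by (rule SL2Z_inv_closed)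
    have "\<forall>i. \<exists>C Y. \<exists>n::nat. C \<ge> 0 \<and> Y \<ge> 1 \<and> (\<forall>\<tau>. Im (of_uhp \<tau>) > Y \<longrightarrow>
        norm (crd (f (moebius_uhp (SL2Z_inv g) \<tau>)) i) \<le> C * norm (of_uhp \<tau>) ^ n)"
      using T g' by (auto simp: tempered_def)
    then obtain C Y n where CYn: "\<And>i. C i \<ge> (0::real)" "\<And>i. Y i \<ge> (1::real)"
      "\<And>i \<tau>. Im (of_uhp \<tau>) > Y i \<Longrightarrow>
        norm (crd (f (moebius_uhp (SL2Z_inv g) \<tau>)) i) \<le> C i * norm (of_uhp \<tau>) ^ (n i :: nat)"
      by metis
    \<comment> \<open>The summand 1 makes the inequality strict, also for coordinates that
      vanish.\<close>
    define C' where "C' = sum C I + 1"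
    define Y' where "Y' = 1 + sum Y I"
    define n' where "n' = sum n I"
    have "cmod (crd (f \<tau>) i) < C' * cmod (of_uhp (moebius_uhp g \<tau>)) powr n'"
      if t: "Im (of_uhp (moebius_uhp g \<tau>)) > Y'" for \<tau> i
    proof -
      let ?t = "norm (of_uhp (moebius_uhp g \<tau>))"
      have "sum Y I \<ge> 0" using CYn(2) by (intro sum_nonneg) (meson order.trans zero_le_one)
      then have Y'1: "Y' \<ge> 1" by (simp add: Y'_def)
      have n1: "?t \<ge> 1" using norm_of_uhp_ge[OF t] Y'1 by linarith
      have C'1: "C' > 0" using sum_nonneg[of I C] CYn(1) by (simp add: C'_def add_nonneg_pos)
      show ?thesis
      proof (cases "i \<in> I")
        case True
        have "Y i \<le> sum Y I" using True assms(1) CYn(2) by (intro member_le_sum) (auto intro: order.trans[OF zero_le_one])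
        then have "norm (crd (f \<tau>) i) \<le> C i * ?t ^ n i"
          using CYn(3)[of i "moebius_uhp g \<tau>"] t g by (simp add: Y'_def)
        also have "\<dots> \<le> C i * ?t ^ n'"
          using n1 CYn(1) True assms(1) by (intro mult_left_mono power_increasing) (auto simp: n'_def intro: member_le_sum)
        also have "\<dots> < C' * ?t ^ n'"
        proof (rule mult_strict_right_mono)
          have "C i \<le> sum C I" using True assms(1) CYn(1) by (intro member_le_sum) auto
          then show "C i < C'" by (simp add: C'_def)
          show "0 < ?t ^ n'" using n1 by (intro zero_less_power) linarith
        qed
        also have "?t ^ n' = ?t powr n'" using n1 by (subst powr_realpow) auto
        finally show ?thesis .
      next
        case False
        then show ?thesis using assms(2) C'1 n1 by (auto intro!: mult_pos_pos)
      qed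
    qed
    then show "\<exists>(C::real) (N::real) (Y::real). \<forall>\<tau>. Im (of_uhp (moebius_uhp g \<tau>)) > Y \<longrightarrow>
          (\<forall>i. cmod (crd (f \<tau>) i) < C * cmod (of_uhp (moebius_uhp g \<tau>)) powr N)"
      by blast
  qed
qed (auto dest: tempered_holomorphic)

lemma scalar_modular_forms_iff:
  "f \<in> scalar_modular_forms \<Gamma> k \<longleftrightarrow> f \<in> tempered \<and>
     (\<forall>\<gamma>\<in>\<Gamma>. \<forall>\<tau>. f (moebius_uhp \<gamma> \<tau>) = automorphy_factor \<gamma> \<tau> powi k * f \<tau>)"
  using tempered_iff_growth[of "UNIV :: unit set" "\<lambda>z _. z" f]
  unfolding scalar_modular_forms_def modular_forms_def by auto

section \<open>Symmetric powers\<close>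

abbreviation "lookup \<equiv> Poly_Mapping.lookup"
abbreviation "single \<equiv> Poly_Mapping.single"
abbreviation "keys \<equiv> Poly_Mapping.keys"

lemma sum_single_lookup:
  fixes v :: "'a \<Rightarrow>\<^sub>0 'b::comm_monoid_add"
  shows "(\<Sum>k\<in>keys v. single k (lookup v k)) = v"
proof (rule poly_mapping_eqI)
  fix m
  show "lookup (\<Sum>k\<in>keys v. single k (lookup v k)) m = lookup v m"
    by (cases "m \<in> keys v") (auto simp: lookup_sum lookup_single when_def in_keys_iff sum.delta)
qed

text \<open>A rule for claims additive in \<open>v\<close>: they need checking on monomials
  only.\<close>

lemma poly_mapping_sum_induct [case_names zero single add]:
  fixes v :: "'a \<Rightarrow>\<^sub>0 'b::comm_monoid_add"
  assumes "P 0" and "\<And>k c. P (single k c)" and "\<And>v w. P v \<Longrightarrow> P w \<Longrightarrow> P (v + w)"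
  shows "P v"
proof -
  have "P (\<Sum>k\<in>A. single k (lookup v k))" if "finite A" for A
    using that by (induction A rule: finite_induct) (auto intro: assms)
  then show ?thesis using sum_single_lookup[of v] by (metis finite_keys)
qed

lemma lookup_scale_sym [simp]: "lookup (scale_sym c v) m = c * lookup v m"
  by (simp add: scale_sym_def Poly_Mapping.map.rep_eq when_def)

lemma scale_sym_mult_single: "scale_sym c v = single 0 c * v"
  unfolding scale_sym_def by (rule mult_map_scale_conv_mult)

lemma scale_sym_simps [simp]: "scale_sym 1 v = v" "scale_sym 0 v = 0" "scale_sym c 0 = 0"
  "scale_sym a (scale_sym b v) = scale_sym (a * b) v" "scale_sym c (single m x) = single m (c * x)"
  by (auto intro!: poly_mapping_eqI simp: lookup_single when_def)

lemma scale_sym_add: "scale_sym c (v + w) = scale_sym c v + scale_sym c w"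
  and scale_sym_add_left: "scale_sym (a + b) v = scale_sym a v + scale_sym b v"
  by (auto intro!: poly_mapping_eqI simp: lookup_add algebra_simps)

lemma scale_sym_mult: "scale_sym c v * w = scale_sym c (v * w)" "v * scale_sym c w = scale_sym c (v * w)"
  by (simp_all add: scale_sym_mult_single mult_ac)

lemma scale_sym_sum: "scale_sym c (sum f A) = (\<Sum>i\<in>A. scale_sym c (f i))"
  by (simp add: scale_sym_mult_single sum_distrib_left)

lemma sym_rep_0 [simp]: "sym_rep A 0 = 0"
  by (simp add: sym_rep_def)

lemma sym_rep_single: "sym_rep A (single m c) =
    scale_sym c (sym_linear (A$1$1) (A$2$1) ^ fst m * sym_linear (A$1$2) (A$2$2) ^ snd m)"
  by (cases "c = 0") (simp_all add: sym_rep_def)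

lemma sym_rep_add: "sym_rep A (v + w) = sym_rep A v + sym_rep A w"
  unfolding sym_rep_def
  by (rule setsum_keys_plus_distrib) (simp_all add: scale_sym_add_left)

lemma sym_rep_scale: "sym_rep A (scale_sym c v) = scale_sym c (sym_rep A v)"
  by (induction v rule: poly_mapping_sum_induct) (simp_all add: sym_rep_single sym_rep_add scale_sym_add)

lemma sym_rep_sum: "sym_rep A (sum f I) = (\<Sum>i\<in>I. sym_rep A (f i))"
  by (induction I rule: infinite_finite_induct) (simp_all add: sym_rep_add)

lemma sym_rep_mult_single: "sym_rep A (single k c * single l d) = sym_rep A (single k c) * sym_rep A (single l d)"
  by (simp add: mult_single sym_rep_single scale_sym_mult power_add mult_ac)

lemma sym_rep_times: "sym_rep A (v * w) = sym_rep A v * sym_rep A w"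
proof (induction v rule: poly_mapping_sum_induct)
  case (single k c)
  show ?case
    by (induction w rule: poly_mapping_sum_induct) (simp_all add: sym_rep_mult_single distrib_left sym_rep_add)
qed (simp_all add: distrib_right sym_rep_add)

lemma sym_rep_one: "sym_rep A 1 = 1"
  using sym_rep_single[of A 0 1] by simp

lemma sym_rep_power: "sym_rep A (v ^ k) = sym_rep A v ^ k"
  by (induction k) (simp_all add: sym_rep_one sym_rep_times)

lemma scale_sym_linear: "scale_sym c (sym_linear x y) = sym_linear (c * x) (c * y)"
  by (simp add: sym_linear_def scale_sym_add)

lemma sym_linear_add: "sym_linear x y + sym_linear x' y' = sym_linear (x + x') (y + y')"
  by (simp add: sym_linear_def single_add)

lemma sym_rep_linear: "sym_rep A (sym_linear x y) =
   sym_linear (A$1$1 * x + A$1$2 * y) (A$2$1 * x + A$2$2 * y)"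
  unfolding sym_linear_def[of x y]
  by (simp add: sym_rep_add sym_rep_single scale_sym_linear sym_linear_add mult_ac)

text \<open>Each \<open>sym_rep A\<close> is an algebra endomorphism of the polynomial ring, hence
  determined by linear forms, where the claim is multiplication of matrices.\<close>

lemma sym_rep_comp: "sym_rep A (sym_rep B v) = sym_rep (A ** B) v"
  by (induction v rule: poly_mapping_sum_induct)
    (simp_all add: sym_rep_add sym_rep_single sym_rep_scale sym_rep_times sym_rep_power sym_rep_linear SL2Z_mult_nth)

section \<open>Diagonal and unipotent matrices, and the operators H, E, F\<close>

abbreviation mat2 :: "'a \<Rightarrow> 'a \<Rightarrow> 'a \<Rightarrow> 'a \<Rightarrow> 'a::zero^2^2" where
  "mat2 a b c d \<equiv> vector [vector [a, b], vector [c, d]]"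

lemma mat2_nth [simp]: "(mat2 a b c d :: 'a::zero^2^2) $ 1 $ 1 = a" "(mat2 a b c d :: 'a::zero^2^2) $ 1 $ 2 = b"
  "(mat2 a b c d :: 'a::zero^2^2) $ 2 $ 1 = c" "(mat2 a b c d :: 'a::zero^2^2) $ 2 $ 2 = d"
  by simp_all

lemma single_power_1: "single (Suc 0, 0) (x::complex) ^ k = single (k, 0) (x ^ k)"
  and single_power_2: "single (0, Suc 0) (x::complex) ^ k = single (0, k) (x ^ k)"
  by (induction k) (simp_all add: mult_single plus_prod_def flip: zero_prod_def)

lemma sym_rep_diag: "lookup (sym_rep (mat2 s 0 0 t) v) (a, b) = s ^ a * t ^ b * lookup v (a, b)"
proof (induction v rule: poly_mapping_sum_induct)
  case (single k c)
  have "sym_linear s 0 = single (1, 0) s" "sym_linear 0 t = single (0, 1) t"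
    by (simp_all add: sym_linear_def)
  then show ?case
    by (cases k) (auto simp: sym_rep_single single_power_1 single_power_2 mult_single lookup_single when_def)
qed (simp_all add: sym_rep_add lookup_add algebra_simps)

lemma sym_rep_upper_single:
  "sym_rep (mat2 1 t 0 1) (single (i, j) c) = (\<Sum>k\<le>j. single (i + k, j - k) (of_nat (j choose k) * t ^ k * c))"
proof -
  have 1: "sym_linear 1 0 = single (1, 0) 1" "sym_linear t 1 = single (1, 0) t + single (0, 1) 1"
    by (simp_all add: sym_linear_def)
  have "sym_linear 1 0 ^ i * sym_linear t 1 ^ j =
     single (i, 0) 1 * (\<Sum>k\<le>j. of_nat (j choose k) * single (1, 0) t ^ k * single (0, 1) 1 ^ (j - k))"
    unfolding 1 binomial_ring by (simp add: single_power_1)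
  also have "\<dots> = (\<Sum>k\<le>j. single (i + k, j - k) (of_nat (j choose k) * t ^ k))"
    unfolding sum_distrib_left
    by (intro sum.cong refl) (simp add: single_power_1 single_power_2 mult_single flip: single_of_nat)
  finally show ?thesis
    by (simp add: sym_rep_single scale_sym_sum mult_ac)
qed

lemma sym_rep_lower_single:
  "sym_rep (mat2 1 0 t 1) (single (i, j) c) = (\<Sum>k\<le>i. single (i - k, j + k) (of_nat (i choose k) * t ^ k * c))"
proof -
  have 1: "sym_linear 0 1 = single (0, 1) 1" "sym_linear 1 t = single (0, 1) t + single (1, 0) 1"
    by (simp_all add: sym_linear_def add.commute)
  have "sym_linear 1 t ^ i * sym_linear 0 1 ^ j =
     single (0, j) 1 * (\<Sum>k\<le>i. of_nat (i choose k) * single (0, 1) t ^ k * single (1, 0) 1 ^ (i - k))"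
    unfolding 1 binomial_ring by (simp add: single_power_2 mult.commute)
  also have "\<dots> = (\<Sum>k\<le>i. single (i - k, j + k) (of_nat (i choose k) * t ^ k))"
    unfolding sum_distrib_left
    by (intro sum.cong refl) (simp add: single_power_1 single_power_2 mult_single flip: single_of_nat)
  finally show ?thesis
    by (simp add: sym_rep_single scale_sym_sum mult_ac)
qed

text \<open>The index k counts the factors \<open>e\<^sub>2\<close> that are replaced by t
  \<open>e\<^sub>1\<close> in \<open>(t e\<^sub>1 + e\<^sub>2) ^ (b + k)\<close>. The form by
  coefficients, polynomial in t, serves three times: for the derivative at t = 0, for the
  exponential, and for growth.\<close>

lemma sym_rep_upper:
  "lookup (sym_rep (mat2 1 t 0 1) v) (a, b) =
     (\<Sum>k\<le>a. of_nat ((b + k) choose k) * t ^ k * lookup v (a - k, b + k))"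
proof (induction v rule: poly_mapping_sum_induct)
  case (single m c)
  obtain i j where m: "m = (i, j)" by force
  have "(\<Sum>k\<le>j. (of_nat (j choose k) * t ^ k * c when (i + k, j - k) = (a, b))) =
      (\<Sum>k\<le>a. of_nat ((b + k) choose k) * t ^ k * (c when (i, j) = (a - k, b + k)))"
    (is "sum ?f _ = sum ?g _")
  proof -
    have "sum ?f {..j} = sum ?f {k. i + k = a \<and> b + k = j}"
      by (rule sum.mono_neutral_right) (auto simp: when_def)
    also have "\<dots> = sum ?g {k. i + k = a \<and> b + k = j}"
      by (rule sum.cong) auto
    also have "\<dots> = sum ?g {..a}"
      by (rule sum.mono_neutral_left) (auto simp: when_def)
    finally show ?thesis .
  qed
  then show ?case
    by (simp add: m sym_rep_upper_single lookup_sum lookup_single)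
qed (simp_all add: sym_rep_add lookup_add algebra_simps sum.distrib)

lemma sym_rep_lower:
  "lookup (sym_rep (mat2 1 0 t 1) v) (a, b) =
     (\<Sum>k\<le>b. of_nat ((a + k) choose k) * t ^ k * lookup v (a + k, b - k))"
proof (induction v rule: poly_mapping_sum_induct)
  case (single m c)
  obtain i j where m: "m = (i, j)" by force
  have "(\<Sum>k\<le>i. (of_nat (i choose k) * t ^ k * c when (i - k, j + k) = (a, b))) =
      (\<Sum>k\<le>b. of_nat ((a + k) choose k) * t ^ k * (c when (i, j) = (a + k, b - k)))"
    (is "sum ?f _ = sum ?g _")
  proof -
    have "sum ?f {..i} = sum ?f {k. j + k = b \<and> a + k = i}"
      by (rule sum.mono_neutral_right) (auto simp: when_def)
    also have "\<dots> = sum ?g {k. j + k = b \<and> a + k = i}"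
      by (rule sum.cong) auto
    also have "\<dots> = sum ?g {..b}"
      by (rule sum.mono_neutral_left) (auto simp: when_def)
    finally show ?thesis .
  qed
  then show ?case
    by (simp add: m sym_rep_lower_single lookup_sum lookup_single)
qed (simp_all add: sym_rep_add lookup_add algebra_simps sum.distrib)

lemma deriv_poly_0: "deriv (\<lambda>t. \<Sum>k\<le>a. t ^ k * c k) (0::complex) = (if a = 0 then 0 else c 1)"
proof -
  have "((\<lambda>t. \<Sum>k\<le>a. t ^ k * c k) has_field_derivative (\<Sum>k\<le>a. of_nat k * 0 ^ (k - 1) * c k)) (at 0)"
    by (auto intro!: derivative_eq_intros sum.cong)
  then have "deriv (\<lambda>t. \<Sum>k\<le>a. t ^ k * c k) 0 = (\<Sum>k\<le>a. of_nat k * 0 ^ (k - 1) * c k)"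
    by (rule DERIV_imp_deriv)
  also have "\<dots> = (\<Sum>k\<in>{..a} \<inter> {1}. of_nat k * 0 ^ (k - 1) * c k)"
    by (rule sum.mono_neutral_right) (auto simp: power_0_left)
  also have "\<dots> = (if a = 0 then 0 else c 1)"
  proof (cases "a = 0")
    case False
    then have "{..a} \<inter> {1} = {1}" by auto
    then show ?thesis using False by simp
  qed auto
  finally show ?thesis .
qed

lemma lookup_E_op: "lookup (E_op v) (a, b) = (if a = 0 then 0 else of_nat (b + 1) * lookup v (a - 1, b + 1))"
proof -
  define f where "f = (\<lambda>(a::nat, b::nat). if a = 0 then 0 else of_nat (b + 1) * lookup v (a - 1, b + 1))"
  have "(\<chi> i j. mat 1 $ i $ j + t * mat2 0 1 0 0 $ i $ j) = mat2 1 t 0 (1::complex)" for t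
    by (intro mat2_eqI) (simp_all add: mat_def)
  then have "deriv (\<lambda>t. lookup (sym_rep (\<chi> i j. mat 1 $ i $ j + t * mat2 0 1 0 0 $ i $ j) v) m) 0 = f m" for m
    by (cases m) (simp add: sym_rep_upper f_def mult_ac deriv_poly_0)
  then have "E_op v = Abs_poly_mapping f" by (simp add: E_op_def d_sym_rep_def)
  \<comment> \<open>Finite support is what allows the coefficients to be read back from
    \<open>Abs_poly_mapping f\<close>.\<close>
  moreover have "finite {m. f m \<noteq> 0}"
  proof (rule finite_subset)
    show "{m. f m \<noteq> 0} \<subseteq> (\<lambda>(i, j). (i + 1, j - 1)) ` keys v"
    proof
      fix m assume "m \<in> {m. f m \<noteq> 0}"
      then have "m = (\<lambda>(i, j). (i + 1, j - 1)) (fst m - 1, snd m + 1)" "(fst m - 1, snd m + 1) \<in> keys v"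
        by (auto simp: f_def in_keys_iff split: prod.splits if_splits)
      then show "m \<in> (\<lambda>(i, j). (i + 1, j - 1)) ` keys v" by (rule image_eqI)
    qed
  qed simp
  ultimately show ?thesis by (simp add: f_def)
qed

lemma lookup_F_op: "lookup (F_op v) (a, b) = (if b = 0 then 0 else of_nat (a + 1) * lookup v (a + 1, b - 1))"
proof -
  define f where "f = (\<lambda>(a::nat, b::nat). if b = 0 then 0 else of_nat (a + 1) * lookup v (a + 1, b - 1))"
  have "(\<chi> i j. mat 1 $ i $ j + t * mat2 0 0 1 0 $ i $ j) = mat2 1 0 t (1::complex)" for t
    by (intro mat2_eqI) (simp_all add: mat_def)
  then have "deriv (\<lambda>t. lookup (sym_rep (\<chi> i j. mat 1 $ i $ j + t * mat2 0 0 1 0 $ i $ j) v) m) 0 = f m" for m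
    by (cases m) (simp add: sym_rep_lower f_def mult_ac deriv_poly_0)
  then have "F_op v = Abs_poly_mapping f" by (simp add: F_op_def d_sym_rep_def)
  moreover have "finite {m. f m \<noteq> 0}"
  proof (rule finite_subset)
    show "{m. f m \<noteq> 0} \<subseteq> (\<lambda>(i, j). (i - 1, j + 1)) ` keys v"
    proof
      fix m assume "m \<in> {m. f m \<noteq> 0}"
      then have "m = (\<lambda>(i, j). (i - 1, j + 1)) (fst m + 1, snd m - 1)" "(fst m + 1, snd m - 1) \<in> keys v"
        by (auto simp: f_def in_keys_iff split: prod.splits if_splits)
      then show "m \<in> (\<lambda>(i, j). (i - 1, j + 1)) ` keys v" by (rule image_eqI)
    qed
  qed simp
  ultimately show ?thesis by (simp add: f_def)
qed

lemma lookup_H_op: "lookup (H_op v) (a, b) = (of_nat a - of_nat b) * lookup v (a, b)"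
proof -
  define f where "f = (\<lambda>(a::nat, b::nat). (of_nat a - of_nat b) * lookup v (a, b))"
  have "(\<chi> i j. mat 1 $ i $ j + t * mat2 1 0 0 (-1) $ i $ j) = mat2 (1 + t) 0 0 (1 - t :: complex)" for t
    by (intro mat2_eqI) (simp_all add: mat_def)
  moreover have "((\<lambda>t. (1 + t) ^ a * (1 - t) ^ b * c) has_field_derivative ((of_nat a - of_nat b) * c)) (at (0::complex))"
    for a b c by (auto intro!: derivative_eq_intros simp: algebra_simps)
  ultimately have "deriv (\<lambda>t. lookup (sym_rep (\<chi> i j. mat 1 $ i $ j + t * mat2 1 0 0 (-1) $ i $ j) v) m) 0 = f m" for m
    by (cases m) (simp add: sym_rep_diag f_def DERIV_imp_deriv)
  then have "H_op v = Abs_poly_mapping f" by (simp add: H_op_def d_sym_rep_def)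
  moreover have "finite {m. f m \<noteq> 0}"
    by (rule finite_subset[of _ "keys v"]) (auto simp: f_def in_keys_iff)
  ultimately show ?thesis by (simp add: f_def)
qed

text \<open>Each application of E raises the exponent of \<open>e\<^sub>1\<close>, so a coordinate
  \<open>(a, b)\<close> sees only the powers k \<le> a and the exponential series is finite there.
  The quotient of factorials in the k-th iterate, divided by k!, is the binomial coefficient of
  \<open>sym_rep_upper\<close>.\<close>

lemma exp_op_E: "exp_op (\<lambda>w. scale_sym t (E_op w)) v = sym_rep (mat2 1 t 0 1) v"
proof -
  let ?A = "\<lambda>w. scale_sym t (E_op w)"
  have *: "lookup ((?A ^^ k) v) (a, b) =
     (if k \<le> a then t ^ k * (fact (b + k) / fact b) * lookup v (a - k, b + k) else 0)" for k a b
  proof (induction k arbitrary: a b)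
    case (Suc k)
    show ?case
    proof (cases "a = 0")
      case False
      have "of_nat (Suc b) * (fact (Suc b + k) / fact (Suc b)) = (fact (b + Suc k) / fact b :: complex)"
        by (simp add: field_simps del: of_nat_Suc)
      then show ?thesis
        using False Suc.IH[of "a - 1" "b + 1"] by (auto simp: lookup_E_op)
    qed (simp add: lookup_E_op)
  qed simp
  have "suminf (\<lambda>k. lookup ((?A ^^ k) v) m / fact k) = lookup (sym_rep (mat2 1 t 0 1) v) m" for m
  proof -
    obtain a b where m: "m = (a, b)" by force
    have "suminf (\<lambda>k. lookup ((?A ^^ k) v) m / fact k) = (\<Sum>k\<le>a. lookup ((?A ^^ k) v) m / fact k)"
      by (rule suminf_finite) (auto simp: m *)
    also have "\<dots> = lookup (sym_rep (mat2 1 t 0 1) v) m"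
      unfolding m sym_rep_upper by (rule sum.cong) (auto simp: * binomial_fact mult_ac)
    finally show ?thesis .
  qed
  then show ?thesis by (simp add: exp_op_def lookup_inverse)
qed

lemma exp_op_F: "exp_op (\<lambda>w. scale_sym t (F_op w)) v = sym_rep (mat2 1 0 t 1) v"
proof -
  let ?A = "\<lambda>w. scale_sym t (F_op w)"
  have *: "lookup ((?A ^^ k) v) (a, b) =
     (if k \<le> b then t ^ k * (fact (a + k) / fact a) * lookup v (a + k, b - k) else 0)" for k a b
  proof (induction k arbitrary: a b)
    case (Suc k)
    show ?case
    proof (cases "b = 0")
      case False
      have "of_nat (Suc a) * (fact (Suc a + k) / fact (Suc a)) = (fact (a + Suc k) / fact a :: complex)"
        by (simp add: field_simps del: of_nat_Suc)
      then show ?thesis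
        using False Suc.IH[of "a + 1" "b - 1"] by (auto simp: lookup_F_op)
    qed (simp add: lookup_F_op)
  qed simp
  have "suminf (\<lambda>k. lookup ((?A ^^ k) v) m / fact k) = lookup (sym_rep (mat2 1 0 t 1) v) m" for m
  proof -
    obtain a b where m: "m = (a, b)" by force
    have "suminf (\<lambda>k. lookup ((?A ^^ k) v) m / fact k) = (\<Sum>k\<le>b. lookup ((?A ^^ k) v) m / fact k)"
      by (rule suminf_finite) (auto simp: m *)
    also have "\<dots> = lookup (sym_rep (mat2 1 0 t 1) v) m"
      unfolding m sym_rep_lower by (rule sum.cong) (auto simp: * binomial_fact mult_ac)
    finally show ?thesis .
  qed
  then show ?thesis by (simp add: exp_op_def lookup_inverse)
qed

section \<open>The symmetric power and its monomial basis\<close>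

lemma Sym_iff: "v \<in> Sym n \<longleftrightarrow> (\<forall>a b. a + b \<noteq> n \<longrightarrow> lookup v (a, b) = 0)"
  unfolding Sym_def mem_Collect_eq Ball_def in_keys_iff split_paired_All by auto

lemma Sym_subspace [intro, simp]: "0 \<in> Sym n" "v \<in> Sym n \<Longrightarrow> w \<in> Sym n \<Longrightarrow> v + w \<in> Sym n"
  "v \<in> Sym n \<Longrightarrow> scale_sym c v \<in> Sym n"
  by (simp_all add: Sym_iff lookup_add)

lemma Sym_sum: "(\<And>i. i \<in> I \<Longrightarrow> f i \<in> Sym n) \<Longrightarrow> sum f I \<in> Sym n"
  by (induction I rule: infinite_finite_induct) auto

lemma Sym_upper: "v \<in> Sym n \<Longrightarrow> sym_rep (mat2 1 t 0 1) v \<in> Sym n"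
  unfolding Sym_iff sym_rep_upper by (auto intro!: sum.neutral)

lemma Sym_lower: "v \<in> Sym n \<Longrightarrow> sym_rep (mat2 1 0 t 1) v \<in> Sym n"
  unfolding Sym_iff sym_rep_lower by (auto intro!: sum.neutral)

text \<open>Indexed by the exponent of \<open>e\<^sub>1\<close>; this monomial has weight 2 a -
  n.\<close>

definition sym_basis :: "nat \<Rightarrow> nat \<Rightarrow> sym" where
  "sym_basis n a = single (a, n - a) 1"

lemma sym_basis_Sym [simp]: "a \<le> n \<Longrightarrow> sym_basis n a \<in> Sym n"
  by (auto simp: sym_basis_def Sym_iff lookup_single when_def)

lemma lookup_sym_basis: "a \<le> n \<Longrightarrow> b \<le> n \<Longrightarrow> lookup (sym_basis n a) (b, n - b) = (if a = b then 1 else 0)"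
  by (auto simp: sym_basis_def lookup_single when_def)

lemma Sym_eqI:
  assumes "v \<in> Sym n" "w \<in> Sym n" "\<And>a. a \<le> n \<Longrightarrow> lookup v (a, n - a) = lookup w (a, n - a)"
  shows "v = w"
proof (rule poly_mapping_eqI)
  fix m :: "nat \<times> nat"
  obtain a b where m: "m = (a, b)" by force
  show "lookup v m = lookup w m"
  proof (cases "a + b = n")
    case True
    then have "a \<le> n" "b = n - a" by auto
    then show ?thesis using assms(3) m by simp
  next
    case False
    then show ?thesis using assms(1,2) m by (simp add: Sym_iff)
  qed
qed

lemma lookup_sum_sym_basis:
  assumes "b \<le> n"
  shows "lookup (\<Sum>a\<le>n. scale_sym (c a) (sym_basis n a)) (b, n - b) = c b"
proof -
  have "lookup (\<Sum>a\<le>n. scale_sym (c a) (sym_basis n a)) (b, n - b) = (\<Sum>a\<le>n. if a = b then c a else 0)"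
    unfolding lookup_sum by (rule sum.cong) (use assms in \<open>auto simp: lookup_sym_basis\<close>)
  then show ?thesis using assms by simp
qed

lemma Sym_expand:
  assumes "v \<in> Sym n"
  shows "v = (\<Sum>a\<le>n. scale_sym (lookup v (a, n - a)) (sym_basis n a))"
  by (rule Sym_eqI[OF assms]) (auto intro: Sym_sum simp: lookup_sum_sym_basis)

lemma sym_rep_1: "sym_rep (mat 1) v = v"
proof -
  have "mat 1 = mat2 1 0 0 (1::complex)" by (intro mat2_eqI) (simp_all add: mat_def)
  then show ?thesis by (intro poly_mapping_eqI) (auto simp: sym_rep_diag)
qed

section \<open>The fundamental matrix\<close>

definition E2_slope :: "uhp \<Rightarrow> complex" where
  "E2_slope \<tau> = 2 * pi * \<i> * (Eisenstein_E2 (of_uhp \<tau>) / 12)"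

definition Phi_point_inv :: "uhp \<Rightarrow> sym \<Rightarrow> sym" where
  "Phi_point_inv \<tau> v = sym_rep (mat2 1 0 (- E2_slope \<tau>) 1) (sym_rep (mat2 1 (- of_uhp \<tau>) 0 1) v)"

lemma Phi_point_eq: "Phi_point \<tau> v = sym_rep (mat2 1 (of_uhp \<tau>) 0 1) (sym_rep (mat2 1 0 (E2_slope \<tau>) 1) v)"
  by (simp add: Phi_point_def exp_op_E exp_op_F E2_slope_def)

lemma Phi_point_scale: "Phi_point \<tau> (scale_sym c v) = scale_sym c (Phi_point \<tau> v)"
  and Phi_point_sum: "Phi_point \<tau> (sum f I) = (\<Sum>i\<in>I. Phi_point \<tau> (f i))"
  and Phi_point_Sym: "v \<in> Sym n \<Longrightarrow> Phi_point \<tau> v \<in> Sym n"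
  by (simp_all add: Phi_point_eq sym_rep_scale sym_rep_sum Sym_lower Sym_upper)

lemma Phi_point_inv_scale: "Phi_point_inv \<tau> (scale_sym c v) = scale_sym c (Phi_point_inv \<tau> v)"
  and Phi_point_inv_Sym: "v \<in> Sym n \<Longrightarrow> Phi_point_inv \<tau> v \<in> Sym n"
  by (simp_all add: Phi_point_inv_def sym_rep_scale Sym_lower Sym_upper)

lemma Phi_point_inverse: "Phi_point \<tau> (Phi_point_inv \<tau> v) = v" "Phi_point_inv \<tau> (Phi_point \<tau> v) = v"
proof -
  have u: "mat2 1 s 0 1 ** mat2 1 (- s) 0 1 = mat (1::complex)" for s
    by (intro mat2_eqI) (simp_all add: SL2Z_mult_nth mat_def)
  have l: "mat2 1 0 s 1 ** mat2 1 0 (- s) 1 = mat (1::complex)" for s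
    by (intro mat2_eqI) (simp_all add: SL2Z_mult_nth mat_def)
  show "Phi_point \<tau> (Phi_point_inv \<tau> v) = v" "Phi_point_inv \<tau> (Phi_point \<tau> v) = v"
    unfolding Phi_point_eq Phi_point_inv_def
    using sym_rep_comp[of "mat2 1 0 (E2_slope \<tau>) 1" "mat2 1 0 (- E2_slope \<tau>) 1"] l[of "E2_slope \<tau>"]
      sym_rep_comp[of "mat2 1 0 (- E2_slope \<tau>) 1" "mat2 1 0 (E2_slope \<tau>) 1"] l[of "- E2_slope \<tau>"]
      sym_rep_comp[of "mat2 1 (of_uhp \<tau>) 0 1" "mat2 1 (- of_uhp \<tau>) 0 1"] u[of "of_uhp \<tau>"]
      sym_rep_comp[of "mat2 1 (- of_uhp \<tau>) 0 1" "mat2 1 (of_uhp \<tau>) 0 1"] u[of "- of_uhp \<tau>"]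
    by (simp_all add: sym_rep_1)
qed

text \<open>The product of 2 \<pi> i / 12 and -6 i / \<pi> is 1, so the defect of the rescaled
  function is exactly c j.\<close>

lemma E2_slope_moebius:
  assumes "g \<in> carrier SL2Z"
  shows "E2_slope (moebius_uhp g \<tau>) =
    automorphy_factor g \<tau> ^ 2 * E2_slope \<tau> + of_int (g$2$1) * automorphy_factor g \<tau>"
  unfolding E2_slope_def E2_moebius_uhp[OF assms] by (simp add: field_simps)

lemma Phi_point_moebius:
  assumes g: "g \<in> carrier SL2Z"
  shows "Phi_point (moebius_uhp g \<tau>) v =
    rho g (Phi_point \<tau> (sym_rep (mat2 (automorphy_factor g \<tau>) 0 0 (1 / automorphy_factor g \<tau>)) v))"
proof -
  define j t w where "j = automorphy_factor g \<tau>" and "t = of_uhp \<tau>" and "w = E2_slope \<tau>"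
  define a b c d :: complex where "a = of_int (g$1$1)" "b = of_int (g$1$2)" "c = of_int (g$2$1)" "d = of_int (g$2$2)"
  have j0: "j \<noteq> 0" using automorphy_factor_nonzero[OF g] by (simp add: j_def)
  have det: "a * d - b * c = 1"
    using g unfolding SL2Z_iff a_b_c_d_def by (metis of_int_1 of_int_diff of_int_mult)
  have j: "j = c * t + d" by (simp add: j_def automorphy_factor_def a_b_c_d_def t_def)
  \<comment> \<open>The determinant condition in the shape in which it enters the upper left
    entry.\<close>
  have aj: "a * j = 1 + c * (a * t + b)" using det by (simp add: j algebra_simps)
  have "map_matrix of_int g ** (mat2 1 t 0 1 ** (mat2 1 0 w 1 ** mat2 j 0 0 (1 / j)))
      = mat2 1 ((a * t + b) / j) 0 1 ** mat2 1 0 (j\<^sup>2 * w + c * j) (1::complex)"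
  proof (intro mat2_eqI)
    have "a * ((1 + t * w) * j) + b * (w * j) = a * j + (a * t + b) * (w * j)" by (simp add: algebra_simps)
    also have "\<dots> = 1 + (a * t + b) / j * (j\<^sup>2 * w + c * j)"
      unfolding aj using j0 by (simp add: field_simps power2_eq_square)
    finally show "(map_matrix of_int g ** (mat2 1 t 0 1 ** (mat2 1 0 w 1 ** mat2 j 0 0 (1 / j)))) $ 1 $ 1
      = (mat2 1 ((a * t + b) / j) 0 1 ** mat2 1 0 (j\<^sup>2 * w + c * j) (1::complex)) $ 1 $ 1"
      by (simp add: SL2Z_mult_nth a_b_c_d_def algebra_simps)
    show "(map_matrix of_int g ** (mat2 1 t 0 1 ** (mat2 1 0 w 1 ** mat2 j 0 0 (1 / j)))) $ 1 $ 2
      = (mat2 1 ((a * t + b) / j) 0 1 ** mat2 1 0 (j\<^sup>2 * w + c * j) (1::complex)) $ 1 $ 2"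
      by (simp add: SL2Z_mult_nth a_b_c_d_def add_divide_distrib)
    have "c * (j + t * (w * j)) + d * (w * j) = (c * t + d) * w * j + c * j" by (simp add: algebra_simps)
    then have "c * (j + t * (w * j)) + d * (w * j) = j\<^sup>2 * w + c * j"
      by (simp add: j[symmetric] power2_eq_square mult_ac)
    then show "(map_matrix of_int g ** (mat2 1 t 0 1 ** (mat2 1 0 w 1 ** mat2 j 0 0 (1 / j)))) $ 2 $ 1
      = (mat2 1 ((a * t + b) / j) 0 1 ** mat2 1 0 (j\<^sup>2 * w + c * j) (1::complex)) $ 2 $ 1"
      by (simp add: SL2Z_mult_nth a_b_c_d_def[symmetric])
    have "c * (t / j) + d * (1 / j) = 1" using j0 by (simp add: j[symmetric] field_simps flip: add_divide_distrib) (simp add: j mult.commute)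
    then show "(map_matrix of_int g ** (mat2 1 t 0 1 ** (mat2 1 0 w 1 ** mat2 j 0 0 (1 / j)))) $ 2 $ 2
      = (mat2 1 ((a * t + b) / j) 0 1 ** mat2 1 0 (j\<^sup>2 * w + c * j) (1::complex)) $ 2 $ 2"
      by (simp add: SL2Z_mult_nth a_b_c_d_def)
  qed
  moreover have "of_uhp (moebius_uhp g \<tau>) = (a * t + b) / j"
    by (simp add: of_uhp_moebius[OF g] a_b_c_d_def t_def j_def)
  moreover have "E2_slope (moebius_uhp g \<tau>) = j\<^sup>2 * w + c * j"
    by (simp add: E2_slope_moebius[OF g] a_b_c_d_def w_def j_def)
  ultimately show ?thesis
    by (simp only: Phi_point_eq rho_def sym_rep_comp matrix_mul_assoc flip: j_def t_def w_def)
qed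

lemma sym_rep_diag_basis:
  assumes "j \<noteq> 0" "a \<le> n"
  shows "sym_rep (mat2 j 0 0 (1 / j)) (sym_basis n a) = scale_sym (j powi (2 * int a - int n)) (sym_basis n a)"
proof (rule poly_mapping_eqI)
  fix m :: "nat \<times> nat"
  obtain b c where m: "m = (b, c)" by force
  have "j ^ a * (1 / j) ^ b = j powi (int a - int b)" for b
    using assms by (simp add: power_int_diff power_one_over)
  then have "j ^ a * (1 / j) ^ (n - a) = j powi (int a - int (n - a))" .
  also have "int a - int (n - a) = 2 * int a - int n" using assms by simp
  finally show "lookup (sym_rep (mat2 j 0 0 (1 / j)) (sym_basis n a)) m =
    lookup (scale_sym (j powi (2 * int a - int n)) (sym_basis n a)) m"
    unfolding m sym_rep_diag by (auto simp: sym_basis_def lookup_single when_def)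
qed

lemma rho_scale: "rho g (scale_sym c v) = scale_sym c (rho g v)"
  by (simp add: rho_def sym_rep_scale)

lemma tempered_E2_slope: "E2_slope \<in> tempered"
  unfolding E2_slope_def[abs_def] divide_inverse
  by (intro tempered_mult tempered_const tempered_E2)

lemma tempered_upper:
  assumes "\<And>m. (\<lambda>\<tau>. lookup (v \<tau>) m) \<in> tempered" "t \<in> tempered"
  shows "(\<lambda>\<tau>. lookup (sym_rep (mat2 1 (t \<tau>) 0 1) (v \<tau>)) m) \<in> tempered"
  by (cases m) (auto simp: sym_rep_upper intro!: tempered_sum tempered_mult tempered_const tempered_power assms)

lemma tempered_lower:
  assumes "\<And>m. (\<lambda>\<tau>. lookup (v \<tau>) m) \<in> tempered" "t \<in> tempered"
  shows "(\<lambda>\<tau>. lookup (sym_rep (mat2 1 0 (t \<tau>) 1) (v \<tau>)) m) \<in> tempered"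
  by (cases m) (auto simp: sym_rep_lower intro!: tempered_sum tempered_mult tempered_const tempered_power assms)

lemma tempered_minus: "f \<in> tempered \<Longrightarrow> (\<lambda>\<tau>. - f \<tau>) \<in> tempered"
  using tempered_mult[OF tempered_const[of "-1"], of f] by simp

text \<open>The coordinates are polynomials in \<tau>, the slope and the coordinates of
  \<open>v\<close>, so the ring property of \<open>tempered\<close> applies. Having it for U and for
  its inverse transfers growth in both directions.\<close>

lemma tempered_Phi_point:
  assumes "\<And>m. (\<lambda>\<tau>. lookup (v \<tau>) m) \<in> tempered"
  shows "(\<lambda>\<tau>. lookup (Phi_point \<tau> (v \<tau>)) m) \<in> tempered"
    and "(\<lambda>\<tau>. lookup (Phi_point_inv \<tau> (v \<tau>)) m) \<in> tempered"
  unfolding Phi_point_eq Phi_point_inv_def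
  by (intro tempered_upper tempered_lower tempered_E2_slope tempered_of_uhp tempered_minus assms)+

section \<open>Vector-valued modular forms\<close>

lemma rho_modular_forms_iff:
  "f \<in> rho_modular_forms \<Gamma> n k \<longleftrightarrow> (\<forall>\<tau>. f \<tau> \<in> Sym n) \<and> (\<forall>m. (\<lambda>\<tau>. lookup (f \<tau>) m) \<in> tempered) \<and>
     (\<forall>\<gamma>\<in>\<Gamma>. \<forall>\<tau>. f (moebius_uhp \<gamma> \<tau>) = scale_sym (automorphy_factor \<gamma> \<tau> powi k) (rho \<gamma> (f \<tau>)))"
proof (cases "\<forall>\<tau>. f \<tau> \<in> Sym n")
  case True
  have "finite {(a, b). a + b = n}"
    by (rule finite_subset[of _ "{..n} \<times> {..n}"]) auto
  from tempered_iff_growth[OF this, of lookup f] show ?thesis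
    using True unfolding rho_modular_forms_def modular_forms_def by (auto simp: Sym_iff)
qed (auto simp: rho_modular_forms_def modular_forms_def)

text \<open>The value of \<Phi> on the a-th monomial tensored with f.\<close>

definition phi_form :: "nat \<Rightarrow> nat \<Rightarrow> (uhp \<Rightarrow> complex) \<Rightarrow> uhp \<Rightarrow> sym" where
  "phi_form n a f = (\<lambda>\<tau>. scale_sym (f \<tau>) (Phi_point \<tau> (sym_basis n a)))"

text \<open>The a-th coordinate of \<open>Sym\<^sup>n U(\<tau>)\<^sup>-\<^sup>1 F(\<tau>)\<close>;
  together these invert \<open>phi_form\<close>.\<close>

definition phi_coord :: "nat \<Rightarrow> nat \<Rightarrow> (uhp \<Rightarrow> sym) \<Rightarrow> uhp \<Rightarrow> complex" where
  "phi_coord n a F = (\<lambda>\<tau>. lookup (Phi_point_inv \<tau> (F \<tau>)) (a, n - a))"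

lemma phi_form_modular:
  assumes \<Gamma>: "\<Gamma> \<subseteq> carrier SL2Z" and f: "f \<in> scalar_modular_forms \<Gamma> l" and a: "a \<le> n"
  shows "phi_form n a f \<in> rho_modular_forms \<Gamma> n (2 * int a - int n + l)"
  unfolding rho_modular_forms_iff
proof (intro conjI allI ballI)
  fix \<tau> show "phi_form n a f \<tau> \<in> Sym n"
    using a by (simp add: phi_form_def Phi_point_Sym)
next
  fix m show "(\<lambda>\<tau>. lookup (phi_form n a f \<tau>) m) \<in> tempered"
    using f by (simp add: phi_form_def scalar_modular_forms_iff)
      (intro tempered_mult tempered_Phi_point tempered_const; simp)
next
  fix \<gamma> \<tau> assume "\<gamma> \<in> \<Gamma>"
  then have g: "\<gamma> \<in> carrier SL2Z" using \<Gamma> by blast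
  have "f (moebius_uhp \<gamma> \<tau>) = automorphy_factor \<gamma> \<tau> powi l * f \<tau>"
    using f \<open>\<gamma> \<in> \<Gamma>\<close> by (simp add: scalar_modular_forms_iff)
  then show "phi_form n a f (moebius_uhp \<gamma> \<tau>) =
    scale_sym (automorphy_factor \<gamma> \<tau> powi (2 * int a - int n + l)) (rho \<gamma> (phi_form n a f \<tau>))"
    unfolding phi_form_def Phi_point_moebius[OF g]
    using a automorphy_factor_nonzero[OF g, of \<tau>]
    by (simp add: sym_rep_diag_basis Phi_point_scale rho_scale power_int_add mult_ac)
qed

lemma phi_coord_modular:
  assumes \<Gamma>: "\<Gamma> \<subseteq> carrier SL2Z" and F: "F \<in> rho_modular_forms \<Gamma> n d" and a: "a \<le> n"
  shows "phi_coord n a F \<in> scalar_modular_forms \<Gamma> (d - (2 * int a - int n))"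
  unfolding scalar_modular_forms_iff
proof (intro conjI allI ballI)
  show "phi_coord n a F \<in> tempered"
    unfolding phi_coord_def using F[unfolded rho_modular_forms_iff] by (intro tempered_Phi_point) blast
next
  fix \<gamma> \<tau> assume "\<gamma> \<in> \<Gamma>"
  then have g: "\<gamma> \<in> carrier SL2Z" using \<Gamma> by blast
  define j where "j = automorphy_factor \<gamma> \<tau>"
  have j0: "j \<noteq> 0" using automorphy_factor_nonzero[OF g] by (simp add: j_def)
  define v where "v = Phi_point_inv \<tau> (F \<tau>)"
  \<comment> \<open>Chosen so that the diagonal matrix in \<open>Phi_point_moebius\<close> sends it
    to \<open>v\<close>; then u is the image of the transformed value under the inverse of U at
    \<gamma>\<tau>.\<close>
  define u where "u = sym_rep (mat2 (1 / j) 0 0 j) v"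
  have "sym_rep (mat2 j 0 0 (1 / j)) u = v"
  proof -
    have "mat2 j 0 0 (1 / j) ** mat2 (1 / j) 0 0 j = mat 1"
      by (intro mat2_eqI) (simp_all add: SL2Z_mult_nth mat_def j0)
    then show ?thesis by (simp add: u_def sym_rep_comp sym_rep_1)
  qed
  then have "Phi_point (moebius_uhp \<gamma> \<tau>) u = rho \<gamma> (F \<tau>)"
    by (simp add: Phi_point_moebius[OF g] Phi_point_inverse v_def flip: j_def)
  then have "Phi_point_inv (moebius_uhp \<gamma> \<tau>) (rho \<gamma> (F \<tau>)) = u"
    by (metis Phi_point_inverse(2))
  moreover have "F (moebius_uhp \<gamma> \<tau>) = scale_sym (j powi d) (rho \<gamma> (F \<tau>))"
    using F \<open>\<gamma> \<in> \<Gamma>\<close> by (simp add: rho_modular_forms_iff j_def)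
  ultimately have "phi_coord n a F (moebius_uhp \<gamma> \<tau>) = j powi d * lookup u (a, n - a)"
    by (simp add: phi_coord_def Phi_point_inv_scale)
  also have "lookup u (a, n - a) = (1 / j) ^ a * j ^ (n - a) * phi_coord n a F \<tau>"
    by (simp add: u_def v_def sym_rep_diag phi_coord_def)
  also have "j powi d * ((1 / j) ^ a * j ^ (n - a) * phi_coord n a F \<tau>) =
     (j powi d * j powi (- int a) * j powi int (n - a)) * phi_coord n a F \<tau>"
    by (simp add: power_int_minus power_one_over field_simps)
  also have "j powi d * j powi (- int a) * j powi int (n - a) = j powi (d + - int a + int (n - a))"
    by (simp only: power_int_add[OF disjI1[OF j0]])
  also have "d + - int a + int (n - a) = d - (2 * int a - int n)"
    using a by simp
  finally show "phi_coord n a F (moebius_uhp \<gamma> \<tau>) =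
    automorphy_factor \<gamma> \<tau> powi (d - (2 * int a - int n)) * phi_coord n a F \<tau>"
    by (simp only: j_def)
qed

lemma phi_form_coord:
  assumes "F \<tau> \<in> Sym n"
  shows "(\<Sum>a\<le>n. phi_form n a (phi_coord n a F) \<tau>) = F \<tau>"
proof -
  have "Phi_point \<tau> (Phi_point_inv \<tau> (F \<tau>)) =
      Phi_point \<tau> (\<Sum>a\<le>n. scale_sym (phi_coord n a F \<tau>) (sym_basis n a))"
    using Sym_expand[OF Phi_point_inv_Sym[OF assms]] by (simp add: phi_coord_def)
  then show ?thesis
    by (simp add: Phi_point_inverse Phi_point_sum Phi_point_scale phi_form_def)
qed

lemma phi_coord_form:
  assumes "b \<le> n"
  shows "phi_coord n b (\<lambda>\<tau>. \<Sum>a\<le>n. phi_form n a (f a) \<tau>) = f b"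
proof
  fix \<tau>
  have "(\<Sum>a\<le>n. phi_form n a (f a) \<tau>) = Phi_point \<tau> (\<Sum>a\<le>n. scale_sym (f a \<tau>) (sym_basis n a))"
    by (simp add: phi_form_def Phi_point_sum Phi_point_scale)
  then show "phi_coord n b (\<lambda>\<tau>. \<Sum>a\<le>n. phi_form n a (f a) \<tau>) \<tau> = f b \<tau>"
    by (simp add: phi_coord_def Phi_point_inverse lookup_sum_sym_basis assms)
qed

section \<open>Weight spaces\<close>

text \<open>H is diagonal on monomials with the distinct eigenvalues 2 a - n. So a weight space is
  spanned by at most one monomial, and it is zero when k is not of this form.\<close>

lemma weight_space_iff:
  "v \<in> weight_space n k \<longleftrightarrow> v \<in> Sym n \<and> (\<forall>a\<le>n. lookup v (a, n - a) \<noteq> 0 \<longrightarrow> k = 2 * int a - int n)"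
proof -
  have "H_op v = scale_sym (of_int k) v \<longleftrightarrow> (\<forall>a\<le>n. lookup v (a, n - a) \<noteq> 0 \<longrightarrow> k = 2 * int a - int n)"
    if v: "v \<in> Sym n"
  proof -
    have S: "H_op v \<in> Sym n" using v by (simp add: Sym_iff lookup_H_op)
    have "H_op v = scale_sym (of_int k) v \<longleftrightarrow>
      (\<forall>a\<le>n. lookup (H_op v) (a, n - a) = lookup (scale_sym (of_int k) v) (a, n - a))"
      using Sym_eqI[OF S, of "scale_sym (of_int k) v"] v by auto
    also have "\<dots> \<longleftrightarrow> (\<forall>a\<le>n. lookup v (a, n - a) \<noteq> 0 \<longrightarrow> k = 2 * int a - int n)"
    proof (intro all_cong)
      fix a assume a: "a \<le> n"
      have "of_nat a - of_nat (n - a) = (of_int (2 * int a - int n) :: complex)"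
        using a by (simp add: of_nat_diff)
      then show "lookup (H_op v) (a, n - a) = lookup (scale_sym (of_int k) v) (a, n - a) \<longleftrightarrow>
        (lookup v (a, n - a) \<noteq> 0 \<longrightarrow> k = 2 * int a - int n)"
        by (auto simp: lookup_H_op simp del: of_int_diff of_int_mult of_int_add)
    qed
    finally show ?thesis .
  qed
  then show ?thesis by (auto simp: weight_space_def)
qed

text \<open>The index set has at most one element; the sum serves to give 0 when k is not a
  weight.\<close>

definition weight_part :: "nat \<Rightarrow> sym \<Rightarrow> int \<Rightarrow> sym" where
  "weight_part n v k = (\<Sum>a\<in>{a. a \<le> n \<and> 2 * int a - int n = k}. scale_sym (lookup v (a, n - a)) (sym_basis n a))"

lemma weight_part_weight: "a \<le> n \<Longrightarrow> weight_part n v (2 * int a - int n) = scale_sym (lookup v (a, n - a)) (sym_basis n a)"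
proof -
  assume "a \<le> n"
  then have "{b. b \<le> n \<and> 2 * int b - int n = 2 * int a - int n} = {a}" by auto
  then show ?thesis by (simp add: weight_part_def)
qed

lemma sum_weights: "(\<Sum>k\<in>weights n. g k) = (\<Sum>a\<le>n. g (2 * int a - int n))"
  unfolding weights_def by (subst sum.reindex) (auto simp: inj_on_def)

lemma lookup_weight_part:
  assumes "b \<le> n"
  shows "lookup (weight_part n v k) (b, n - b) = (if 2 * int b - int n = k then lookup v (b, n - b) else 0)"
proof -
  have "lookup (weight_part n v k) (b, n - b) =
    (\<Sum>a\<in>{a. a \<le> n \<and> 2 * int a - int n = k}. if a = b then lookup v (a, n - a) else 0)"
    unfolding weight_part_def lookup_sum by (rule sum.cong) (use assms in \<open>auto simp: lookup_sym_basis\<close>)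
  then show ?thesis using assms by simp
qed

text \<open>Uniqueness has to cover all integers k, not only the summands that occur: off the
  weights the family is forced to be 0, because the weight space is.\<close>

lemma weight_components_eq:
  assumes v: "v \<in> Sym n"
  shows "weight_components n v = weight_part n v"
  unfolding weight_components_def
proof (rule the_equality)
  have "weight_part n v k \<in> weight_space n k" for k
    unfolding weight_space_iff using lookup_weight_part[of _ n v k]
    by (auto simp: weight_part_def intro!: Sym_sum split: if_splits)
  moreover have "v = (\<Sum>k\<in>weights n. weight_part n v k)"
    unfolding sum_weights by (subst Sym_expand[OF v]) (simp add: weight_part_weight)
  ultimately show "(\<forall>k. weight_part n v k \<in> weight_space n k) \<and> v = (\<Sum>k\<in>weights n. weight_part n v k)"
    by blast
next
  fix c assume c: "(\<forall>k. c k \<in> weight_space n k) \<and> v = (\<Sum>k\<in>weights n. c k)"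
  show "c = weight_part n v"
  proof
    fix k
    have ck: "c k \<in> Sym n" using c by (simp add: weight_space_iff)
    show "c k = weight_part n v k"
    proof (rule Sym_eqI[OF ck])
      show "weight_part n v k \<in> Sym n" by (auto simp: weight_part_def intro!: Sym_sum)
      fix b assume b: "b \<le> n"
      have c0: "lookup (c k') (b, n - b) = 0" if "k' \<noteq> 2 * int b - int n" for k'
        using c b that by (auto simp: weight_space_iff)
      have "lookup v (b, n - b) = (\<Sum>a\<le>n. lookup (c (2 * int a - int n)) (b, n - b))"
        using c by (simp add: sum_weights lookup_sum)
      also have "\<dots> = (\<Sum>a\<in>{b}. lookup (c (2 * int a - int n)) (b, n - b))"
        by (rule sum.mono_neutral_right) (use b c0 in auto)
      finally show "lookup (c k) (b, n - b) = lookup (weight_part n v k) (b, n - b)"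
        using c0[of k] b by (auto simp: lookup_weight_part)
    qed
  qed
qed

lemma Phi_pure_eq:
  assumes "v \<in> Sym n"
  shows "Phi_pure n v f = (\<Sum>a\<le>n. \<Sum>l\<in>keys f. single (2 * int a - int n + l)
     (\<lambda>\<tau>. scale_sym (lookup v (a, n - a)) (phi_form n a (lookup f l) \<tau>)))"
  unfolding Phi_pure_def sum_weights
  by (intro sum.cong refl)
     (simp add: weight_components_eq[OF assms] weight_part_weight Phi_point_scale phi_form_def mult.commute[of "lookup f _ _"])

section \<open>Graded modules of modular forms\<close>

text \<open>Subgroups of a type class group, the link between function spaces and the algebraic
  records.\<close>

definition additive_set :: "'a::ab_group_add set \<Rightarrow> bool" where
  "additive_set S \<longleftrightarrow> 0 \<in> S \<and> (\<forall>x\<in>S. \<forall>y\<in>S. x + y \<in> S) \<and> (\<forall>x\<in>S. - x \<in> S)"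

lemma additive_set_sum:
  "additive_set S \<Longrightarrow> (\<And>i. i \<in> I \<Longrightarrow> f i \<in> S) \<Longrightarrow> sum f I \<in> S"
  by (induction I rule: infinite_finite_induct) (auto simp: additive_set_def)

lemma direct_sum_additive:
  assumes "\<And>k. additive_set (Mg k)"
  shows "additive_set (direct_sum Mg)"
  using assms by (auto simp: additive_set_def direct_sum_def lookup_add)

lemma direct_sum_single:
  assumes "\<And>k. additive_set (Mg k)" "m \<in> Mg k"
  shows "single k m \<in> direct_sum Mg"
  using assms by (auto simp: direct_sum_def lookup_single when_def additive_set_def)

lemma homogeneous_part_subset:
  assumes "\<And>k. additive_set (Mg k)"
  shows "homogeneous_part Mg k \<subseteq> direct_sum Mg"
  using direct_sum_single[of Mg, OF assms] by (auto simp: homogeneous_part_def)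

text \<open>Shared by the ring of scalar forms and the module of vector-valued forms: both records
  use the addition of \<open>\<Rightarrow>\<^sub>0\<close>, so \<open>finsum\<close> and inverses
  can be replaced by those of the type.\<close>

locale direct_sum_group =
  fixes Mg :: "int \<Rightarrow> 'a::ab_group_add set" and M :: "(int \<Rightarrow>\<^sub>0 'a, 'c) ring_scheme" (structure)
  assumes Mg: "\<And>k. additive_set (Mg k)"
    and carrier: "carrier M = direct_sum Mg"
    and add: "add M = (+)"
    and zero: "zero M = 0"
begin

lemma abelian_group: "abelian_group M"
proof (rule abelian_groupI)
  have D: "additive_set (direct_sum Mg)" by (rule direct_sum_additive[OF Mg])
  show "\<exists>y\<in>carrier M. y \<oplus> x = \<zero>" if "x \<in> carrier M" for x
    using D that by (intro bexI[of _ "- x"]) (auto simp: carrier add zero additive_set_def)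
qed (use direct_sum_additive[OF Mg] in \<open>auto simp: carrier add zero additive_set_def add_ac\<close>)

lemma finsum_eq:
  assumes "finite A" "\<And>i. i \<in> A \<Longrightarrow> c i \<in> carrier M"
  shows "finsum M c A = sum c A"
proof -
  interpret abelian_group M by (rule abelian_group)
  show ?thesis using assms
    by (induction A rule: finite_induct) (simp_all add: add zero Pi_def)
qed

lemma a_inv_eq: "x \<in> carrier M \<Longrightarrow> \<ominus> x = - x"
proof -
  interpret abelian_group M by (rule abelian_group)
  assume x: "x \<in> carrier M"
  have "- x \<in> carrier M" using direct_sum_additive[OF Mg] x by (auto simp: carrier additive_set_def)
  then show "\<ominus> x = - x" using x by (intro minus_equality) (auto simp: add zero)
qed

lemma grading: "grading M (homogeneous_part Mg)"
  unfolding grading_def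
proof (intro conjI allI ballI)
  interpret abelian_group M by (rule abelian_group)
  fix k
  show "additive_subgroup (homogeneous_part Mg k) M"
  proof (rule additive_subgroup.intro, rule subgroup.intro)
    have sub: "homogeneous_part Mg k \<subseteq> carrier M"
      using homogeneous_part_subset[of Mg, OF Mg] by (simp add: carrier)
    then show "homogeneous_part Mg k \<subseteq> carrier (add_monoid M)" by simp
    show "x \<otimes>\<^bsub>add_monoid M\<^esub> y \<in> homogeneous_part Mg k"
      if "x \<in> homogeneous_part Mg k" "y \<in> homogeneous_part Mg k" for x y
      using that Mg[of k] by (auto simp: add homogeneous_part_def additive_set_def simp flip: single_add)
    show "\<one>\<^bsub>add_monoid M\<^esub> \<in> homogeneous_part Mg k"
      using Mg[of k] by (auto simp: zero homogeneous_part_def additive_set_def intro!: image_eqI[of _ _ 0])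
    show "inv\<^bsub>add_monoid M\<^esub> x \<in> homogeneous_part Mg k" if "x \<in> homogeneous_part Mg k" for x
      using that sub a_inv_eq[of x] Mg[of k]
      by (auto simp: a_inv_def homogeneous_part_def additive_set_def simp flip: single_uminus)
  qed
next
  interpret abelian_group M by (rule abelian_group)
  fix x assume "x \<in> carrier M"
  then have x: "lookup x k \<in> Mg k" for k by (auto simp: carrier direct_sum_def)
  define c where "c = (\<lambda>k. single k (lookup x k))"
  have c_in: "c k \<in> homogeneous_part Mg k" for k using x by (simp add: c_def homogeneous_part_def)
  have sub: "homogeneous_part Mg k \<subseteq> carrier M" for k
    using homogeneous_part_subset[of Mg, OF Mg] by (simp add: carrier)
  have ck: "{k. c k \<noteq> \<zero>} = keys x"
    by (auto simp: zero c_def in_keys_iff) (metis lookup_single_eq lookup_zero)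
  show "\<exists>!c. (\<forall>k. c k \<in> homogeneous_part Mg k) \<and> finite {k. c k \<noteq> \<zero>} \<and> x = finsum M c {k. c k \<noteq> \<zero>}"
  proof (rule ex1I[of _ c], intro conjI allI)
    show "finite {k. c k \<noteq> \<zero>}" by (simp add: ck)
    show "x = finsum M c {k. c k \<noteq> \<zero>}"
      unfolding ck using c_in sub by (subst finsum_eq) (auto simp: c_def sum_single_lookup)
  next
    fix c' assume c': "(\<forall>k. c' k \<in> homogeneous_part Mg k) \<and> finite {k. c' k \<noteq> \<zero>} \<and> x = finsum M c' {k. c' k \<noteq> \<zero>}"
    define A where "A = {k. c' k \<noteq> \<zero>}"
    have A: "finite A" using c' by (simp add: A_def)
    have "\<forall>k. \<exists>m. c' k = single k m" using c' by (auto simp: homogeneous_part_def)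
    then obtain m where m: "\<And>k. c' k = single k (m k)" by metis
    have "x = finsum M c' A" using c' by (simp add: A_def)
    also have "\<dots> = sum c' A" by (rule finsum_eq[OF A]) (use c' sub in auto)
    finally have xs: "x = (\<Sum>k\<in>A. single k (m k))" by (simp add: m)
    \<comment> \<open>Outside \<open>A\<close> the component \<open>c' k\<close> is zero and so is
      \<open>m k\<close>, which gives uniqueness off the support as well.\<close>
    have mk: "m k = lookup x k" for k
    proof -
      have "lookup x k = (\<Sum>i\<in>A. if i = k then m i else 0)"
        unfolding xs lookup_sum by (intro sum.cong) (auto simp: lookup_single when_def)
      also have "\<dots> = (if k \<in> A then m k else 0)" using A by simp
      also have "\<dots> = m k" using m[of k] by (auto simp: A_def zero) (metis lookup_single_eq lookup_zero)
      finally show ?thesis by simp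
    qed
    show "c' = c" by (rule ext) (simp add: m mk c_def)
  qed (rule c_in)
qed

end

section \<open>Closure properties of scalar and vector-valued forms\<close>

lemma scalar_additive: "additive_set (scalar_modular_forms \<Gamma> k)"
  by (auto simp: additive_set_def scalar_modular_forms_iff zero_fun_def plus_fun_def fun_Compl_def
      intro: tempered_const tempered_add tempered_minus simp: algebra_simps)

lemma scalar_mult:
  assumes "\<Gamma> \<subseteq> carrier SL2Z" "f \<in> scalar_modular_forms \<Gamma> i" "g \<in> scalar_modular_forms \<Gamma> j"
  shows "f * g \<in> scalar_modular_forms \<Gamma> (i + j)"
  unfolding scalar_modular_forms_iff
proof (intro conjI ballI allI)
  show "f * g \<in> tempered"
    using assms(2,3) tempered_mult[of f g] by (simp add: scalar_modular_forms_iff times_fun_def)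
  fix \<gamma> \<tau> assume "\<gamma> \<in> \<Gamma>"
  then show "(f * g) (moebius_uhp \<gamma> \<tau>) = automorphy_factor \<gamma> \<tau> powi (i + j) * (f * g) \<tau>"
    using assms automorphy_factor_nonzero[of \<gamma> \<tau>]
    by (auto simp: scalar_modular_forms_iff power_int_add)
qed

lemma scalar_one: "1 \<in> scalar_modular_forms \<Gamma> 0"
  by (simp add: scalar_modular_forms_iff one_fun_def tempered_const)

lemma scalar_scale:
  assumes "f \<in> scalar_modular_forms \<Gamma> k"
  shows "scale_fun c f \<in> scalar_modular_forms \<Gamma> k"
  using assms tempered_mult[OF tempered_const[of c], of f] by (auto simp: scalar_modular_forms_iff scale_fun_def)

lemma rho_add: "rho g (v + w) = rho g v + rho g w"
  by (simp add: rho_def sym_rep_add)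

lemma rho_forms_scale:
  assumes "\<Gamma> \<subseteq> carrier SL2Z" "f \<in> scalar_modular_forms \<Gamma> i" "F \<in> rho_modular_forms \<Gamma> n j"
  shows "(\<lambda>\<tau>. scale_sym (f \<tau>) (F \<tau>)) \<in> rho_modular_forms \<Gamma> n (i + j)"
  unfolding rho_modular_forms_iff
proof (intro conjI ballI allI)
  fix m show "(\<lambda>\<tau>. lookup (scale_sym (f \<tau>) (F \<tau>)) m) \<in> tempered"
    using assms(2,3) tempered_mult[of f "\<lambda>\<tau>. lookup (F \<tau>) m"]
    by (cases m) (simp add: scalar_modular_forms_iff rho_modular_forms_iff)
  fix \<gamma> \<tau> assume "\<gamma> \<in> \<Gamma>"
  then show "scale_sym (f (moebius_uhp \<gamma> \<tau>)) (F (moebius_uhp \<gamma> \<tau>)) =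
      scale_sym (automorphy_factor \<gamma> \<tau> powi (i + j)) (rho \<gamma> (scale_sym (f \<tau>) (F \<tau>)))"
    using assms automorphy_factor_nonzero[of \<gamma> \<tau>]
    by (auto simp: scalar_modular_forms_iff rho_modular_forms_iff power_int_add rho_scale mult_ac)
qed (use assms(3) in \<open>simp add: rho_modular_forms_iff\<close>)

lemma scale_sym_fun_forms:
  assumes "F \<in> rho_modular_forms \<Gamma> n k"
  shows "scale_sym_fun c F \<in> rho_modular_forms \<Gamma> n k"
  using assms tempered_mult[OF tempered_const[of c]]
  by (auto simp: scale_sym_fun_def rho_modular_forms_iff rho_scale mult_ac)

lemma rho_forms_additive: "additive_set (rho_modular_forms \<Gamma> n k)"
proof -
  have "rho \<gamma> 0 = 0" for \<gamma> by (simp add: rho_def)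
  then have 0: "0 \<in> rho_modular_forms \<Gamma> n k"
    by (auto simp: rho_modular_forms_iff zero_fun_def tempered_const)
  have "scale_sym_fun (-1) F = - F" for F
    by (rule ext, rule poly_mapping_eqI) (simp add: scale_sym_fun_def)
  then have "- F \<in> rho_modular_forms \<Gamma> n k" if "F \<in> rho_modular_forms \<Gamma> n k" for F
    using scale_sym_fun_forms[OF that, of "-1"] by simp
  moreover have "F + G \<in> rho_modular_forms \<Gamma> n k"
    if "F \<in> rho_modular_forms \<Gamma> n k" "G \<in> rho_modular_forms \<Gamma> n k" for F G
    using that by (auto simp: rho_modular_forms_iff lookup_add rho_add scale_sym_add intro: tempered_add)
  ultimately show ?thesis using 0 by (auto simp: additive_set_def)
qed

lemma mult_eq_sum:
  "f * g = (\<Sum>i\<in>keys f. \<Sum>j\<in>keys g. single (i + j) (lookup f i * lookup g j))"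
  for f g :: "int \<Rightarrow>\<^sub>0 'a::comm_ring_1"
proof -
  have "f * g = (\<Sum>i\<in>keys f. single i (lookup f i)) * (\<Sum>j\<in>keys g. single j (lookup g j))"
    by (simp add: sum_single_lookup)
  then show ?thesis by (simp add: sum_product mult_single)
qed

lemma scalar_direct_sum_mult:
  assumes "\<Gamma> \<subseteq> carrier SL2Z"
    "f \<in> direct_sum (scalar_modular_forms \<Gamma>)" "g \<in> direct_sum (scalar_modular_forms \<Gamma>)"
  shows "f * g \<in> direct_sum (scalar_modular_forms \<Gamma>)"
  unfolding mult_eq_sum
  by (intro additive_set_sum direct_sum_additive direct_sum_single scalar_additive scalar_mult assms)
     (use assms(2,3) in \<open>auto simp: direct_sum_def\<close>)

lemma single_zero_fun: "single k (\<lambda>\<tau>. 0) = 0"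
  by (rule poly_mapping_eqI) (auto simp: lookup_single when_def zero_fun_def)

lemma modular_act_single: "modular_act (single i f) (single j F) = single (i + j) (\<lambda>\<tau>. scale_sym (f \<tau>) (F \<tau>))"
  by (cases "f = 0"; cases "F = 0") (auto simp: modular_act_def single_zero_fun)

lemma modular_act_add_left: "modular_act (f + g) F = modular_act f F + modular_act g F"
  unfolding modular_act_def
proof (rule setsum_keys_plus_distrib)
  show "(\<Sum>j\<in>keys F. single (k + j) (\<lambda>\<tau>. scale_sym ((0::uhp \<Rightarrow> complex) \<tau>) (lookup F j \<tau>))) = 0" for k
    by (simp add: single_zero_fun)
  show "(\<Sum>j\<in>keys F. single (k + j) (\<lambda>\<tau>. scale_sym ((lookup f k + lookup g k) \<tau>) (lookup F j \<tau>))) =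
    (\<Sum>j\<in>keys F. single (k + j) (\<lambda>\<tau>. scale_sym (lookup f k \<tau>) (lookup F j \<tau>))) +
    (\<Sum>j\<in>keys F. single (k + j) (\<lambda>\<tau>. scale_sym (lookup g k \<tau>) (lookup F j \<tau>)))" for k
    by (simp add: sum.distrib[symmetric] single_add[symmetric] plus_fun_def scale_sym_add_left)
qed

lemma modular_act_add_right: "modular_act f (F + G) = modular_act f F + modular_act f G"
proof -
  have "(\<Sum>j\<in>keys (F + G). single (i + j) (\<lambda>\<tau>. scale_sym (lookup f i \<tau>) (lookup (F + G) j \<tau>))) =
    (\<Sum>j\<in>keys F. single (i + j) (\<lambda>\<tau>. scale_sym (lookup f i \<tau>) (lookup F j \<tau>))) +
    (\<Sum>j\<in>keys G. single (i + j) (\<lambda>\<tau>. scale_sym (lookup f i \<tau>) (lookup G j \<tau>)))" for i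
    by (rule setsum_keys_plus_distrib[where f = "\<lambda>j x. single (i + j) (\<lambda>\<tau>. scale_sym (lookup f i \<tau>) (x \<tau>))"])
       (simp_all add: single_zero_fun single_add[symmetric] plus_fun_def scale_sym_add)
  then show ?thesis unfolding modular_act_def by (simp add: sum.distrib)
qed

lemma modular_act_0 [simp]: "modular_act 0 F = 0" "modular_act f 0 = 0"
  by (simp_all add: modular_act_def)

lemma modular_act_assoc: "modular_act (f * g) F = modular_act f (modular_act g F)"
proof (induction f rule: poly_mapping_sum_induct)
  case (single i a)
  show ?case
  proof (induction g rule: poly_mapping_sum_induct)
    case (single j b)
    show ?case
      by (induction F rule: poly_mapping_sum_induct)
         (simp_all add: mult_single modular_act_single modular_act_add_right add.assoc)
  qed (simp_all add: distrib_left modular_act_add_left modular_act_add_right)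
qed (simp_all add: distrib_right modular_act_add_left)

lemma modular_act_one: "modular_act 1 F = F"
proof (induction F rule: poly_mapping_sum_induct)
  case (single k c)
  show ?case using modular_act_single[of 0 1 k c] by simp
qed (simp_all add: modular_act_add_right)

lemma modular_act_closed:
  assumes "\<Gamma> \<subseteq> carrier SL2Z"
    "f \<in> direct_sum (scalar_modular_forms \<Gamma>)" "F \<in> direct_sum (rho_modular_forms \<Gamma> n)"
  shows "modular_act f F \<in> direct_sum (rho_modular_forms \<Gamma> n)"
  unfolding modular_act_def
  by (intro additive_set_sum direct_sum_additive direct_sum_single rho_forms_additive rho_forms_scale assms)
     (use assms(2,3) in \<open>auto simp: direct_sum_def\<close>)

section \<open>The graded ring and the graded module of forms\<close>

lemma modular_ring_cring:
  assumes "\<Gamma> \<subseteq> carrier SL2Z"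
  shows "cring (modular_ring \<Gamma>)"
proof -
  interpret direct_sum_group "scalar_modular_forms \<Gamma>" "modular_ring \<Gamma>"
    by unfold_locales (auto simp: modular_ring_def scalar_additive)
  have one: "1 \<in> direct_sum (scalar_modular_forms \<Gamma>)"
    using direct_sum_single[of "scalar_modular_forms \<Gamma>", OF scalar_additive scalar_one] by simp
  show ?thesis
  proof (rule cringI)
    show "abelian_group (modular_ring \<Gamma>)" by (rule abelian_group)
    show "comm_monoid (modular_ring \<Gamma>)"
      by (rule comm_monoidI)
        (use one scalar_direct_sum_mult[OF assms] in \<open>auto simp: modular_ring_def mult_ac\<close>)
  qed (auto simp: modular_ring_def distrib_right)
qed

lemma modular_ring_graded:
  assumes "\<Gamma> \<subseteq> carrier SL2Z"
  shows "graded_ring (modular_ring \<Gamma>) (homogeneous_part (scalar_modular_forms \<Gamma>))"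
proof -
  interpret direct_sum_group "scalar_modular_forms \<Gamma>" "modular_ring \<Gamma>"
    by unfold_locales (auto simp: modular_ring_def scalar_additive)
  show ?thesis
    unfolding graded_ring_def
  proof (intro conjI allI ballI modular_ring_cring[OF assms] grading)
    show "\<one>\<^bsub>modular_ring \<Gamma>\<^esub> \<in> homogeneous_part (scalar_modular_forms \<Gamma>) 0"
      using scalar_one by (auto simp: modular_ring_def homogeneous_part_def intro!: image_eqI[of _ _ 1])
    fix i j r s
    assume "r \<in> homogeneous_part (scalar_modular_forms \<Gamma>) i" "s \<in> homogeneous_part (scalar_modular_forms \<Gamma>) j"
    then show "r \<otimes>\<^bsub>modular_ring \<Gamma>\<^esub> s \<in> homogeneous_part (scalar_modular_forms \<Gamma>) (i + j)"
      using scalar_mult[OF assms] by (auto simp: modular_ring_def homogeneous_part_def mult_single)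
  qed
qed

lemma rho_module_graded:
  assumes "\<Gamma> \<subseteq> carrier SL2Z"
  shows "graded_module (modular_ring \<Gamma>) (homogeneous_part (scalar_modular_forms \<Gamma>))
    (rho_module \<Gamma> n) (homogeneous_part (rho_modular_forms \<Gamma> n))"
proof -
  interpret direct_sum_group "rho_modular_forms \<Gamma> n" "rho_module \<Gamma> n"
    by unfold_locales (auto simp: rho_module_def rho_forms_additive)
  show ?thesis
    unfolding graded_module_def
  proof (intro conjI allI ballI modular_ring_graded[OF assms] grading)
    show "Module.module (modular_ring \<Gamma>) (rho_module \<Gamma> n)"
      by (rule moduleI[OF modular_ring_cring[OF assms] abelian_group])
        (use modular_act_closed[OF assms] in \<open>auto simp: modular_ring_def rho_module_def
          modular_act_add_left modular_act_add_right modular_act_assoc modular_act_one\<close>)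
    fix i j r x
    assume "r \<in> homogeneous_part (scalar_modular_forms \<Gamma>) i" "x \<in> homogeneous_part (rho_modular_forms \<Gamma> n) j"
    then show "r \<odot>\<^bsub>rho_module \<Gamma> n\<^esub> x \<in> homogeneous_part (rho_modular_forms \<Gamma> n) (i + j)"
      using rho_forms_scale[OF assms] by (auto simp: rho_module_def homogeneous_part_def modular_act_single)
  qed
qed

text \<open>Transport of structure. About \<open>M\<close> only closure of its operations and
  compatibility with \<phi> are assumed; each axiom holds because its image under the injective
  \<phi> holds in \<open>N\<close>.\<close>

lemma graded_module_transport:
  assumes N: "graded_module R Rg N Ng"
    and bij: "bij_betw \<phi> (carrier M) (carrier N)"
    and zero: "zero M \<in> carrier M" "\<phi> (zero M) = zero N"
    and add_closed: "\<And>x y. x \<in> carrier M \<Longrightarrow> y \<in> carrier M \<Longrightarrow> x \<oplus>\<^bsub>M\<^esub> y \<in> carrier M"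
    and add: "\<And>x y. x \<in> carrier M \<Longrightarrow> y \<in> carrier M \<Longrightarrow> \<phi> (x \<oplus>\<^bsub>M\<^esub> y) = \<phi> x \<oplus>\<^bsub>N\<^esub> \<phi> y"
    and smult_closed: "\<And>r x. r \<in> carrier R \<Longrightarrow> x \<in> carrier M \<Longrightarrow> r \<odot>\<^bsub>M\<^esub> x \<in> carrier M"
    and smult: "\<And>r x. r \<in> carrier R \<Longrightarrow> x \<in> carrier M \<Longrightarrow> \<phi> (r \<odot>\<^bsub>M\<^esub> x) = r \<odot>\<^bsub>N\<^esub> \<phi> x"
    and Mg: "\<And>k. Mg k \<subseteq> carrier M" "\<And>k. \<phi> ` Mg k = Ng k"
  shows "graded_module_iso R Rg M Mg N Ng \<phi>"
proof -
  have modN: "Module.module R N" and grR: "graded_ring R Rg" and grN: "grading N Ng"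
    and actN: "\<And>i j r x. r \<in> Rg i \<Longrightarrow> x \<in> Ng j \<Longrightarrow> r \<odot>\<^bsub>N\<^esub> x \<in> Ng (i + j)"
    using N by (auto simp: graded_module_def)
  interpret N: Module.module R N by (rule modN)
  have inj: "x = y" if "x \<in> carrier M" "y \<in> carrier M" "\<phi> x = \<phi> y" for x y
    using bij that by (auto simp: bij_betw_def inj_on_def)
  have im: "\<phi> x \<in> carrier N" if "x \<in> carrier M" for x
    using bij that by (auto simp: bij_betw_def)
  define \<psi> where "\<psi> = inv_into (carrier M) \<phi>"
  have \<psi>: "\<psi> y \<in> carrier M" "\<phi> (\<psi> y) = y" if "y \<in> carrier N" for y
    using that bij by (auto simp: \<psi>_def bij_betw_def inv_into_into f_inv_into_f)
  have agM: "abelian_group M"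
  proof (rule abelian_groupI)
    fix x y z assume x: "x \<in> carrier M" and y: "y \<in> carrier M" and z: "z \<in> carrier M"
    show "x \<oplus>\<^bsub>M\<^esub> y \<oplus>\<^bsub>M\<^esub> z = x \<oplus>\<^bsub>M\<^esub> (y \<oplus>\<^bsub>M\<^esub> z)"
      by (rule inj) (simp_all add: x y z add add_closed im N.a_assoc)
  next
    fix x y assume x: "x \<in> carrier M" and y: "y \<in> carrier M"
    show "x \<oplus>\<^bsub>M\<^esub> y = y \<oplus>\<^bsub>M\<^esub> x"
      by (rule inj) (simp_all add: x y add add_closed im N.a_comm)
  next
    fix x assume x: "x \<in> carrier M"
    show "\<zero>\<^bsub>M\<^esub> \<oplus>\<^bsub>M\<^esub> x = x"
      by (rule inj) (simp_all add: x add add_closed im zero)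
    have "\<psi> (\<ominus>\<^bsub>N\<^esub> \<phi> x) \<oplus>\<^bsub>M\<^esub> x = \<zero>\<^bsub>M\<^esub>"
      by (rule inj) (simp_all add: x add add_closed im zero \<psi> N.l_neg)
    then show "\<exists>y\<in>carrier M. y \<oplus>\<^bsub>M\<^esub> x = \<zero>\<^bsub>M\<^esub>"
      using \<psi>(1)[of "\<ominus>\<^bsub>N\<^esub> \<phi> x"] x im by auto
  qed (use zero add_closed in auto)
  interpret M: abelian_group M by (rule agM)
  have phi_finsum: "\<phi> (finsum M c A) = finsum N (\<lambda>i. \<phi> (c i)) A"
    if "finite A" "\<And>i. i \<in> A \<Longrightarrow> c i \<in> carrier M" for c :: "int \<Rightarrow> _" and A
    using that
  proof (induction A rule: finite_induct)
    case (insert a A)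
    then show ?case by (simp add: Pi_def add im)
  qed (simp add: zero)
  have modM: "Module.module R M"
  proof (rule moduleI)
    show "cring R" by (rule N.is_cring)
    fix a b x y assume ab: "a \<in> carrier R" "b \<in> carrier R" and x: "x \<in> carrier M"
    show "(a \<oplus>\<^bsub>R\<^esub> b) \<odot>\<^bsub>M\<^esub> x = a \<odot>\<^bsub>M\<^esub> x \<oplus>\<^bsub>M\<^esub> b \<odot>\<^bsub>M\<^esub> x"
      by (rule inj) (simp_all add: ab x add add_closed smult smult_closed im N.smult_l_distr)
    show "(a \<otimes>\<^bsub>R\<^esub> b) \<odot>\<^bsub>M\<^esub> x = a \<odot>\<^bsub>M\<^esub> (b \<odot>\<^bsub>M\<^esub> x)"
      by (rule inj) (simp_all add: ab x smult smult_closed im N.smult_assoc1)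
  next
    fix x assume x: "x \<in> carrier M"
    show "\<one>\<^bsub>R\<^esub> \<odot>\<^bsub>M\<^esub> x = x"
      by (rule inj) (simp_all add: x smult smult_closed im)
  next
    fix a x y assume a: "a \<in> carrier R" and x: "x \<in> carrier M" and y: "y \<in> carrier M"
    show "a \<odot>\<^bsub>M\<^esub> (x \<oplus>\<^bsub>M\<^esub> y) = a \<odot>\<^bsub>M\<^esub> x \<oplus>\<^bsub>M\<^esub> a \<odot>\<^bsub>M\<^esub> y"
      by (rule inj) (simp_all add: a x y add add_closed smult smult_closed im N.smult_r_distr)
  qed (use agM smult_closed in auto)
  \<comment> \<open>By injectivity, equality of images of the graded parts makes membership testable
    after applying \<phi>.\<close>
  have mem: "x \<in> Mg k" if "x \<in> carrier M" "\<phi> x \<in> Ng k" for x k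
    using that Mg inj by (metis (no_types, lifting) imageE subsetD)
  have phiMg: "\<phi> x \<in> Ng k" if "x \<in> Mg k" for x k using that Mg(2)[of k] by blast
  have Ng: "Ng k \<subseteq> carrier N" for k using grN by (auto simp: grading_def dest: additive_subgroup.a_subset)
  have "grading M Mg"
    unfolding grading_def
  proof (intro conjI allI ballI)
    fix k
    interpret Nk: additive_subgroup "Ng k" N using grN by (simp add: grading_def)
    show "additive_subgroup (Mg k) M"
    proof (rule additive_subgroup.intro, rule subgroup.intro)
      show "Mg k \<subseteq> carrier (add_monoid M)" using Mg by simp
      show "x \<otimes>\<^bsub>add_monoid M\<^esub> y \<in> Mg k" if "x \<in> Mg k" "y \<in> Mg k" for x y
        using that Mg(1) Nk.a_closed[OF phiMg phiMg] by (auto intro!: mem simp: add_closed add subset_iff)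
      show "\<one>\<^bsub>add_monoid M\<^esub> \<in> Mg k" by (auto intro!: mem simp: zero)
      show "inv\<^bsub>add_monoid M\<^esub> x \<in> Mg k" if x: "x \<in> Mg k" for x
      proof -
        have xM: "x \<in> carrier M" and xN: "\<phi> x \<in> Ng k" using Mg(1) phiMg x by auto
        have "\<phi> (\<ominus>\<^bsub>M\<^esub> x) \<oplus>\<^bsub>N\<^esub> \<phi> x = \<zero>\<^bsub>N\<^esub>"
          using xM by (simp add: zero M.l_neg flip: add)
        then have "\<phi> (\<ominus>\<^bsub>M\<^esub> x) = \<ominus>\<^bsub>N\<^esub> \<phi> x"
          using xM im by (metis M.a_inv_closed N.minus_equality)
        then show ?thesis using xM xN Nk.a_inv_closed
          by (auto intro!: mem simp flip: a_inv_def)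
      qed
    qed
  next
    fix x assume x: "x \<in> carrier M"
    define P where "P = (\<lambda>c. (\<forall>k. c k \<in> Ng k) \<and> finite {k. c k \<noteq> \<zero>\<^bsub>N\<^esub>} \<and> \<phi> x = finsum N c {k. c k \<noteq> \<zero>\<^bsub>N\<^esub>})"
    have "\<exists>!c. P c"
      using grN im[OF x] unfolding grading_def P_def by blast
    then obtain c where "P c" and uniq: "\<And>c'. P c' \<Longrightarrow> c' = c" by blast
    then have c: "\<And>k. c k \<in> Ng k" "finite {k. c k \<noteq> \<zero>\<^bsub>N\<^esub>}" "\<phi> x = finsum N c {k. c k \<noteq> \<zero>\<^bsub>N\<^esub>}"
      unfolding P_def by blast+
    have \<phi>0: "\<phi> y = \<zero>\<^bsub>N\<^esub> \<longleftrightarrow> y = \<zero>\<^bsub>M\<^esub>" if "y \<in> carrier M" for y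
      using inj[of y "\<zero>\<^bsub>M\<^esub>"] that zero by auto
    have cN: "c k \<in> carrier N" for k using c Ng by blast
    show "\<exists>!c. (\<forall>k. c k \<in> Mg k) \<and> finite {k. c k \<noteq> \<zero>\<^bsub>M\<^esub>} \<and> x = finsum M c {k. c k \<noteq> \<zero>\<^bsub>M\<^esub>}"
    proof (rule ex1I[of _ "\<lambda>k. \<psi> (c k)"], intro conjI allI)
      show "\<psi> (c k) \<in> Mg k" for k using c \<psi>[OF cN] by (auto intro!: mem)
      have eq: "{k. \<psi> (c k) \<noteq> \<zero>\<^bsub>M\<^esub>} = {k. c k \<noteq> \<zero>\<^bsub>N\<^esub>}"
        using \<phi>0[OF \<psi>(1)[OF cN]] \<psi>(2)[OF cN] by auto
      then show "finite {k. \<psi> (c k) \<noteq> \<zero>\<^bsub>M\<^esub>}" using c by simp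
      have fc: "finsum M (\<lambda>k. \<psi> (c k)) {k. c k \<noteq> \<zero>\<^bsub>N\<^esub>} \<in> carrier M"
        using \<psi>(1)[OF cN] by (auto intro!: M.finsum_closed)
      show "x = finsum M (\<lambda>k. \<psi> (c k)) {k. \<psi> (c k) \<noteq> \<zero>\<^bsub>M\<^esub>}"
        unfolding eq
        by (rule inj[OF x fc]) (use c \<psi>[OF cN] in \<open>simp add: phi_finsum\<close>)
    next
      fix c' assume c': "(\<forall>k. c' k \<in> Mg k) \<and> finite {k. c' k \<noteq> \<zero>\<^bsub>M\<^esub>} \<and> x = finsum M c' {k. c' k \<noteq> \<zero>\<^bsub>M\<^esub>}"
      then have c'M: "c' k \<in> carrier M" for k using Mg by blast
      have eq: "{k. c' k \<noteq> \<zero>\<^bsub>M\<^esub>} = {k. \<phi> (c' k) \<noteq> \<zero>\<^bsub>N\<^esub>}" using \<phi>0[OF c'M] by auto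
      have "(\<lambda>k. \<phi> (c' k)) = c"
      proof (rule uniq, unfold P_def, intro conjI allI)
        show "\<phi> (c' k) \<in> Ng k" for k using c' Mg by blast
        show "finite {k. \<phi> (c' k) \<noteq> \<zero>\<^bsub>N\<^esub>}" using c' eq by simp
        show "\<phi> x = finsum N (\<lambda>k. \<phi> (c' k)) {k. \<phi> (c' k) \<noteq> \<zero>\<^bsub>N\<^esub>}"
          using c' c'M unfolding eq[symmetric] by (metis phi_finsum)
      qed
      then show "c' = (\<lambda>k. \<psi> (c k))"
        using bij c'M by (auto simp: \<psi>_def bij_betw_def inv_into_f_f)
    qed
  qed
  then have "graded_module R Rg M Mg"
    unfolding graded_module_def
  proof (intro conjI allI ballI grR modM)
    fix i j r x assume r: "r \<in> Rg i" and x: "x \<in> Mg j"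
    have "Rg i \<subseteq> carrier R"
      using grR by (auto simp: graded_ring_def grading_def dest: additive_subgroup.a_subset)
    then show "r \<odot>\<^bsub>M\<^esub> x \<in> Mg (i + j)"
      using r x Mg(1) actN[OF r phiMg[OF x]] by (auto intro!: mem simp: smult smult_closed subset_iff)
  qed
  then show ?thesis
    using N bij add smult Mg by (simp add: graded_module_iso_def)
qed

section \<open>The tensor product\<close>

lemma lookup_scale_coeffs: "scl c 0 = 0 \<Longrightarrow> lookup (scale_coeffs scl c x) k = scl c (lookup x k)"
  by (simp add: scale_coeffs_def Poly_Mapping.map.rep_eq when_def)

lemma scale_coeffs_module: "Modules.module (scale_coeffs (*) :: complex \<Rightarrow> ('k \<Rightarrow>\<^sub>0 complex) \<Rightarrow> _)"
  by unfold_locales (auto intro!: poly_mapping_eqI simp: lookup_scale_coeffs lookup_add algebra_simps)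

interpretation FS: Modules.module "scale_coeffs (*) :: complex \<Rightarrow> ('k \<Rightarrow>\<^sub>0 complex) \<Rightarrow> _"
  by (rule scale_coeffs_module)

lemma scale_coeffs_single: "scale_coeffs (*) c (single p (d::complex)) = single p (c * d)"
  by (rule poly_mapping_eqI) (auto simp: lookup_scale_coeffs lookup_single when_def)

text \<open>Constants as forms of weight 0. Scalar multiplication becomes multiplication in the
  ring, so bilinearity over the complex numbers follows from ring identities.\<close>

definition const_poly :: "complex \<Rightarrow> int \<Rightarrow>\<^sub>0 (uhp \<Rightarrow> complex)" where
  "const_poly c = single 0 (\<lambda>_. c)"

lemma const_poly_simps: "const_poly 0 = 0" "const_poly 1 = 1" "const_poly (a + b) = const_poly a + const_poly b"
  "const_poly (a * b) = const_poly a * const_poly b"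
proof -
  show "const_poly 0 = 0" by (simp add: const_poly_def single_zero_fun)
  have "(\<lambda>_. 1) = (1 :: uhp \<Rightarrow> complex)" by (simp add: one_fun_def)
  then show "const_poly 1 = 1" by (simp add: const_poly_def)
  show "const_poly (a + b) = const_poly a + const_poly b"
    by (simp add: const_poly_def plus_fun_def flip: single_add)
  show "const_poly (a * b) = const_poly a * const_poly b"
    by (simp add: const_poly_def mult_single times_fun_def)
qed

lemma scale_poly_eq: "scale_coeffs scale_fun c f = const_poly c * f"
proof -
  have "scale_fun c = (*) (\<lambda>_. c)" by (auto simp: fun_eq_iff scale_fun_def)
  then show ?thesis by (simp add: scale_coeffs_def const_poly_def mult_map_scale_conv_mult)
qed

lemma const_poly_in: "const_poly c \<in> direct_sum (scalar_modular_forms \<Gamma>)"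
proof -
  have "scale_fun c 1 \<in> scalar_modular_forms \<Gamma> 0" by (intro scalar_scale scalar_one)
  moreover have "scale_fun c 1 = (\<lambda>_. c)" by (simp add: scale_fun_def fun_eq_iff)
  ultimately show ?thesis
    unfolding const_poly_def using direct_sum_single[of "scalar_modular_forms \<Gamma>", OF scalar_additive] by metis
qed

lemma scalar_direct_sum_additive: "additive_set (direct_sum (scalar_modular_forms \<Gamma>))"
  by (intro direct_sum_additive scalar_additive)

text \<open>Since the monomials are a basis of the first factor, the tensor product is a sum of n +
  1 copies of the second; this is the a-th projection, defined on representatives.\<close>

definition tensor_coeff :: "nat \<Rightarrow> nat \<Rightarrow> (sym \<times> (int \<Rightarrow>\<^sub>0 (uhp \<Rightarrow> complex)) \<Rightarrow>\<^sub>0 complex) \<Rightarrow> int \<Rightarrow>\<^sub>0 (uhp \<Rightarrow> complex)"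
  where "tensor_coeff n a x = (\<Sum>p\<in>keys x. const_poly (lookup x p * lookup (fst p) (a, n - a)) * snd p)"

lemma tensor_coeff_add: "tensor_coeff n a (x + y) = tensor_coeff n a x + tensor_coeff n a y"
  unfolding tensor_coeff_def
  by (rule setsum_keys_plus_distrib[where f = "\<lambda>p c. const_poly (c * lookup (fst p) (a, n - a)) * snd p"])
     (simp_all add: const_poly_simps distrib_right)

lemma tensor_coeff_single: "tensor_coeff n a (single p c) = const_poly (c * lookup (fst p) (a, n - a)) * snd p"
  by (cases "c = 0") (simp_all add: tensor_coeff_def const_poly_simps)

lemma tensor_coeff_0 [simp]: "tensor_coeff n a 0 = 0"
  by (simp add: tensor_coeff_def)

lemma tensor_coeff_scale: "tensor_coeff n a (scale_coeffs (*) c x) = const_poly c * tensor_coeff n a x"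
  by (induction x rule: poly_mapping_sum_induct)
     (simp_all add: scale_coeffs_single FS.scale_right_distrib tensor_coeff_add tensor_coeff_single
       const_poly_simps mult.assoc distrib_left)

lemma tensor_coeff_minus: "tensor_coeff n a (- x) = - tensor_coeff n a x"
  using tensor_coeff_add[of n a x "- x"] by (simp add: eq_neg_iff_add_eq_0 add.commute)

lemma tensor_coeff_diff: "tensor_coeff n a (x - y) = tensor_coeff n a x - tensor_coeff n a y"
  using tensor_coeff_add[of n a x "- y"] by (simp add: tensor_coeff_minus)

lemma tensor_coeff_sum: "tensor_coeff n a (sum f I) = (\<Sum>i\<in>I. tensor_coeff n a (f i))"
  by (induction I rule: infinite_finite_induct) (simp_all add: tensor_coeff_add)

lemma free_space_closed:
  "0 \<in> free_space V M" "x \<in> free_space V M \<Longrightarrow> y \<in> free_space V M \<Longrightarrow> x + y \<in> free_space V M"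
  "x \<in> free_space V M \<Longrightarrow> scale_coeffs (*) c x \<in> free_space V M"
  "x \<in> free_space V M \<Longrightarrow> - x \<in> free_space V M"
  "x \<in> free_space V M \<Longrightarrow> y \<in> free_space V M \<Longrightarrow> x - y \<in> free_space V M"
  "v \<in> V \<Longrightarrow> m \<in> M \<Longrightarrow> single (v, m) d \<in> free_space V M"
proof -
  show 1: "0 \<in> free_space V M" "v \<in> V \<Longrightarrow> m \<in> M \<Longrightarrow> single (v, m) d \<in> free_space V M"
    by (auto simp: free_space_def)
  show 2: "x + y \<in> free_space V M" if "x \<in> free_space V M" "y \<in> free_space V M" for x y
    using that keys_add[of x y] by (auto simp: free_space_def)
  show 3: "- x \<in> free_space V M" if "x \<in> free_space V M" for x
    using that by (auto simp: free_space_def in_keys_iff)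
  show "x - y \<in> free_space V M" if "x \<in> free_space V M" "y \<in> free_space V M" for x y
    using 2[OF that(1) 3[OF that(2)]] by simp
  show "scale_coeffs (*) c x \<in> free_space V M" if "x \<in> free_space V M"
    using that by (auto simp: free_space_def in_keys_iff lookup_scale_coeffs)
qed

lemma free_space_sum: "(\<And>i. i \<in> I \<Longrightarrow> f i \<in> free_space V M) \<Longrightarrow> sum f I \<in> free_space V M"
  by (induction I rule: infinite_finite_induct) (auto intro: free_space_closed)

context
  fixes \<Gamma> :: "(int^2^2) set" and n :: nat
  assumes \<Gamma>: "\<Gamma> \<subseteq> carrier SL2Z"
begin

abbreviation (input) "RR \<equiv> direct_sum (scalar_modular_forms \<Gamma>)"
abbreviation (input) "FF \<equiv> free_space (Sym n) (direct_sum (scalar_modular_forms \<Gamma>))"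
abbreviation (input) "KK \<equiv> Vn_tensor_relations \<Gamma> n"

lemma const_poly_mult_in: "f \<in> RR \<Longrightarrow> const_poly c * f \<in> RR"
  by (intro scalar_direct_sum_mult \<Gamma> const_poly_in)

lemma tensor_coeff_in: "x \<in> FF \<Longrightarrow> tensor_coeff n a x \<in> RR"
  unfolding tensor_coeff_def
  by (intro additive_set_sum scalar_direct_sum_additive const_poly_mult_in) (auto simp: free_space_def)

text \<open>The projections are bilinear in the pair, hence kill the generators of the
  relations.\<close>

lemma tensor_relations_subset: "KK \<subseteq> {x \<in> FF. \<forall>a\<le>n. tensor_coeff n a x = 0}"
  unfolding Vn_tensor_relations_def tensor_relations_def Let_def
proof (rule FS.span_minimal)
  show "FS.subspace {x \<in> FF. \<forall>a\<le>n. tensor_coeff n a x = 0}"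
    unfolding FS.subspace_def
    by (auto simp: tensor_coeff_add tensor_coeff_scale intro: free_space_closed)
  have R: "m \<in> RR \<Longrightarrow> m' \<in> RR \<Longrightarrow> m + m' \<in> RR" for m m'
    using scalar_direct_sum_additive[of \<Gamma>] by (auto simp: additive_set_def)
  show "{single (v + v', m) 1 - single (v, m) 1 - single (v', m) 1 |v v' m. v \<in> Sym n \<and> v' \<in> Sym n \<and> m \<in> RR} \<union>
    {single (v, m + m') 1 - single (v, m) 1 - single (v, m') 1 |v m m'. v \<in> Sym n \<and> m \<in> RR \<and> m' \<in> RR} \<union>
    {single (scale_sym c v, m) 1 - scale_coeffs (*) c (single (v, m) 1) |c v m. v \<in> Sym n \<and> m \<in> RR} \<union>
    {single (v, scale_coeffs scale_fun c m) 1 - scale_coeffs (*) c (single (v, m) 1) |c v m. v \<in> Sym n \<and> m \<in> RR}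
    \<subseteq> {x \<in> FF. \<forall>a\<le>n. tensor_coeff n a x = 0}"
  proof -
    let ?S = "{x \<in> FF. \<forall>a\<le>n. tensor_coeff n a x = 0}"
    have A: "single (v + v', m) 1 - single (v, m) 1 - single (v', m) 1 \<in> ?S"
      if "v \<in> Sym n" "v' \<in> Sym n" "m \<in> RR" for v v' m
      using that by (auto intro!: free_space_closed Sym_subspace
        simp: tensor_coeff_diff tensor_coeff_single lookup_add const_poly_simps distrib_right)
    have B: "single (v, m + m') 1 - single (v, m) 1 - single (v, m') 1 \<in> ?S"
      if "v \<in> Sym n" "m \<in> RR" "m' \<in> RR" for v m m'
      using that by (auto intro!: free_space_closed R simp: tensor_coeff_diff tensor_coeff_single distrib_left)
    have C: "single (scale_sym c v, m) 1 - scale_coeffs (*) c (single (v, m) 1) \<in> ?S"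
      if "v \<in> Sym n" "m \<in> RR" for c v m
      using that by (auto intro!: free_space_closed Sym_subspace
        simp: tensor_coeff_diff tensor_coeff_scale tensor_coeff_single const_poly_simps mult.assoc)
    have D: "single (v, scale_coeffs scale_fun c m) 1 - scale_coeffs (*) c (single (v, m) 1) \<in> ?S"
      if "v \<in> Sym n" "m \<in> RR" for c v m
      unfolding scale_poly_eq scale_coeffs_single
      by (intro CollectI conjI allI impI free_space_closed const_poly_mult_in that)
         (simp add: tensor_coeff_diff tensor_coeff_single const_poly_simps mult_ac)
    show ?thesis
      by (intro Un_least subsetI; elim CollectE exE conjE; hypsubst; rule A B C D; assumption)
  qed
qed

lemma tensor_relations_closed: "0 \<in> KK" "x \<in> KK \<Longrightarrow> y \<in> KK \<Longrightarrow> x + y \<in> KK" "x \<in> KK \<Longrightarrow> y \<in> KK \<Longrightarrow> x - y \<in> KK"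
  "x \<in> KK \<Longrightarrow> - x \<in> KK"
  unfolding Vn_tensor_relations_def tensor_relations_def Let_def
  by (rule FS.span_zero FS.span_add FS.span_diff FS.span_neg; assumption)+

lemma tensor_relations_sum: "(\<And>i. i \<in> I \<Longrightarrow> f i \<in> KK) \<Longrightarrow> sum f I \<in> KK"
  by (induction I rule: infinite_finite_induct) (auto intro: tensor_relations_closed)

lemma tensor_relations_gens:
  "v \<in> Sym n \<Longrightarrow> v' \<in> Sym n \<Longrightarrow> m \<in> RR \<Longrightarrow> single (v + v', m) 1 - single (v, m) 1 - single (v', m) 1 \<in> KK"
  "v \<in> Sym n \<Longrightarrow> m \<in> RR \<Longrightarrow> m' \<in> RR \<Longrightarrow> single (v, m + m') 1 - single (v, m) 1 - single (v, m') 1 \<in> KK"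
  "v \<in> Sym n \<Longrightarrow> m \<in> RR \<Longrightarrow> single (scale_sym c v, m) 1 - single (v, m) c \<in> KK"
  "v \<in> Sym n \<Longrightarrow> m \<in> RR \<Longrightarrow> single (v, const_poly c * m) 1 - single (v, m) c \<in> KK"
  unfolding Vn_tensor_relations_def tensor_relations_def Let_def
proof -
  let ?G = "{single (v + v', m) 1 - single (v, m) 1 - single (v', m) 1 |v v' m. v \<in> Sym n \<and> v' \<in> Sym n \<and> m \<in> RR} \<union>
    {single (v, m + m') 1 - single (v, m) 1 - single (v, m') 1 |v m m'. v \<in> Sym n \<and> m \<in> RR \<and> m' \<in> RR} \<union>
    {single (scale_sym c v, m) 1 - scale_coeffs (*) c (single (v, m) (1::complex)) |c v m. v \<in> Sym n \<and> m \<in> RR} \<union>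
    {single (v, scale_coeffs scale_fun c m) 1 - scale_coeffs (*) c (single (v, m) 1) |c v m. v \<in> Sym n \<and> m \<in> RR}"
  show "v \<in> Sym n \<Longrightarrow> v' \<in> Sym n \<Longrightarrow> m \<in> RR \<Longrightarrow> single (v + v', m) 1 - single (v, m) 1 - single (v', m) 1 \<in> FS.span ?G"
    by (rule FS.span_base) blast
  show "v \<in> Sym n \<Longrightarrow> m \<in> RR \<Longrightarrow> m' \<in> RR \<Longrightarrow> single (v, m + m') 1 - single (v, m) 1 - single (v, m') 1 \<in> FS.span ?G"
    by (rule FS.span_base) blast
  assume v: "v \<in> Sym n" and m: "m \<in> RR"
  have "single (scale_sym c v, m) 1 - scale_coeffs (*) c (single (v, m) 1) \<in> FS.span ?G"
    by (rule FS.span_base) (use v m in blast)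
  then show "single (scale_sym c v, m) 1 - single (v, m) c \<in> FS.span ?G"
    by (simp add: scale_coeffs_single)
  have "single (v, scale_coeffs scale_fun c m) 1 - scale_coeffs (*) c (single (v, m) 1) \<in> FS.span ?G"
    by (rule FS.span_base) (use v m in blast)
  then show "single (v, const_poly c * m) 1 - single (v, m) c \<in> FS.span ?G"
    by (simp add: scale_coeffs_single scale_poly_eq)
qed

lemma tensor_relations_zero_right: "v \<in> Sym n \<Longrightarrow> single (v, 0) 1 \<in> KK"
  using tensor_relations_gens(4)[of v 0 0] scalar_direct_sum_additive[of \<Gamma>] by (simp add: additive_set_def)

lemma tensor_relations_zero_left: "m \<in> RR \<Longrightarrow> single (0, m) 1 \<in> KK"
  using tensor_relations_gens(3)[of 0 m 0] by simp

lemma tensor_relations_sum_left: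
  assumes "\<And>i. i \<in> I \<Longrightarrow> u i \<in> Sym n" "m \<in> RR" "finite I"
  shows "single (\<Sum>i\<in>I. u i, m) 1 - (\<Sum>i\<in>I. single (u i, m) 1) \<in> KK"
  using assms(3,1)
proof (induction I rule: finite_induct)
  case empty
  then show ?case using tensor_relations_zero_left[OF assms(2)] by simp
next
  case (insert i I)
  have "single (u i + sum u I, m) 1 - single (u i, m) 1 - single (sum u I, m) 1 \<in> KK"
    by (rule tensor_relations_gens) (use insert assms(2) in \<open>auto intro: Sym_sum\<close>)
  then have "(single (u i + sum u I, m) 1 - single (u i, m) 1 - single (sum u I, m) 1) +
     (single (\<Sum>i\<in>I. u i, m) 1 - (\<Sum>i\<in>I. single (u i, m) 1)) \<in> KK"
    using insert by (intro tensor_relations_closed(2)) auto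
  then show ?case using insert by (simp add: algebra_simps)
qed

text \<open>Modulo the relations, every element is the sum of the monomials tensored with its
  coordinates. This gives the converse inclusion for the relations.\<close>

lemma tensor_normal_form:
  assumes "x \<in> FF"
  shows "x - (\<Sum>a\<le>n. single (sym_basis n a, tensor_coeff n a x) 1) \<in> KK"
proof -
  define N where "N = (\<lambda>x. \<Sum>a\<le>n. single (sym_basis n a, tensor_coeff n a x) (1::complex))"
  \<comment> \<open>For one pair: move the coefficient into the vector, expand the vector in
    monomials, and move the resulting scalars over to the form. Each move is a relation.\<close>
  have step: "single (v, m) c - N (single (v, m) c) \<in> KK" if v: "v \<in> Sym n" and m: "m \<in> RR" for v m c
  proof -
    let ?u = "\<lambda>a. scale_sym (lookup (scale_sym c v) (a, n - a)) (sym_basis n a)"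
    have cv: "(\<Sum>a\<le>n. ?u a) = scale_sym c v"
      by (rule Sym_expand[symmetric]) (simp add: v)
    have 1: "single (v, m) c - single (scale_sym c v, m) 1 \<in> KK"
      using tensor_relations_closed(4)[OF tensor_relations_gens(3)[OF v m, of c]] by simp
    have 2: "single (scale_sym c v, m) 1 - (\<Sum>a\<le>n. single (?u a, m) 1) \<in> KK"
      using tensor_relations_sum_left[of "{..n}" ?u m, unfolded cv] m by simp
    have "single (?u a, m) 1 - single (sym_basis n a, const_poly (c * lookup v (a, n - a)) * m) 1 \<in> KK" if "a \<le> n" for a
      using tensor_relations_closed(3)[OF tensor_relations_gens(3)[of "sym_basis n a" m "c * lookup v (a, n - a)"]
          tensor_relations_gens(4)[of "sym_basis n a" m "c * lookup v (a, n - a)"]] that m by simp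
    then have 3: "(\<Sum>a\<le>n. single (?u a, m) 1 - single (sym_basis n a, const_poly (c * lookup v (a, n - a)) * m) 1) \<in> KK"
      by (intro tensor_relations_sum) simp
    have "(single (v, m) c - single (scale_sym c v, m) 1) +
      (single (scale_sym c v, m) 1 - (\<Sum>a\<le>n. single (?u a, m) 1)) +
      (\<Sum>a\<le>n. single (?u a, m) 1 - single (sym_basis n a, const_poly (c * lookup v (a, n - a)) * m) 1) \<in> KK"
      by (intro tensor_relations_closed 1 2 3)
    then show ?thesis by (simp add: N_def tensor_coeff_single sum_subtractf)
  qed
  have "x' - N x' \<in> KK \<and> x' \<in> FF" if "finite A" "A \<subseteq> Sym n \<times> RR" "x' = (\<Sum>p\<in>A. single p (lookup x p))" for A x'
    using that
  proof (induction A arbitrary: x' rule: finite_induct)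
    case empty
    have "N 0 \<in> KK" unfolding N_def by (intro tensor_relations_sum) (auto intro: tensor_relations_zero_right)
    then show ?case using empty by (auto intro: tensor_relations_closed free_space_closed)
  next
    case (insert p A)
    define y where "y = (\<Sum>p\<in>A. single p (lookup x p))"
    define z where "z = single p (lookup x p)"
    have y: "y - N y \<in> KK" "y \<in> FF" using insert y_def by auto
    have z: "z - N z \<in> KK" "z \<in> FF" using insert step[of "fst p" "snd p"] by (cases p; auto simp: z_def intro: free_space_closed)+
    \<comment> \<open>The normal form is additive only modulo relations, since the keys
      \<open>(sym_basis n a, f + g)\<close> are formal symbols.\<close>
    have "N (z + y) - (N z + N y) \<in> KK"
      unfolding N_def sum.distrib[symmetric] sum_subtractf[symmetric] tensor_coeff_add diff_diff_eq[symmetric]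
      by (intro tensor_relations_sum tensor_relations_gens tensor_coeff_in y z) auto
    then have "(z - N z) + (y - N y) - (N (z + y) - (N z + N y)) \<in> KK"
      by (intro tensor_relations_closed(3)[OF tensor_relations_closed(2)[OF z(1) y(1)]])
    moreover have "x' = z + y" using insert by (simp add: y_def z_def)
    ultimately show ?case using y z by (auto simp: algebra_simps intro: free_space_closed)
  qed
  from this[of "keys x" x] show ?thesis
    using assms by (auto simp: sum_single_lookup N_def free_space_def)
qed

text \<open>The relations are the common kernel of the coordinates: if these all vanish, the normal
  form consists of symbols with second entry 0, which are relations.\<close>

lemma tensor_relations_eq: "KK = {x \<in> FF. \<forall>a\<le>n. tensor_coeff n a x = 0}"
proof
  show "{x \<in> FF. \<forall>a\<le>n. tensor_coeff n a x = 0} \<subseteq> KK"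
  proof
    fix x assume x: "x \<in> {x \<in> FF. \<forall>a\<le>n. tensor_coeff n a x = 0}"
    have "(\<Sum>a\<le>n. single (sym_basis n a, tensor_coeff n a x) 1) \<in> KK"
      using x by (intro tensor_relations_sum) (auto intro: tensor_relations_zero_right)
    then have "(x - (\<Sum>a\<le>n. single (sym_basis n a, tensor_coeff n a x) 1)) + (\<Sum>a\<le>n. single (sym_basis n a, tensor_coeff n a x) 1) \<in> KK"
      using x by (intro tensor_relations_closed tensor_normal_form) auto
    then show "x \<in> KK" by simp
  qed
qed (rule tensor_relations_subset)

lemma coset_eq_iff: "add_coset x KK = add_coset y KK \<longleftrightarrow> x - y \<in> KK"
proof
  assume "add_coset x KK = add_coset y KK"
  then have "x \<in> add_coset y KK" using tensor_relations_closed(1) by (force simp: add_coset_def)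
  then show "x - y \<in> KK" by (auto simp: add_coset_def)
next
  assume xy: "x - y \<in> KK"
  have "add_coset x KK \<subseteq> add_coset y KK" if "x - y \<in> KK" for x y
  proof
    fix z assume "z \<in> add_coset x KK"
    then obtain k where "z = x + k" "k \<in> KK" by (auto simp: add_coset_def)
    then show "z \<in> add_coset y KK"
      using tensor_relations_closed(2)[OF that, of k] by (auto simp: add_coset_def intro!: image_eqI[of _ _ "(x - y) + k"])
  qed
  from this[OF xy] this[of y x] tensor_relations_closed(4)[OF xy] show "add_coset x KK = add_coset y KK" by auto
qed

lemma coset_eq_iff_coeff:
  assumes "x \<in> FF" "y \<in> FF"
  shows "add_coset x KK = add_coset y KK \<longleftrightarrow> (\<forall>a\<le>n. tensor_coeff n a x = tensor_coeff n a y)"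
  unfolding coset_eq_iff unfolding tensor_relations_eq using assms by (auto simp: tensor_coeff_diff intro: free_space_closed)

lemma coset_add: "{x + y |x y. x \<in> add_coset u KK \<and> y \<in> add_coset v KK} = add_coset (u + v) KK"
proof
  show "{x + y |x y. x \<in> add_coset u KK \<and> y \<in> add_coset v KK} \<subseteq> add_coset (u + v) KK"
  proof clarify
    fix x y assume "x \<in> add_coset u KK" "y \<in> add_coset v KK"
    then obtain k l where "x = u + k" "y = v + l" "k \<in> KK" "l \<in> KK" by (auto simp: add_coset_def)
    then show "x + y \<in> add_coset (u + v) KK"
      using tensor_relations_closed(2)[of k l] by (auto simp: add_coset_def algebra_simps intro!: image_eqI[of _ _ "k + l"])
  qed
  show "add_coset (u + v) KK \<subseteq> {x + y |x y. x \<in> add_coset u KK \<and> y \<in> add_coset v KK}"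
  proof
    fix z assume "z \<in> add_coset (u + v) KK"
    then obtain k where "z = u + (v + k)" "k \<in> KK" by (auto simp: add_coset_def add.assoc)
    moreover have "u \<in> add_coset u KK" using tensor_relations_closed(1) by (force simp: add_coset_def)
    ultimately show "z \<in> {x + y |x y. x \<in> add_coset u KK \<and> y \<in> add_coset v KK}"
      by (auto simp: add_coset_def)
  qed
qed

lemma free_act_add: "free_act r (x + y) = free_act r x + free_act r y"
  unfolding free_act_def by (rule setsum_keys_plus_distrib) (simp_all add: single_add)

lemma free_act_single: "free_act r (single p c) = single (fst p, r * snd p) c"
  by (cases "c = 0") (simp_all add: free_act_def)

lemma tensor_coeff_act: "tensor_coeff n a (free_act r x) = r * tensor_coeff n a x"
proof (induction x rule: poly_mapping_sum_induct)
  case zero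
  then show ?case by (simp add: free_act_def)
qed (simp_all add: free_act_add free_act_single tensor_coeff_single tensor_coeff_add distrib_left mult_ac)

lemma free_act_closed: "r \<in> RR \<Longrightarrow> x \<in> FF \<Longrightarrow> free_act r x \<in> FF"
  unfolding free_act_def
proof (rule free_space_sum)
  assume r: "r \<in> RR" and x: "x \<in> FF"
  fix p assume "p \<in> keys x"
  then have "p \<in> Sym n \<times> RR" using x by (auto simp: free_space_def)
  then show "single (fst p, r * snd p) (lookup x p) \<in> FF"
    by (intro free_space_closed) (auto intro!: scalar_direct_sum_mult[OF \<Gamma>] r)
qed

text \<open>The action multiplies coordinates by r, so all representatives lead to the same coset
  and the union collapses to it.\<close>

lemma coset_act:
  assumes "r \<in> RR" "x \<in> FF"
  shows "(\<Union>y\<in>add_coset x KK. add_coset (free_act r y) KK) = add_coset (free_act r x) KK"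
proof -
  have "add_coset (free_act r y) KK = add_coset (free_act r x) KK" if y: "y \<in> add_coset x KK" for y
  proof -
    obtain k where k: "y = x + k" "k \<in> KK" using y by (auto simp: add_coset_def)
    then have kF: "k \<in> FF" "\<And>a. a \<le> n \<Longrightarrow> tensor_coeff n a k = 0" by (auto simp: tensor_relations_eq)
    have "free_act r y \<in> FF" "free_act r x \<in> FF"
      using assms kF k by (auto intro!: free_act_closed free_space_closed)
    then show ?thesis
      by (subst coset_eq_iff_coeff) (auto simp: tensor_coeff_act k kF tensor_coeff_add)
  qed
  moreover have "x \<in> add_coset x KK" using tensor_relations_closed(1) by (force simp: add_coset_def)
  ultimately show ?thesis by blast
qed

end

section \<open>The operator as an isomorphism\<close>

definition phi_basis :: "nat \<Rightarrow> nat \<Rightarrow> int \<Rightarrow>\<^sub>0 (uhp \<Rightarrow> sym)" where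
  "phi_basis n a = single (2 * int a - int n) (\<lambda>\<tau>. Phi_point \<tau> (sym_basis n a))"

text \<open>The operator \<Phi> in coordinates: the tuple f stands for the sum of the monomials
  tensored with \<open>f a\<close>.\<close>

definition phi_sum :: "nat \<Rightarrow> (nat \<Rightarrow> int \<Rightarrow>\<^sub>0 (uhp \<Rightarrow> complex)) \<Rightarrow> int \<Rightarrow>\<^sub>0 (uhp \<Rightarrow> sym)" where
  "phi_sum n f = (\<Sum>a\<le>n. modular_act (f a) (phi_basis n a))"

lemma modular_act_eq_sum_single:
  "modular_act f (single w G) = (\<Sum>l\<in>keys f. single (w + l) (\<lambda>\<tau>. scale_sym (lookup f l \<tau>) (G \<tau>)))"
  by (cases "G = 0") (auto simp: modular_act_def single_zero_fun add.commute)

lemma lookup_modular_act_single: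
  "lookup (modular_act f (single w G)) d = (\<lambda>\<tau>. scale_sym (lookup f (d - w) \<tau>) (G \<tau>))"
proof (induction f rule: poly_mapping_sum_induct)
  case (single k c)
  then show ?case
    by (auto simp: modular_act_single lookup_single when_def fun_eq_iff)
qed (auto simp: modular_act_add_left lookup_add scale_sym_add_left fun_eq_iff)

lemma scale_coeffs_sym_single:
  "scale_coeffs scale_sym_fun c (single k G) = single k (\<lambda>\<tau>. scale_sym c (G \<tau>))"
proof -
  have "scale_sym_fun c 0 = 0" by (simp add: scale_sym_fun_def fun_eq_iff)
  then show ?thesis by (simp add: scale_coeffs_def) (simp add: scale_sym_fun_def)
qed

lemma modular_act_const: "modular_act (const_poly c) F = scale_coeffs scale_sym_fun c F"
proof (induction F rule: poly_mapping_sum_induct)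
  case zero
  then show ?case by (intro poly_mapping_eqI) (simp add: scale_coeffs_def Poly_Mapping.map.rep_eq)
next
  case (single k G)
  then show ?case
    by (simp add: const_poly_def modular_act_single scale_coeffs_sym_single)
next
  case (add v w)
  have "scale_coeffs scale_sym_fun c (v + w) = scale_coeffs scale_sym_fun c v + scale_coeffs scale_sym_fun c w"
    by (rule poly_mapping_eqI)
       (simp add: lookup_scale_coeffs lookup_add scale_sym_fun_def fun_eq_iff scale_sym_add)
  then show ?case by (simp add: modular_act_add_right add)
qed

text \<open>Reduces bijectivity of \<Phi> to one degree d at a time, where \<open>phi_form\<close>
  and \<open>phi_coord\<close> invert each other.\<close>

lemma lookup_phi_sum: "lookup (phi_sum n f) d = (\<lambda>\<tau>. \<Sum>a\<le>n. phi_form n a (lookup (f a) (d - (2 * int a - int n))) \<tau>)"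
proof -
  have s: "(\<Sum>i\<in>I. g i) \<tau> = (\<Sum>i\<in>I. g i \<tau>)" for g :: "nat \<Rightarrow> uhp \<Rightarrow> sym" and I \<tau>
    by (induction I rule: infinite_finite_induct) auto
  show ?thesis
    by (rule ext) (simp add: phi_sum_def phi_basis_def lookup_sum lookup_modular_act_single s phi_form_def)
qed

lemma phi_sum_inj:
  assumes "phi_sum n f = phi_sum n g" "a \<le> n"
  shows "f a = g a"
proof (rule poly_mapping_eqI)
  fix l
  \<comment> \<open>The degree in which the weight l part of the a-th coordinate appears.\<close>
  define d where "d = l + (2 * int a - int n)"
  have "phi_coord n a (lookup (phi_sum n f) d) = lookup (f a) (d - (2 * int a - int n))" for f
    unfolding lookup_phi_sum by (rule phi_coord_form[OF assms(2)])
  then show "lookup (f a) l = lookup (g a) l"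
    using assms(1) by (metis add_diff_cancel_right' d_def)
qed

lemma phi_basis_in:
  assumes "\<Gamma> \<subseteq> carrier SL2Z" "a \<le> n"
  shows "phi_basis n a \<in> direct_sum (rho_modular_forms \<Gamma> n)"
proof -
  have "phi_form n a 1 \<in> rho_modular_forms \<Gamma> n (2 * int a - int n + 0)"
    by (rule phi_form_modular[OF assms(1) scalar_one assms(2)])
  then show ?thesis
    unfolding phi_basis_def
    using direct_sum_single[of "rho_modular_forms \<Gamma> n", OF rho_forms_additive] by (simp add: phi_form_def)
qed

lemma phi_sum_in:
  assumes "\<Gamma> \<subseteq> carrier SL2Z" "\<And>a. a \<le> n \<Longrightarrow> f a \<in> direct_sum (scalar_modular_forms \<Gamma>)"
  shows "phi_sum n f \<in> direct_sum (rho_modular_forms \<Gamma> n)"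
  unfolding phi_sum_def
  by (intro additive_set_sum direct_sum_additive rho_forms_additive modular_act_closed phi_basis_in) (use assms in auto)

text \<open>The a-th coordinate of the preimage of F; a component of degree d contributes in weight
  d - (2 a - n).\<close>

definition phi_preimage :: "nat \<Rightarrow> (int \<Rightarrow>\<^sub>0 (uhp \<Rightarrow> sym)) \<Rightarrow> nat \<Rightarrow> int \<Rightarrow>\<^sub>0 (uhp \<Rightarrow> complex)" where
  "phi_preimage n F a = (\<Sum>d\<in>keys F. single (d - (2 * int a - int n)) (phi_coord n a (lookup F d)))"

lemma phi_coord_0: "phi_coord n a 0 = 0"
  by (auto simp: phi_coord_def fun_eq_iff Phi_point_inv_def)

lemma lookup_phi_preimage: "lookup (phi_preimage n F a) l = phi_coord n a (lookup F (l + (2 * int a - int n)))"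
proof -
  have "lookup (phi_preimage n F a) l = (\<Sum>d\<in>keys F. if d = l + (2 * int a - int n) then phi_coord n a (lookup F d) else 0)"
    unfolding phi_preimage_def lookup_sum by (intro sum.cong) (auto simp: lookup_single when_def)
  also have "\<dots> = phi_coord n a (lookup F (l + (2 * int a - int n)))"
    by (simp add: in_keys_iff phi_coord_0)
  finally show ?thesis .
qed

lemma phi_preimage_in:
  assumes "\<Gamma> \<subseteq> carrier SL2Z" "F \<in> direct_sum (rho_modular_forms \<Gamma> n)" "a \<le> n"
  shows "phi_preimage n F a \<in> direct_sum (scalar_modular_forms \<Gamma>)"
proof -
  have "lookup F (l + (2 * int a - int n)) \<in> rho_modular_forms \<Gamma> n (l + (2 * int a - int n))" for l
    using assms(2) by (simp add: direct_sum_def)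
  from phi_coord_modular[OF assms(1) this assms(3)] show ?thesis
    by (simp add: direct_sum_def lookup_phi_preimage)
qed

lemma phi_sum_preimage:
  assumes "F \<in> direct_sum (rho_modular_forms \<Gamma> n)"
  shows "phi_sum n (phi_preimage n F) = F"
proof (rule poly_mapping_eqI)
  fix d
  have "lookup F d \<tau> \<in> Sym n" for \<tau> using assms by (simp add: direct_sum_def rho_modular_forms_iff)
  then show "lookup (phi_sum n (phi_preimage n F)) d = lookup F d"
    unfolding lookup_phi_sum by (simp add: lookup_phi_preimage phi_form_coord)
qed

lemma phi_sum_add: "phi_sum n (\<lambda>a. f a + g a) = phi_sum n f + phi_sum n g"
  by (simp add: phi_sum_def modular_act_add_left sum.distrib)

lemma phi_sum_sum: "phi_sum n (\<lambda>a. \<Sum>i\<in>I. f i a) = (\<Sum>i\<in>I. phi_sum n (f i))"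
  by (induction I rule: infinite_finite_induct) (simp_all add: phi_sum_add, simp_all add: phi_sum_def)

lemma modular_act_sum_right: "modular_act f (sum g I) = (\<Sum>i\<in>I. modular_act f (g i))"
  by (induction I rule: infinite_finite_induct) (simp_all add: modular_act_add_right)

lemma phi_sum_act: "phi_sum n (\<lambda>a. r * f a) = modular_act r (phi_sum n f)"
  by (simp add: phi_sum_def modular_act_assoc modular_act_sum_right)

lemma Phi_pure_phi_sum:
  assumes "v \<in> Sym n"
  shows "Phi_pure n v f = phi_sum n (\<lambda>a. const_poly (lookup v (a, n - a)) * f)"
  unfolding Phi_pure_eq[OF assms] phi_sum_def
proof (intro sum.cong refl)
  fix a
  have [simp]: "scale_coeffs scale_sym_fun c (sum g I) = (\<Sum>i\<in>I. scale_coeffs scale_sym_fun c (g i))" for c and g :: "int \<Rightarrow> int \<Rightarrow>\<^sub>0 (uhp \<Rightarrow> sym)" and I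
    by (simp add: modular_act_sum_right flip: modular_act_const)
  show "(\<Sum>l\<in>keys f. single (2 * int a - int n + l) (\<lambda>\<tau>. scale_sym (lookup v (a, n - a)) (phi_form n a (lookup f l) \<tau>))) =
    modular_act (const_poly (lookup v (a, n - a)) * f) (phi_basis n a)"
    unfolding modular_act_assoc modular_act_const unfolding phi_basis_def modular_act_eq_sum_single
    by (simp add: phi_form_def scale_coeffs_sym_single)
qed

lemma Phi_extension_eq:
  assumes "x \<in> free_space (Sym n) M"
  shows "(\<Sum>p\<in>keys x. scale_coeffs scale_sym_fun (lookup x p) (Phi_pure n (fst p) (snd p))) =
    phi_sum n (\<lambda>a. tensor_coeff n a x)"
proof -
  have "(\<Sum>p\<in>keys x. scale_coeffs scale_sym_fun (lookup x p) (Phi_pure n (fst p) (snd p))) =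
    (\<Sum>p\<in>keys x. phi_sum n (\<lambda>a. const_poly (lookup x p * lookup (fst p) (a, n - a)) * snd p))"
  proof (rule sum.cong)
    fix p assume "p \<in> keys x"
    then have v: "fst p \<in> Sym n" using assms by (auto simp: free_space_def)
    show "scale_coeffs scale_sym_fun (lookup x p) (Phi_pure n (fst p) (snd p)) =
      phi_sum n (\<lambda>a. const_poly (lookup x p * lookup (fst p) (a, n - a)) * snd p)"
      by (simp add: Phi_pure_phi_sum[OF v] const_poly_simps mult.assoc phi_sum_act flip: modular_act_const)
  qed simp
  then show ?thesis by (simp add: phi_sum_sum tensor_coeff_def)
qed

text \<open>The linear extension depends on a representative only through its coordinates, which are
  constant on a coset; so the definite description in \<open>Phi\<close> is met by exactly one
  value.\<close>

lemma Phi_coset: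
  assumes "\<Gamma> \<subseteq> carrier SL2Z" and x: "x \<in> free_space (Sym n) (direct_sum (scalar_modular_forms \<Gamma>))"
  shows "Phi n (add_coset x (Vn_tensor_relations \<Gamma> n)) = phi_sum n (\<lambda>a. tensor_coeff n a x)"
proof -
  let ?K = "Vn_tensor_relations \<Gamma> n"
  have eq: "(\<Sum>p\<in>keys y. scale_coeffs scale_sym_fun (lookup y p) (Phi_pure n (fst p) (snd p))) =
     phi_sum n (\<lambda>a. tensor_coeff n a x)" if y: "y \<in> add_coset x ?K" for y
  proof -
    obtain k where k: "y = x + k" "k \<in> ?K" using y by (auto simp: add_coset_def)
    then have kF: "k \<in> free_space (Sym n) (direct_sum (scalar_modular_forms \<Gamma>))"
      "\<And>a. a \<le> n \<Longrightarrow> tensor_coeff n a k = 0" by (auto simp: tensor_relations_eq[OF assms(1)])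
    have "y \<in> free_space (Sym n) (direct_sum (scalar_modular_forms \<Gamma>))"
      using k kF x by (auto intro: free_space_closed)
    from Phi_extension_eq[OF this] show ?thesis
      by (simp add: k kF tensor_coeff_add phi_sum_def)
  qed
  have "x \<in> add_coset x ?K" using tensor_relations_closed(1)[OF assms(1)] by (force simp: add_coset_def)
  then show ?thesis unfolding Phi_def by (intro the_equality) (auto simp: eq)
qed

theorem Phi_graded_module_iso:
  assumes \<Gamma>: "\<Gamma> \<subseteq> carrier SL2Z"
  shows "graded_module_iso
           (modular_ring \<Gamma>) (homogeneous_part (scalar_modular_forms \<Gamma>))
           (tensor_module \<Gamma> n) (tensor_part \<Gamma> n)
           (rho_module \<Gamma> n) (homogeneous_part (rho_modular_forms \<Gamma> n))
           (Phi n)"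
proof -
  let ?K = "Vn_tensor_relations \<Gamma> n"
  let ?R = "direct_sum (scalar_modular_forms \<Gamma>)"
  let ?F = "free_space (Sym n) ?R"
  let ?N = "direct_sum (rho_modular_forms \<Gamma> n)"
  have carM: "carrier (tensor_module \<Gamma> n) = (\<lambda>x. add_coset x ?K) ` ?F"
    and addM: "add (tensor_module \<Gamma> n) = (\<lambda>X Y. {x + y | x y. x \<in> X \<and> y \<in> Y})"
    and zeroM: "zero (tensor_module \<Gamma> n) = ?K"
    and smultM: "smult (tensor_module \<Gamma> n) = (\<lambda>r X. \<Union>x\<in>X. add_coset (free_act r x) ?K)"
    by (simp_all add: tensor_module_def Let_def)
  have R: "carrier (modular_ring \<Gamma>) = ?R" by (simp add: modular_ring_def)
  have N: "carrier (rho_module \<Gamma> n) = ?N" "add (rho_module \<Gamma> n) = (+)" "zero (rho_module \<Gamma> n) = 0"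
    "smult (rho_module \<Gamma> n) = modular_act" by (simp_all add: rho_module_def)
  note Phi = Phi_coset[OF \<Gamma>]
  have K0: "?K = add_coset 0 ?K" by (simp add: add_coset_def)
  have basis_sum: "(\<Sum>a\<le>n. single (sym_basis n a, f a) 1) \<in> ?F"
    "b \<le> n \<Longrightarrow> tensor_coeff n b (\<Sum>a\<le>n. single (sym_basis n a, f a) 1) = f b"
    if f: "\<And>a. a \<le> n \<Longrightarrow> f a \<in> ?R" for f b
  proof -
    show "(\<Sum>a\<le>n. single (sym_basis n a, f a) 1) \<in> ?F"
      using f by (intro free_space_sum free_space_closed) auto
    assume b: "b \<le> n"
    have "tensor_coeff n b (\<Sum>a\<le>n. single (sym_basis n a, f a) 1) = (\<Sum>a\<le>n. if a = b then f a else 0)"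
      unfolding tensor_coeff_sum
      by (rule sum.cong) (use b in \<open>auto simp: tensor_coeff_single lookup_sym_basis const_poly_simps\<close>)
    then show "tensor_coeff n b (\<Sum>a\<le>n. single (sym_basis n a, f a) 1) = f b" using b by simp
  qed
  have phi_sum_cong: "phi_sum n f = phi_sum n g" if "\<And>a. a \<le> n \<Longrightarrow> f a = g a" for f g
    using that by (auto simp: phi_sum_def intro!: sum.cong)
  show ?thesis
  proof (rule graded_module_transport[OF rho_module_graded[OF \<Gamma>]], unfold R N)
    show "bij_betw (Phi n) (carrier (tensor_module \<Gamma> n)) ?N"
    proof (rule bij_betwI')
      fix X Y assume "X \<in> carrier (tensor_module \<Gamma> n)" "Y \<in> carrier (tensor_module \<Gamma> n)"
      then obtain x y where xy: "X = add_coset x ?K" "Y = add_coset y ?K" "x \<in> ?F" "y \<in> ?F"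
        by (auto simp: carM)
      show "Phi n X = Phi n Y \<longleftrightarrow> X = Y"
        unfolding xy(1,2) Phi[OF xy(3)] Phi[OF xy(4)] coset_eq_iff_coeff[OF \<Gamma> xy(3,4)]
        by (intro iffI allI impI, erule (1) phi_sum_inj, rule phi_sum_cong) blast
    next
      fix X assume "X \<in> carrier (tensor_module \<Gamma> n)"
      then obtain x where x: "X = add_coset x ?K" "x \<in> ?F" by (auto simp: carM)
      show "Phi n X \<in> ?N"
        unfolding x(1) Phi[OF x(2)] by (intro phi_sum_in \<Gamma> tensor_coeff_in x)
    next
      fix F assume F: "F \<in> ?N"
      \<comment> \<open>The preimage is written in normal form, so that its coordinates are
        known.\<close>
      let ?x = "\<Sum>a\<le>n. single (sym_basis n a, phi_preimage n F a) 1"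
      have x: "?x \<in> ?F" "\<And>b. b \<le> n \<Longrightarrow> tensor_coeff n b ?x = phi_preimage n F b"
        by (rule basis_sum(1)[OF phi_preimage_in[OF \<Gamma> F]] basis_sum(2)[OF phi_preimage_in[OF \<Gamma> F]]; assumption)+
      have "F = Phi n (add_coset ?x ?K)"
        unfolding Phi[OF x(1)] using phi_sum_cong[OF x(2)] phi_sum_preimage[OF F] by simp
      then show "\<exists>X\<in>carrier (tensor_module \<Gamma> n). F = Phi n X"
        using x by (auto simp: carM)
    qed
    show "\<zero>\<^bsub>tensor_module \<Gamma> n\<^esub> \<in> carrier (tensor_module \<Gamma> n)"
      unfolding zeroM carM using K0 free_space_closed(1) by blast
    show "Phi n \<zero>\<^bsub>tensor_module \<Gamma> n\<^esub> = 0"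
      unfolding zeroM by (subst K0) (simp add: Phi free_space_closed phi_sum_def)
  next
    fix X Y assume "X \<in> carrier (tensor_module \<Gamma> n)" "Y \<in> carrier (tensor_module \<Gamma> n)"
    then obtain x y where xy: "X = add_coset x ?K" "Y = add_coset y ?K" "x \<in> ?F" "y \<in> ?F"
      by (auto simp: carM)
    have XY: "X \<oplus>\<^bsub>tensor_module \<Gamma> n\<^esub> Y = add_coset (x + y) ?K"
      unfolding addM xy(1,2) by (rule coset_add[OF \<Gamma>])
    show "X \<oplus>\<^bsub>tensor_module \<Gamma> n\<^esub> Y \<in> carrier (tensor_module \<Gamma> n)"
      unfolding XY carM using xy by (auto intro: free_space_closed)
    show "Phi n (X \<oplus>\<^bsub>tensor_module \<Gamma> n\<^esub> Y) = Phi n X + Phi n Y"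
      unfolding XY using xy by (simp add: Phi free_space_closed tensor_coeff_add phi_sum_add)
  next
    fix r X assume r: "r \<in> ?R" and "X \<in> carrier (tensor_module \<Gamma> n)"
    then obtain x where x: "X = add_coset x ?K" "x \<in> ?F" by (auto simp: carM)
    have rX: "r \<odot>\<^bsub>tensor_module \<Gamma> n\<^esub> X = add_coset (free_act r x) ?K"
      unfolding smultM x(1) by (rule coset_act[OF \<Gamma> r x(2)])
    have rx: "free_act r x \<in> ?F" by (rule free_act_closed[OF \<Gamma> r x(2)])
    show "r \<odot>\<^bsub>tensor_module \<Gamma> n\<^esub> X \<in> carrier (tensor_module \<Gamma> n)"
      unfolding rX carM using rx by auto
    show "Phi n (r \<odot>\<^bsub>tensor_module \<Gamma> n\<^esub> X) = modular_act r (Phi n X)"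
      unfolding rX unfolding x(1) Phi[OF rx] Phi[OF x(2)] by (simp add: tensor_coeff_act[OF \<Gamma>] phi_sum_act)
  next
    fix d
    have hom: "homogeneous_part (scalar_modular_forms \<Gamma>) l \<subseteq> ?R" for l
      by (rule homogeneous_part_subset[OF scalar_additive])
    have sub: "x \<in> ?F" if "\<forall>p\<in>keys x. \<exists>k l. k + l = d \<and> fst p \<in> weight_space n k \<and>
       snd p \<in> homogeneous_part (scalar_modular_forms \<Gamma>) l" for x
      using that hom by (fastforce simp: free_space_def weight_space_def)
    then show "tensor_part \<Gamma> n d \<subseteq> carrier (tensor_module \<Gamma> n)"
      by (auto simp: tensor_part_def carM)
    show "Phi n ` tensor_part \<Gamma> n d = homogeneous_part (rho_modular_forms \<Gamma> n) d"
    proof (intro equalityI subsetI)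
      fix F assume "F \<in> Phi n ` tensor_part \<Gamma> n d"
      then obtain x where x: "\<forall>p\<in>keys x. \<exists>k l. k + l = d \<and> fst p \<in> weight_space n k \<and>
         snd p \<in> homogeneous_part (scalar_modular_forms \<Gamma>) l" and F: "F = Phi n (add_coset x ?K)"
        by (auto simp: tensor_part_def)
      have F': "F = phi_sum n (\<lambda>a. tensor_coeff n a x)" using F Phi[OF sub[OF x]] by simp
      \<comment> \<open>A key whose vector has a nonzero a-th coordinate must have weight 2 a - n,
        which fixes the weight of its form.\<close>
      have c: "lookup (tensor_coeff n a x) l = 0" if a: "a \<le> n" and l: "l \<noteq> d - (2 * int a - int n)" for a l
      proof -
        have "lookup (const_poly (lookup x p * lookup (fst p) (a, n - a)) * snd p) l = 0" if p: "p \<in> keys x" for p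
        proof (cases "lookup (fst p) (a, n - a) = 0")
          case False
          obtain k i where k: "k + i = d" "fst p \<in> weight_space n k"
            "snd p \<in> homogeneous_part (scalar_modular_forms \<Gamma>) i" using x p by blast
          have "k = 2 * int a - int n" using k(2) False a by (auto simp: weight_space_iff)
          then have "i \<noteq> l" using k(1) l by auto
          then show ?thesis using k(3)
            by (auto simp: homogeneous_part_def const_poly_def mult_single lookup_single when_def)
        qed (simp add: const_poly_simps)
        then show ?thesis unfolding tensor_coeff_def lookup_sum by (rule sum.neutral[rule_format])
      qed
      have "lookup F e = 0" if "e \<noteq> d" for e
        unfolding F' lookup_phi_sum using that by (auto simp: c phi_form_def fun_eq_iff intro!: sum.neutral)
      then have "F = single d (lookup F d)"
        by (intro poly_mapping_eqI) (auto simp: lookup_single when_def)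
      moreover have "lookup F d \<in> rho_modular_forms \<Gamma> n d"
        using phi_sum_in[OF \<Gamma> tensor_coeff_in[OF \<Gamma> sub[OF x]]] by (simp add: F' direct_sum_def)
      ultimately show "F \<in> homogeneous_part (rho_modular_forms \<Gamma> n) d" by (auto simp: homogeneous_part_def)
    next
      fix F assume "F \<in> homogeneous_part (rho_modular_forms \<Gamma> n) d"
      then obtain G where G: "G \<in> rho_modular_forms \<Gamma> n d" "F = single d G" by (auto simp: homogeneous_part_def)
      have FN: "F \<in> ?N" unfolding G(2) by (rule direct_sum_single[of "rho_modular_forms \<Gamma> n", OF rho_forms_additive G(1)])
      let ?x = "\<Sum>a\<le>n. single (sym_basis n a, phi_preimage n F a) (1::complex)"
      have x: "?x \<in> ?F" "\<And>b. b \<le> n \<Longrightarrow> tensor_coeff n b ?x = phi_preimage n F b"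
        by (rule basis_sum(1)[OF phi_preimage_in[OF \<Gamma> FN]] basis_sum(2)[OF phi_preimage_in[OF \<Gamma> FN]]; assumption)+
      have "F = Phi n (add_coset ?x ?K)"
        unfolding Phi[OF x(1)] using phi_sum_cong[OF x(2)] phi_sum_preimage[OF FN] by simp
      \<comment> \<open>A homogeneous F has a homogeneous preimage in normal form: the monomial
        carries weight 2 a - n and its coefficient the rest of d.\<close>
      moreover have "\<exists>k l. k + l = d \<and> fst p \<in> weight_space n k \<and>
         snd p \<in> homogeneous_part (scalar_modular_forms \<Gamma>) l" if p: "p \<in> keys ?x" for p
      proof -
        obtain a where a: "a \<le> n" "p = (sym_basis n a, phi_preimage n F a)"
          using p keys_sum[of "\<lambda>a. single (sym_basis n a, phi_preimage n F a) (1::complex)" "{..n}"] by auto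
        let ?w = "2 * int a - int n"
        have "sym_basis n a \<in> weight_space n ?w"
          using a(1) by (auto simp: weight_space_iff lookup_sym_basis split: if_splits)
        moreover have "phi_preimage n F a = single (d - ?w) (phi_coord n a G)"
          by (rule poly_mapping_eqI)
             (auto simp: lookup_phi_preimage G(2) lookup_single when_def phi_coord_0)
        then have "phi_preimage n F a \<in> homogeneous_part (scalar_modular_forms \<Gamma>) (d - ?w)"
          using phi_coord_modular[OF \<Gamma> G(1) a(1)] by (auto simp: homogeneous_part_def)
        ultimately show ?thesis
          by (intro exI[of _ ?w] exI[of _ "d - ?w"]) (simp add: a(2))
      qed
      ultimately show "F \<in> Phi n ` tensor_part \<Gamma> n d"
        unfolding tensor_part_def by blast
    qed
  qed
qed

text \<open>The basis consists of the images of the n + 1 monomials tensored with 1.\<close>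

theorem rho_module_free:
  assumes \<Gamma>: "\<Gamma> \<subseteq> carrier SL2Z"
  shows "free_module_of_rank (modular_ring \<Gamma>) (rho_module \<Gamma> n) (n + 1)"
proof -
  have mod: "Module.module (modular_ring \<Gamma>) (rho_module \<Gamma> n)"
    using rho_module_graded[OF \<Gamma>] by (simp add: graded_module_def)
  interpret direct_sum_group "rho_modular_forms \<Gamma> n" "rho_module \<Gamma> n"
    by unfold_locales (auto simp: rho_module_def rho_forms_additive)
  have set: "{..<n + 1} = {..n}" by auto
  have fin: "finsum (rho_module \<Gamma> n) (\<lambda>i. c i \<odot>\<^bsub>rho_module \<Gamma> n\<^esub> phi_basis n i) {..<n + 1} = phi_sum n c"
    if "c \<in> {..<n + 1} \<rightarrow>\<^sub>E carrier (modular_ring \<Gamma>)" for c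
  proof -
    have "finsum (rho_module \<Gamma> n) (\<lambda>i. c i \<odot>\<^bsub>rho_module \<Gamma> n\<^esub> phi_basis n i) {..<n + 1} =
      (\<Sum>i\<in>{..<n + 1}. c i \<odot>\<^bsub>rho_module \<Gamma> n\<^esub> phi_basis n i)"
      by (rule finsum_eq) (use that modular_act_closed[OF \<Gamma>] phi_basis_in[OF \<Gamma>] in
        \<open>auto simp: rho_module_def modular_ring_def PiE_iff\<close>)
    then show ?thesis
      unfolding phi_sum_def set[symmetric] by (simp add: rho_module_def del: sum.lessThan_Suc)
  qed
  have "\<exists>!c. c \<in> {..<n + 1} \<rightarrow>\<^sub>E carrier (modular_ring \<Gamma>) \<and>
     F = finsum (rho_module \<Gamma> n) (\<lambda>i. c i \<odot>\<^bsub>rho_module \<Gamma> n\<^esub> phi_basis n i) {..<n + 1}"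
    if F: "F \<in> carrier (rho_module \<Gamma> n)" for F
  \<comment> \<open>Coefficient families are extensional functions, so the preimage is cut off
    outside the index range to make it unique.\<close>
  proof (rule ex1I[of _ "restrict (phi_preimage n F) {..<n + 1}"])
    have FN: "F \<in> direct_sum (rho_modular_forms \<Gamma> n)" using F by (simp add: rho_module_def)
    have c: "restrict (phi_preimage n F) {..<n + 1} \<in> {..<n + 1} \<rightarrow>\<^sub>E carrier (modular_ring \<Gamma>)"
      using phi_preimage_in[OF \<Gamma> FN] by (auto simp: modular_ring_def)
    have "phi_sum n (restrict (phi_preimage n F) {..<n + 1}) = phi_sum n (phi_preimage n F)"
      by (auto simp: phi_sum_def intro!: sum.cong)
    then show "restrict (phi_preimage n F) {..<n + 1} \<in> {..<n + 1} \<rightarrow>\<^sub>E carrier (modular_ring \<Gamma>) \<and>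
     F = finsum (rho_module \<Gamma> n) (\<lambda>i. restrict (phi_preimage n F) {..<n + 1} i \<odot>\<^bsub>rho_module \<Gamma> n\<^esub> phi_basis n i) {..<n + 1}"
      using c fin[OF c] phi_sum_preimage[OF FN] by simp
    fix c' assume c': "c' \<in> {..<n + 1} \<rightarrow>\<^sub>E carrier (modular_ring \<Gamma>) \<and>
     F = finsum (rho_module \<Gamma> n) (\<lambda>i. c' i \<odot>\<^bsub>rho_module \<Gamma> n\<^esub> phi_basis n i) {..<n + 1}"
    then have "phi_sum n c' = phi_sum n (phi_preimage n F)"
      using fin[of c'] phi_sum_preimage[OF FN] by simp
    then have "c' a = phi_preimage n F a" if "a \<le> n" for a using phi_sum_inj that by blast
    then show "c' = restrict (phi_preimage n F) {..<n + 1}"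
      using c' by (intro ext) (auto simp: restrict_def PiE_iff extensional_def)
  qed
  then show ?thesis
    unfolding free_module_of_rank_def
    using mod phi_basis_in[OF \<Gamma>] by (intro conjI exI[of _ "phi_basis n"]) (auto simp: rho_module_def)
qed

section \<open>Expansions at the cusps\<close>

lemma exp_i_eq_iff:
  fixes z w :: complex and h :: real
  assumes "h > 0" "exp (2 * of_real pi * \<i> * z / of_real h) = exp (2 * of_real pi * \<i> * w / of_real h)"
  shows "\<exists>k::int. z = w + of_int k * of_real h"
proof -
  have "nome (z / of_real h - w / of_real h) = 1"
    using assms(2) by (simp add: nome_def exp_diff right_diff_distrib)
  then obtain k where "z / of_real h - w / of_real h = of_int k"
    by (auto simp: nome_eq_1_iff elim: Ints_cases)
  then have "z = w + of_int k * of_real h" using assms(1) by (simp add: field_simps)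
  then show ?thesis ..
qed

lemma power_le_fact_exp:
  fixes x :: real
  assumes "x \<ge> 0"
  shows "x ^ n \<le> fact n * exp x"
proof -
  have "(\<Sum>k\<in>{n}. x ^ k /\<^sub>R fact k) \<le> suminf (\<lambda>k. x ^ k /\<^sub>R fact k)"
    by (rule sum_le_suminf) (use assms summable_exp[of x] in auto)
  then have "x ^ n /\<^sub>R fact n \<le> exp x" by (simp add: exp_def)
  then show ?thesis by (simp add: field_simps)
qed

text \<open>Periodicity lets F factor through q. Near q = 0 the factored function grows at most like
  a power of log |q|, so q times it tends to 0 and the singularity is removable.\<close>

lemma q_expansion:
  fixes F :: "complex \<Rightarrow> complex" and h :: real
  assumes h: "h > 0"
    and hol: "F holomorphic_on {z. Im z > 0}"
    and per: "\<And>z. Im z > 0 \<Longrightarrow> F (z + of_real h) = F z"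
    and growth: "\<And>z. Im z > Y \<Longrightarrow> norm (F z) \<le> C * norm z ^ n" and C: "C \<ge> 0"
  shows "\<exists>G. G holomorphic_on ball 0 1 \<and>
    (\<forall>z. Im z > 0 \<longrightarrow> G (exp (2 * of_real pi * \<i> * z / of_real h)) = F z)"
proof -
  define e where "e = (\<lambda>z::complex. exp (2 * of_real pi * \<i> * z / of_real h))"
  \<comment> \<open>A right inverse of \<open>e\<close> built from the principal logarithm. It jumps
    across the negative axis by a multiple of the period, which F does not see.\<close>
  define l where "l = (\<lambda>q. of_real h * Ln q / (2 * of_real pi * \<i>))"
  have per_nat: "F (z + of_nat k * of_real h) = F z" if "Im z > 0" for z k
  proof (induction k)
    case (Suc k)
    have "F (z + of_nat k * of_real h + of_real h) = F (z + of_nat k * of_real h)"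
      by (rule per) (use that in simp)
    then show ?case using Suc by (simp add: algebra_simps)
  qed simp
  have per_int: "F (z + of_int k * of_real h) = F z" if "Im z > 0" for z k
  proof (cases "k \<ge> 0")
    case True
    then show ?thesis using per_nat[OF that, of "nat k"] by simp
  next
    case False
    then show ?thesis using per_nat[of "z + of_int k * of_real h" "nat (- k)"] that by simp
  qed
  have e_l: "e (l q) = q" if "q \<noteq> 0" for q using that h by (simp add: e_def l_def)
  have norm_e: "norm (e z) = exp (- (2 * pi * Im z / h))" for z using h by (simp add: e_def Im_divide_of_real)
  have norm_e_less: "norm (e z) < 1 \<longleftrightarrow> Im z > 0" for z using h by (simp add: norm_e zero_less_mult_iff zero_less_divide_iff)
  have Im_l: "Im (l q) > 0" if "q \<noteq> 0" "norm q < 1" for q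
    using norm_e_less[of "l q"] e_l that by simp
  define G0 where "G0 = (\<lambda>q. F (l q))"
  have G0: "G0 (e z) = F z" if "Im z > 0" for z
  proof -
    have "e (l (e z)) = e z" by (rule e_l) (simp add: e_def)
    then obtain k :: int where "l (e z) = z + of_int k * of_real h"
      unfolding e_def using exp_i_eq_iff[OF h] by blast
    then show ?thesis using per_int[OF that] by (simp add: G0_def)
  qed
  have "G0 holomorphic_on (ball 0 1 - {0})"
  proof (rule holomorphic_onI, rule field_differentiable_at_within)
    fix p :: complex assume p: "p \<in> ball 0 1 - {0}"
    \<comment> \<open>A local branch centred at \<open>p\<close>: the logarithm of q/p is
      holomorphic at \<open>p\<close> even when \<open>p\<close> lies on the cut, and
      \<open>F \<circ> L\<close> agrees with \<open>G0\<close>.\<close>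
    define L where "L = (\<lambda>q. l p + of_real h * Ln (q / p) / (2 * of_real pi * \<i>))"
    have p0: "p \<noteq> 0" "norm p < 1" using p by auto
    have eL: "e (L q) = q" if "q \<noteq> 0" for q
    proof -
      have "e (L q) = e (l p) * exp (Ln (q / p))"
        using h by (simp add: e_def L_def ring_distribs add_divide_distrib exp_add)
      then show ?thesis using p0 that e_l by simp
    qed
    have L: "(L has_field_derivative of_real h * (1 / p) / (2 * of_real pi * \<i>)) (at p)"
      unfolding L_def using p0 by (auto intro!: derivative_eq_intros)
    have Lp: "L p = l p" using p0 by (simp add: L_def)
    have "F field_differentiable (at (L p))"
      using hol Im_l[OF p0] unfolding Lp
      by (intro holomorphic_on_imp_differentiable_at[OF hol]) (auto simp: open_halfspace_Im_gt)
    then have "(F \<circ> L) field_differentiable (at p)"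
      using L by (intro field_differentiable_compose) (auto simp: field_differentiable_def)
    then obtain D where D: "(F \<circ> L has_field_derivative D) (at p)" by (auto simp: field_differentiable_def)
    have "(G0 has_field_derivative D) (at p)"
    proof (rule has_field_derivative_transform_within_open[OF D])
      show "open (ball 0 1 - {0} :: complex set)" by (intro open_Diff) auto
      show "p \<in> ball 0 1 - {0}" by (rule p)
      fix q :: complex assume q: "q \<in> ball 0 1 - {0}"
      then have "e (L q) = q" "Im (L q) > 0" using eL norm_e_less[of "L q"] by auto
      then show "(F \<circ> L) q = G0 q" using G0[of "L q"] by simp
    qed
    then show "G0 field_differentiable (at p)" by (auto simp: field_differentiable_def)
  qed
  moreover have "((\<lambda>q. (q - 0) * G0 q) \<longlongrightarrow> 0) (at 0)"
  proof -
    \<comment> \<open>With s = - ln |q| one has |l q| \<le> (h/\<pi>) (s + \<pi>)/2, and x^n \<le>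
      n! exp x at x = (s + \<pi>)/2 costs only exp(s/2) = |q|^(-1/2). Keeping the half in x is what
      leaves a factor sqrt |q| after multiplication by q.\<close>
    define K where "K = C * ((h / pi) ^ n * (fact n * exp (pi / 2)))"
    define r where "r = exp (- (2 * pi * \<bar>Y\<bar> / h))"
    have bound: "norm (q * G0 q) \<le> K * sqrt (norm q)" if q: "q \<noteq> 0" "norm q < min r 1" for q
    proof -
      define s where "s = - ln (norm q)"
      have s: "s > 0" "norm q = exp (- s)" using q by (auto simp: s_def)
      have "exp (- (2 * pi * Im (l q) / h)) < exp (- (2 * pi * \<bar>Y\<bar> / h))"
        using q e_l[of q] norm_e[of "l q"] by (simp add: r_def)
      then have "2 * pi * \<bar>Y\<bar> / h < 2 * pi * Im (l q) / h" by simp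
      then have "\<bar>Y\<bar> < Im (l q)" using h by (simp add: divide_less_cancel)
      then have 1: "norm (G0 q) \<le> C * norm (l q) ^ n" unfolding G0_def by (intro growth) linarith
      have "norm (Ln q) \<le> s + pi"
      proof -
        have "\<bar>Re (Ln q)\<bar> = s" using q(1) s(1) by (simp add: s_def)
        moreover have "\<bar>Im (Ln q)\<bar> \<le> pi" using Im_Ln_le_pi[OF q(1)] mpi_less_Im_Ln[OF q(1)] by linarith
        ultimately show ?thesis using cmod_le[of "Ln q"] by linarith
      qed
      then have "norm (l q) \<le> (h / pi) * ((s + pi) / 2)"
        using h mult_left_mono[of "norm (Ln q)" "s + pi" h] by (simp add: l_def norm_mult norm_divide field_simps)
      then have "norm (l q) ^ n \<le> ((h / pi) * ((s + pi) / 2)) ^ n" by (rule power_mono) simp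
      also have "\<dots> \<le> (h / pi) ^ n * (fact n * exp ((s + pi) / 2))"
        unfolding power_mult_distrib using s h by (intro mult_left_mono power_le_fact_exp) auto
      finally have 3: "norm (l q) ^ n \<le> (h / pi) ^ n * (fact n * exp ((s + pi) / 2))" .
      have 2: "norm (G0 q) \<le> K * exp (s / 2)"
        using order.trans[OF 1 mult_left_mono[OF 3 C]] by (simp add: K_def exp_add add_divide_distrib mult_ac)
      have "sqrt (norm q) = exp (- s / 2)"
        unfolding s(2) by (rule real_sqrt_unique) (simp_all add: power2_eq_square flip: exp_add)
      then have "norm q * exp (s / 2) = sqrt (norm q)"
        unfolding s(2) by (simp flip: exp_add)
      then show ?thesis
        using mult_left_mono[OF 2, of "norm q"] by (simp add: norm_mult mult_ac)
    qed
    have "((\<lambda>q. q * G0 q) \<longlongrightarrow> 0) (at 0)"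
    proof (rule Lim_null_comparison)
      show "\<forall>\<^sub>F q in at 0. norm (q * G0 q) \<le> K * sqrt (norm q)"
        unfolding eventually_at using bound
        by (intro exI[of _ "min r 1"]) (auto simp: r_def)
      have "((\<lambda>q::complex. K * sqrt (norm q)) \<longlongrightarrow> K * sqrt (norm (0::complex))) (at 0)"
        by (intro tendsto_intros)
      then show "((\<lambda>q::complex. K * sqrt (norm q)) \<longlongrightarrow> 0) (at 0)" by simp
    qed
    then show ?thesis by simp
  qed
  ultimately obtain G where G: "G holomorphic_on ball 0 1" "\<And>q. q \<in> ball 0 1 - {0} \<Longrightarrow> G q = G0 q"
    using holomorphic_on_extend_lim[of G0 "ball 0 1" 0] by auto
  have "G (e z) = F z" if "Im z > 0" for z
    using G(2)[of "e z"] G0[OF that] that norm_e_less[of z] by (simp add: e_def)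
  then show ?thesis using G(1) unfolding e_def by blast
qed

text \<open>Schwarz's lemma of order m: divide by q^m through the shifted power series
  \<open>G1\<close> and apply the maximum principle on the disc of radius r.\<close>

lemma q_expansion_bound:
  fixes G :: "complex \<Rightarrow> complex"
  assumes hol: "G holomorphic_on ball 0 1" and zero: "\<And>i. i < m \<Longrightarrow> (deriv ^^ i) G 0 = 0"
    and r: "0 < r" "r < 1" and B: "\<And>q. norm q = r \<Longrightarrow> norm (G q) \<le> B" and q: "norm q \<le> r"
  shows "norm (G q) \<le> (norm q / r) ^ m * B"
proof -
  define c where "c = (\<lambda>n. (deriv ^^ n) G 0 / fact n)"
  have sums: "(\<lambda>n. c n * w ^ n) sums G w" if "norm w < 1" for w
    using holomorphic_power_series[OF hol, of w] that by (simp add: c_def)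
  have c0: "c i = 0" if "i < m" for i using zero[OF that] by (simp add: c_def)
  define G1 where "G1 = (\<lambda>w. suminf (\<lambda>n. c (n + m) * w ^ n))"
  have s1: "(\<lambda>n. c (n + m) * w ^ (n + m)) sums G w" if "norm w < 1" for w
  proof -
    have "(\<Sum>i<m. c i * w ^ i) = 0" using c0 by (intro sum.neutral) auto
    then show ?thesis using sums_split_initial_segment[OF sums[OF that], of m] by simp
  qed
  have summ: "summable (\<lambda>n. c (n + m) * w ^ n)" if "norm w < 1" for w
  proof (cases "w = 0")
    case False
    have "summable (\<lambda>n. c (n + m) * w ^ (n + m) / w ^ m)"
      using s1[OF that] by (intro summable_divide) (auto simp: sums_iff)
    then show ?thesis using False by (simp add: power_add)
  qed (simp add: powser_inside summable_0_powser)
  have G1: "G w = w ^ m * G1 w" if "norm w < 1" for w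
  proof -
    have "(\<lambda>n. w ^ m * (c (n + m) * w ^ n)) sums (w ^ m * G1 w)"
      unfolding G1_def by (intro sums_mult summable_sums summ that)
    moreover have "(\<lambda>n. w ^ m * (c (n + m) * w ^ n)) = (\<lambda>n. c (n + m) * w ^ (n + m))"
      by (simp add: power_add mult_ac)
    ultimately show ?thesis using s1[OF that] sums_unique2 by metis
  qed
  have "((\<lambda>w. suminf (\<lambda>n. c (n + m) * w ^ n)) has_field_derivative suminf (\<lambda>n. diffs (\<lambda>n. c (n + m)) n * w ^ n)) (at w)"
    if "norm w < 1" for w by (rule termdiffs_strong'[OF summ that])
  then have hol1: "G1 holomorphic_on ball 0 1"
    unfolding G1_def by (intro holomorphic_onI) (auto simp: field_differentiable_def intro: has_field_derivative_at_within)
  have "norm (G1 q) \<le> B / r ^ m"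
  proof (rule maximum_modulus_frontier[of G1 "cball 0 r"])
    show "G1 holomorphic_on interior (cball 0 r)"
      using r by (intro holomorphic_on_subset[OF hol1]) auto
    show "continuous_on (closure (cball 0 r)) G1"
      using r by (intro holomorphic_on_imp_continuous_on holomorphic_on_subset[OF hol1]) auto
    fix w :: complex assume "w \<in> frontier (cball 0 r)"
    then have w: "norm w = r" using r by (auto simp: frontier_cball)
    then have "norm (G w) = r ^ m * norm (G1 w)" using G1[of w] r by (simp add: norm_mult norm_power)
    then show "norm (G1 w) \<le> B / r ^ m" using B[OF w] r by (simp add: field_simps)
  qed (use q in auto)
  then have "norm q ^ m * norm (G1 q) \<le> norm q ^ m * (B / r ^ m)" by (rule mult_left_mono) simp
  then show ?thesis using G1[of q] q r by (simp add: norm_mult norm_power power_divide)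
qed

section \<open>Reduction theory\<close>

text \<open>A bottom row (k, -p) is wanted with |k \<tau> - p|^2 \<le> 5 y. Dirichlet approximation
  of the real part gives at most y from the real part and 4 y from the imaginary part.\<close>

lemma SL2Z_reduction: "\<exists>g\<in>carrier SL2Z. Im (of_uhp (moebius_uhp g \<tau>)) \<ge> 1 / 5"
proof (cases "Im (of_uhp \<tau>) \<ge> 1")
  case True
  then show ?thesis by (intro bexI[of _ "mat 1"]) (auto simp: SL2Z_def)
next
  case False
  define x y where "x = Re (of_uhp \<tau>)" and "y = Im (of_uhp \<tau>)"
  have y: "0 < y" "y < 1" using False Im_of_uhp by (auto simp: y_def)
  \<comment> \<open>For y < 1 this \<open>N\<close> lies between 1/sqrt y and 2/sqrt y: the lower
    bound controls |k x - p|, the upper one k y.\<close>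
  define N where "N = nat \<lceil>1 / sqrt y\<rceil>"
  have sy: "sqrt y > 0" "sqrt y < 1" using y by auto
  have N1: "1 / sqrt y \<le> real N" unfolding N_def by (rule real_nat_ceiling_ge)
  have "real N < 1 / sqrt y + 1" using sy by (simp add: N_def) linarith
  moreover have "1 \<le> 1 / sqrt y" using y by simp
  ultimately have N2: "real N \<le> 2 / sqrt y" by simp
  have Npos: "N > 0" using N1 sy by (cases N) (auto simp: field_simps)
  obtain p k where pk: "coprime p k" "0 < k" "k \<le> int N" "\<bar>of_int k * x - of_int p\<bar> < 1 / real N"
    using Dirichlet_approx_coprime[OF Npos, of x] by metis
  obtain u v where uv: "u * p + v * k = 1" using bezout_int[of p k] pk(1) by auto
  \<comment> \<open>Coprimality of p and k completes the row to a matrix of determinant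
    \<open>u * p + v * k\<close>.\<close>
  define g :: "int^2^2" where "g = mat2 (- u) (- v) k (- p)"
  have g: "g \<in> carrier SL2Z" using uv by (simp add: SL2Z_iff g_def)
  have "1 / real N \<le> sqrt y" using N1 sy Npos by (simp add: field_simps)
  then have "\<bar>of_int k * x - of_int p\<bar> \<le> sqrt y" using pk(4) by linarith
  then have 1: "(of_int k * x - of_int p)\<^sup>2 \<le> y" using y
    by (metis abs_le_square_iff abs_of_nonneg real_sqrt_ge_0_iff less_imp_le real_sqrt_pow2)
  have "real_of_int k \<le> 2 / sqrt y" using N2 pk(3) by linarith
  then have "real_of_int k * sqrt y \<le> 2" using sy by (simp add: pos_le_divide_eq)
  then have "real_of_int k * sqrt y * sqrt y \<le> 2 * sqrt y" using sy by (intro mult_right_mono) auto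
  then have "real_of_int k * y \<le> 2 * sqrt y" using y by (simp add: mult.assoc)
  then have "(real_of_int k * y)\<^sup>2 \<le> (2 * sqrt y)\<^sup>2" using pk(2) y by (intro power_mono) auto
  then have 2: "(real_of_int k * y)\<^sup>2 \<le> 4 * y" using y by (simp add: power_mult_distrib)
  have "(norm (automorphy_factor g \<tau>))\<^sup>2 = (of_int k * x - of_int p)\<^sup>2 + (real_of_int k * y)\<^sup>2"
    by (simp add: automorphy_factor_def g_def cmod_power2 x_def y_def)
  then have "(norm (automorphy_factor g \<tau>))\<^sup>2 \<le> 5 * y" using 1 2 by simp
  moreover have "(norm (automorphy_factor g \<tau>))\<^sup>2 > 0" using automorphy_factor_nonzero[OF g] by simp
  ultimately have "Im (of_uhp (moebius_uhp g \<tau>)) \<ge> 1 / 5"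
    unfolding of_uhp_moebius(2)[OF g] y_def[symmetric] by (simp add: field_simps)
  then show ?thesis using g by blast
qed

text \<open>Finite index enters the analysis here, as finitely many charts h, and in the existence
  of cusp widths.\<close>

lemma coset_representatives:
  assumes \<Gamma>: "subgroup \<Gamma> SL2Z" and fin: "finite (rcosets\<^bsub>SL2Z\<^esub> \<Gamma>)"
  obtains R where "finite R" "R \<subseteq> carrier SL2Z"
    "\<And>g. g \<in> carrier SL2Z \<Longrightarrow> \<exists>\<gamma>\<in>\<Gamma>. \<exists>h\<in>R. g = \<gamma> ** h"
proof -
  interpret group SL2Z by (rule SL2Z_group)
  define rep where "rep = (\<lambda>X. SOME h. h \<in> carrier SL2Z \<and> X = \<Gamma> #>\<^bsub>SL2Z\<^esub> h)"
  have rep: "rep X \<in> carrier SL2Z \<and> X = \<Gamma> #>\<^bsub>SL2Z\<^esub> rep X" if "X \<in> rcosets\<^bsub>SL2Z\<^esub> \<Gamma>" for X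
    unfolding rep_def by (rule someI_ex) (use that in \<open>auto simp: RCOSETS_def\<close>)
  show ?thesis
  proof
    show "finite (rep ` (rcosets\<^bsub>SL2Z\<^esub> \<Gamma>))" using fin by simp
    show "rep ` (rcosets\<^bsub>SL2Z\<^esub> \<Gamma>) \<subseteq> carrier SL2Z" using rep by auto
    fix g assume g: "g \<in> carrier SL2Z"
    let ?X = "\<Gamma> #>\<^bsub>SL2Z\<^esub> g"
    have X: "?X \<in> rcosets\<^bsub>SL2Z\<^esub> \<Gamma>" using g by (auto simp: RCOSETS_def)
    have "g \<in> ?X" by (rule rcos_self[OF g \<Gamma>])
    then have "g \<in> \<Gamma> #>\<^bsub>SL2Z\<^esub> rep ?X" using rep[OF X] by blast
    then show "\<exists>\<gamma>\<in>\<Gamma>. \<exists>h\<in>rep ` (rcosets\<^bsub>SL2Z\<^esub> \<Gamma>). g = \<gamma> ** h"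
      using X by (auto simp: r_coset_def)
  qed
qed

section \<open>Translations and the widths of cusps\<close>

definition translation :: "int \<Rightarrow> int^2^2" where
  "translation k = mat2 1 k 0 1"

lemma translation_in: "translation k \<in> carrier SL2Z"
  by (simp add: translation_def SL2Z_iff)

lemma translation_mult: "translation k ** translation l = translation (k + l)"
  by (intro mat2_eqI) (simp_all add: translation_def SL2Z_mult_nth)

lemma automorphy_translation [simp]: "automorphy_factor (translation k) \<tau> = 1"
  by (simp add: translation_def automorphy_factor_def)

lemma of_uhp_translation: "of_uhp (moebius_uhp (translation k) \<tau>) = of_uhp \<tau> + of_int k"
  by (simp add: of_uhp_moebius(1)[OF translation_in]) (simp add: translation_def)

text \<open>Pigeonhole: among the infinitely many products of h with translations, two lie in the
  same coset of \<Gamma>, and their difference is the width.\<close>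

lemma cusp_width:
  assumes \<Gamma>: "subgroup \<Gamma> SL2Z" and fin: "finite (rcosets\<^bsub>SL2Z\<^esub> \<Gamma>)" and h: "h \<in> carrier SL2Z"
  shows "\<exists>N::nat. N > 0 \<and> (\<exists>\<gamma>\<in>\<Gamma>. h ** translation (int N) = \<gamma> ** h)"
proof -
  interpret group SL2Z by (rule SL2Z_group)
  let ?c = "\<lambda>i::nat. \<Gamma> #>\<^bsub>SL2Z\<^esub> (h ** translation (int i))"
  have in_c: "h ** translation (int i) \<in> carrier SL2Z" for i
    by (intro SL2Z_mult_closed h translation_in)
  have "range ?c \<subseteq> rcosets\<^bsub>SL2Z\<^esub> \<Gamma>" using in_c by (auto simp: RCOSETS_def)
  then have "finite (range ?c)" using fin finite_subset by blast
  then have "\<not> inj ?c" using finite_imageD by blast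
  then obtain i j where ij: "?c i = ?c j" "i \<noteq> j" by (auto simp: inj_on_def)
  have "\<exists>N::nat. N > 0 \<and> (\<exists>\<gamma>\<in>\<Gamma>. h ** translation (int N) = \<gamma> ** h)" if "?c i = ?c j" "i < j" for i j
  proof -
    have "h ** translation (int j) \<in> ?c i" using rcos_self[OF in_c \<Gamma>] that(1) by metis
    then obtain \<gamma> where \<gamma>: "\<gamma> \<in> \<Gamma>" "h ** translation (int j) = \<gamma> ** (h ** translation (int i))"
      by (auto simp: r_coset_def)
    have "h ** translation (int (j - i)) = (h ** translation (int j)) ** translation (- int i)"
      using that(2) by (simp add: translation_mult of_nat_diff flip: matrix_mul_assoc)
    also have "\<dots> = \<gamma> ** h ** (translation (int i) ** translation (- int i))"
      by (simp add: \<gamma> matrix_mul_assoc)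
    also have "translation (int i) ** translation (- int i) = mat 1"
      by (simp add: translation_mult) (intro mat2_eqI; simp add: translation_def mat_def)
    finally show ?thesis using \<gamma>(1) that(2) by (intro exI[of _ "j - i"]) auto
  qed
  from this[of i j] this[of j i] ij show ?thesis by (metis linorder_neqE_nat)
qed

section \<open>Finite dimension of the spaces of modular forms\<close>

lemma norm_q:
  "h > 0 \<Longrightarrow> norm (exp (2 * of_real pi * \<i> * z / of_real h)) = exp (- (2 * pi * Im z / h))"
  by (simp add: Im_divide_of_real)

lemma q_surj:
  fixes h :: real
  assumes "h > 0" "q \<noteq> 0"
  obtains z where "exp (2 * of_real pi * \<i> * z / of_real h) = q"
  using assms that[of "of_real h * Ln q / (2 * of_real pi * \<i>)"] by simp

definition slash :: "int \<Rightarrow> int^2^2 \<Rightarrow> (uhp \<Rightarrow> complex) \<Rightarrow> uhp \<Rightarrow> complex" where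
  "slash k g f \<tau> = automorphy_factor g \<tau> powi (- k) * f (moebius_uhp g \<tau>)"

definition petersson :: "int \<Rightarrow> (uhp \<Rightarrow> complex) \<Rightarrow> uhp \<Rightarrow> real" where
  "petersson k f \<tau> = norm (f \<tau>) * Im (of_uhp \<tau>) powr (of_int k / 2)"

text \<open>Im(g \<tau>) = Im \<tau> / |j|^2, and the exponent k/2 turns |j|^2 into |j|^k, which is
  what the slash factor removes.\<close>

lemma petersson_slash:
  assumes g: "g \<in> carrier SL2Z"
  shows "petersson k (slash k g f) \<tau> = petersson k f (moebius_uhp g \<tau>)"
proof -
  let ?j = "norm (automorphy_factor g \<tau>)"
  have j: "?j > 0" using automorphy_factor_nonzero[OF g] by simp
  have "(?j\<^sup>2) powr (of_int k / 2) = ?j powr of_int k"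
    using j by (simp add: powr_powr flip: powr_numeral)
  also have "\<dots> = ?j powi k" using j by (simp add: powr_real_of_int')
  finally have "(Im (of_uhp \<tau>) / ?j\<^sup>2) powr (of_int k / 2) = Im (of_uhp \<tau>) powr (of_int k / 2) / ?j powi k"
    using Im_of_uhp[of \<tau>] j by (simp add: powr_divide)
  then show ?thesis
    unfolding petersson_def slash_def of_uhp_moebius(2)[OF g]
    by (simp add: norm_mult norm_divide norm_power_int power_int_minus field_simps)
qed

lemma petersson_invariant:
  assumes \<Gamma>: "\<Gamma> \<subseteq> carrier SL2Z" and f: "f \<in> scalar_modular_forms \<Gamma> k" and g: "\<gamma> \<in> \<Gamma>"
  shows "petersson k f (moebius_uhp \<gamma> \<tau>) = petersson k f \<tau>"
proof -
  have gS: "\<gamma> \<in> carrier SL2Z" using \<Gamma> g by blast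
  have "slash k \<gamma> f = f"
    using f g automorphy_factor_nonzero[OF gS]
    by (auto simp: scalar_modular_forms_iff slash_def fun_eq_iff power_int_minus)
  then show ?thesis using petersson_slash[OF gS, of k f \<tau>] by simp
qed

lemma slash_holomorphic:
  assumes f: "f \<in> tempered" and g: "g \<in> carrier SL2Z"
  shows "(\<lambda>z. slash k g f (Abs_uhp z)) holomorphic_on {z. Im z > 0}"
proof -
  let ?a = "of_int (g$1$1) :: complex" and ?b = "of_int (g$1$2) :: complex"
  let ?c = "of_int (g$2$1) :: complex" and ?d = "of_int (g$2$2) :: complex"
  have det: "g$1$1 * g$2$2 - g$1$2 * g$2$1 = 1" using g by (simp add: SL2Z_iff)
  have nz: "?c * z + ?d \<noteq> 0" if "Im z > 0" for z using Im_moebius(2)[OF det that] .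
  have "((\<lambda>z. f (Abs_uhp z)) \<circ> (\<lambda>z. (?a * z + ?b) / (?c * z + ?d))) holomorphic_on {z. Im z > 0}"
    by (rule holomorphic_on_compose_gen[OF _ tempered_holomorphic[OF f]])
       (use nz Im_moebius(1)[OF det] in \<open>auto intro!: holomorphic_intros\<close>)
  moreover have "(\<lambda>z. (?c * z + ?d) powi (- k)) holomorphic_on {z. Im z > 0}"
    using nz by (intro holomorphic_intros) auto
  ultimately have "(\<lambda>z. (?c * z + ?d) powi (- k) * f (Abs_uhp ((?a * z + ?b) / (?c * z + ?d)))) holomorphic_on {z. Im z > 0}"
    unfolding o_def by (rule holomorphic_on_mult[rotated])
  then show ?thesis
    by (rule holomorphic_transform)
       (simp add: slash_def moebius_uhp_def automorphy_factor_def Abs_uhp_inverse)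
qed

lemma slash_growth:
  assumes f: "f \<in> tempered" and g: "g \<in> carrier SL2Z"
  shows "\<exists>C Y. \<exists>n::nat. C \<ge> 0 \<and> (\<forall>\<tau>. Im (of_uhp \<tau>) > Y \<longrightarrow> norm (slash k g f \<tau>) \<le> C * norm (of_uhp \<tau>) ^ n)"
proof -
  obtain C Y n where CYn: "C \<ge> 0" "Y \<ge> 1"
    "\<And>\<tau>. Im (of_uhp \<tau>) > Y \<Longrightarrow> norm (f (moebius_uhp g \<tau>)) \<le> C * norm (of_uhp \<tau>) ^ n"
    using temperedD[OF f g] by blast
  define K where "K = \<bar>real_of_int (g$2$1)\<bar> + \<bar>real_of_int (g$2$2)\<bar> + 1"
  define m where "m = nat \<bar>k\<bar>"
  have "norm (slash k g f \<tau>) \<le> (K ^ m * C) * norm (of_uhp \<tau>) ^ (m + n)" if t: "Im (of_uhp \<tau>) > Y" for \<tau>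
  proof -
    let ?t = "norm (of_uhp \<tau>)" and ?j = "norm (automorphy_factor g \<tau>)"
    have t1: "?t \<ge> 1" using norm_of_uhp_ge[OF t] CYn(2) by linarith
    have j1: "?j \<ge> 1" using norm_automorphy_factor_ge[OF g] t CYn(2) by simp
    have jK: "?j \<le> K * ?t" using norm_automorphy_factor_le[OF t1, of g] t1 by (simp add: K_def ring_distribs)
    \<comment> \<open>As |j| \<ge> 1, the exponent |k| covers both signs of k.\<close>
    have "?j powi (- k) \<le> ?j ^ m"
    proof (cases "k \<ge> 0")
      case True
      then have "?j powi (- k) = inverse (?j ^ m)" by (simp add: m_def power_int_def power_inverse)
      also have "\<dots> \<le> 1" using one_le_power[OF j1, of m] by (simp add: inverse_le_1_iff)
      also have "1 \<le> ?j ^ m" by (rule one_le_power[OF j1])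
      finally show ?thesis .
    next
      case False
      then show ?thesis by (simp add: m_def power_int_def)
    qed
    also have "\<dots> \<le> (K * ?t) ^ m" by (rule power_mono[OF jK]) simp
    finally have "?j powi (- k) * norm (f (moebius_uhp g \<tau>)) \<le> (K * ?t) ^ m * (C * ?t ^ n)"
      using CYn(3)[OF t] by (intro mult_mono) (auto simp: K_def)
    then show ?thesis
      by (simp add: slash_def norm_mult norm_power_int power_mult_distrib power_add mult_ac)
  qed
  moreover have "K ^ m * C \<ge> 0" using CYn(1) by (simp add: K_def)
  ultimately show ?thesis by blast
qed

text \<open>Conjugation by h moves the translation into \<Gamma>; the automorphy factor of \<gamma>
  picked up inside the slash factor cancels the one from the modularity of f.\<close>

lemma slash_periodic:
  assumes \<Gamma>: "\<Gamma> \<subseteq> carrier SL2Z" and f: "f \<in> scalar_modular_forms \<Gamma> k" and h: "h \<in> carrier SL2Z"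
    and \<gamma>: "\<gamma> \<in> \<Gamma>" "h ** translation N = \<gamma> ** h"
  shows "slash k h f (moebius_uhp (translation N) \<tau>) = slash k h f \<tau>"
proof -
  have gS: "\<gamma> \<in> carrier SL2Z" using \<Gamma> \<gamma>(1) by blast
  have "moebius_uhp h (moebius_uhp (translation N) \<tau>) = moebius_uhp \<gamma> (moebius_uhp h \<tau>)"
    using \<gamma>(2) by (metis moebius_uhp_mult h gS translation_in)
  moreover have "automorphy_factor h (moebius_uhp (translation N) \<tau>) =
      automorphy_factor \<gamma> (moebius_uhp h \<tau>) * automorphy_factor h \<tau>"
    using automorphy_factor_mult[OF h translation_in, of N \<tau>] automorphy_factor_mult[OF gS h, of \<tau>] \<gamma>(2) by simp
  moreover have "f (moebius_uhp \<gamma> (moebius_uhp h \<tau>)) =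
      automorphy_factor \<gamma> (moebius_uhp h \<tau>) powi k * f (moebius_uhp h \<tau>)"
    using f \<gamma>(1) by (simp add: scalar_modular_forms_iff)
  ultimately show ?thesis
    using automorphy_factor_nonzero[OF gS, of "moebius_uhp h \<tau>"]
    by (simp add: slash_def power_int_mult_distrib power_int_minus)
qed

text \<open>The Taylor series of f in exp(2 \<pi> i \<tau>/N) at the cusp h sends infinity to. The
  choice is harmless: \<open>disc_eqI\<close> makes such a function unique on the unit disc.\<close>

definition cusp_expansion :: "int \<Rightarrow> int^2^2 \<Rightarrow> nat \<Rightarrow> (uhp \<Rightarrow> complex) \<Rightarrow> complex \<Rightarrow> complex" where
  "cusp_expansion k h N f = (SOME G. G holomorphic_on ball 0 1 \<and>
     (\<forall>\<tau>. G (exp (2 * of_real pi * \<i> * of_uhp \<tau> / of_real (real N))) = slash k h f \<tau>))"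

lemma cusp_expansion:
  assumes \<Gamma>: "\<Gamma> \<subseteq> carrier SL2Z" and f: "f \<in> scalar_modular_forms \<Gamma> k" and h: "h \<in> carrier SL2Z"
    and \<gamma>: "\<gamma> \<in> \<Gamma>" "h ** translation (int N) = \<gamma> ** h" and N: "N > 0"
  shows "cusp_expansion k h N f holomorphic_on ball 0 1"
    and "cusp_expansion k h N f (exp (2 * of_real pi * \<i> * of_uhp \<tau> / of_real (real N))) = slash k h f \<tau>"
proof -
  have ft: "f \<in> tempered" using f by (simp add: scalar_modular_forms_iff)
  obtain C Y n where CYn: "C \<ge> 0" "\<And>\<tau>. Im (of_uhp \<tau>) > Y \<Longrightarrow> norm (slash k h f \<tau>) \<le> C * norm (of_uhp \<tau>) ^ (n::nat)"
    using slash_growth[OF ft h] by blast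
  have "\<exists>G. G holomorphic_on ball 0 1 \<and>
    (\<forall>z. Im z > 0 \<longrightarrow> G (exp (2 * of_real pi * \<i> * z / of_real (real N))) = slash k h f (Abs_uhp z))"
  proof (rule q_expansion[where Y = "max Y 0" and C = C and n = n])
    show "slash k h f (Abs_uhp (z + of_real (real N))) = slash k h f (Abs_uhp z)" if "Im z > 0" for z
    proof -
      have "moebius_uhp (translation (int N)) (Abs_uhp z) = Abs_uhp (z + of_real (real N))"
        using that of_uhp_translation[of "int N" "Abs_uhp z"] by (metis Abs_uhp_inverse mem_Collect_eq of_int_of_nat_eq of_real_of_nat_eq of_uhp_inverse)
      then show ?thesis using slash_periodic[OF \<Gamma> f h \<gamma>, of "Abs_uhp z"] by simp
    qed
    show "norm (slash k h f (Abs_uhp z)) \<le> C * norm z ^ n" if "Im z > max Y 0" for z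
      using CYn(2)[of "Abs_uhp z"] that by (simp add: Abs_uhp_inverse)
  qed (use N CYn(1) slash_holomorphic[OF ft h] in auto)
  then obtain G where "G holomorphic_on ball 0 1"
    "\<And>z. Im z > 0 \<Longrightarrow> G (exp (2 * of_real pi * \<i> * z / of_real (real N))) = slash k h f (Abs_uhp z)" by blast
  then have "\<exists>G. G holomorphic_on ball 0 1 \<and>
     (\<forall>\<tau>. G (exp (2 * of_real pi * \<i> * of_uhp \<tau> / of_real (real N))) = slash k h f \<tau>)"
    by (intro exI[of _ G]) (auto simp: Im_of_uhp of_uhp_inverse)
  from someI_ex[OF this]
  show "cusp_expansion k h N f holomorphic_on ball 0 1"
    and "cusp_expansion k h N f (exp (2 * of_real pi * \<i> * of_uhp \<tau> / of_real (real N))) = slash k h f \<tau>"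
    unfolding cusp_expansion_def by blast+
qed

text \<open>From height 1/10 up to height y, Schwarz's lemma gains exp(-2 \<pi> m (y - 1/10)/h)
  while the weight factor changes by (10 y)^(k/2); \<theta> bounds the product of the two for y
  \<ge> 1/5.\<close>

lemma petersson_decay:
  fixes \<theta> :: real
  assumes G: "G holomorphic_on ball 0 1"
    and GF: "\<And>\<tau>. G (exp (2 * of_real pi * \<i> * of_uhp \<tau> / of_real h)) = F \<tau>"
    and zero: "\<And>i. i < m \<Longrightarrow> (deriv ^^ i) G 0 = 0" and h: "h > 0"
    and B: "\<And>\<tau>. Im (of_uhp \<tau>) = 1/10 \<Longrightarrow> petersson k F \<tau> \<le> B"
    and cond: "\<And>y. y \<ge> 1/5 \<Longrightarrow> (10 * y) powr (of_int k / 2) * exp (- (2 * pi * real m * (y - 1/10) / h)) \<le> \<theta>"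
    and \<tau>: "Im (of_uhp \<tau>) \<ge> 1/5" and B0: "B \<ge> 0"
  shows "petersson k F \<tau> \<le> \<theta> * B"
proof -
  let ?e = "\<lambda>z. exp (2 * of_real pi * \<i> * z / of_real h)"
  define y where "y = Im (of_uhp \<tau>)"
  define r where "r = exp (- (2 * pi * (1/10) / h))"
  define q where "q = ?e (of_uhp \<tau>)"
  \<comment> \<open>The Petersson bound at height 1/10, restated as a bound for F itself on the
    circle |q| = r.\<close>
  define B' where "B' = B / (1/10) powr (of_int k / 2)"
  have r: "0 < r" "r < 1" using h by (auto simp: r_def)
  have nq: "norm q = exp (- (2 * pi * y / h))" unfolding q_def y_def by (rule norm_q[OF h])
  have qr: "norm q / r = exp (- (2 * pi * (y - 1/10) / h))"
    unfolding nq r_def by (simp add: right_diff_distrib diff_divide_distrib flip: exp_diff)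
  have "2 * pi * (1/10) / h \<le> 2 * pi * y / h"
    using \<tau> h by (intro divide_right_mono mult_left_mono) (auto simp: y_def)
  then have "norm q \<le> r"
    unfolding nq r_def by simp
  have GB: "norm (G p) \<le> B'" if p: "norm p = r" for p
  proof -
    have "p \<noteq> 0" using p r by auto
    then obtain z where z: "?e z = p" using q_surj[OF h] by metis
    have "exp (- (2 * pi * Im z / h)) = exp (- (2 * pi * (1/10) / h))"
      using p norm_q[OF h, of z] by (simp only: z r_def)
    then have "2 * pi * Im z / h = 2 * pi * (1/10) / h" by (simp only: exp_inj_iff neg_equal_iff_equal)
    then have Imz: "Im z = 1/10" unfolding divide_cancel_right mult_cancel_left using h by auto
    then have zz: "of_uhp (Abs_uhp z) = z" by (simp add: Abs_uhp_inverse)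
    have "petersson k F (Abs_uhp z) \<le> B" by (rule B) (simp add: zz Imz)
    then have "norm (F (Abs_uhp z)) * (1/10) powr (of_int k / 2) \<le> B" by (simp add: petersson_def zz Imz)
    then have "norm (F (Abs_uhp z)) \<le> B'" unfolding B'_def by (subst pos_le_divide_eq) auto
    then show ?thesis using GF[of "Abs_uhp z"] by (simp only: zz z)
  qed
  have "norm (F \<tau>) \<le> (norm q / r) ^ m * B'"
    using q_expansion_bound[OF G zero r GB \<open>norm q \<le> r\<close>] GF[of \<tau>] by (simp only: q_def)
  also have "(norm q / r) ^ m = exp (- (2 * pi * real m * (y - 1/10) / h))"
    unfolding qr exp_of_nat_mult[symmetric] by (simp add: mult_ac)
  finally have "petersson k F \<tau> \<le> exp (- (2 * pi * real m * (y - 1/10) / h)) * B' * y powr (of_int k / 2)"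
    unfolding petersson_def y_def by (intro mult_right_mono) auto
  also have "\<dots> = (y powr (of_int k / 2) / (1/10) powr (of_int k / 2)) *
      exp (- (2 * pi * real m * (y - 1/10) / h)) * B"
    by (simp only: B'_def times_divide_eq_left times_divide_eq_right mult_ac)
  also have "y powr (of_int k / 2) / (1/10) powr (of_int k / 2) = (10 * y) powr (of_int k / 2)"
    using \<tau> by (subst powr_divide[symmetric]) (auto simp: y_def mult.commute)
  also have "(10 * y) powr (of_int k / 2) * exp (- (2 * pi * real m * (y - 1/10) / h)) * B \<le> \<theta> * B"
    using \<tau> B0 by (intro mult_right_mono cond) (auto simp: y_def)
  finally show ?thesis .
qed

text \<open>Keeping \<theta> and the orders \<open>m h\<close> abstract serves two applications: m =
  0 in negative weight, and large orders in general.\<close>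

lemma modular_form_vanishes:
  fixes \<theta> :: real
  assumes \<Gamma>: "\<Gamma> \<subseteq> carrier SL2Z" and f: "f \<in> scalar_modular_forms \<Gamma> k"
    and R: "finite R" "R \<subseteq> carrier SL2Z" "\<And>g. g \<in> carrier SL2Z \<Longrightarrow> \<exists>\<gamma>\<in>\<Gamma>. \<exists>h\<in>R. g = \<gamma> ** h"
    and N: "\<And>h. h \<in> R \<Longrightarrow> N h > 0 \<and> (\<exists>\<gamma>\<in>\<Gamma>. h ** translation (int (N h)) = \<gamma> ** h)"
    and \<theta>: "0 \<le> \<theta>" "\<theta> < 1"
    and cond: "\<And>h y. h \<in> R \<Longrightarrow> y \<ge> 1/5 \<Longrightarrow>
       (10 * y) powr (of_int k / 2) * exp (- (2 * pi * real (m h) * (y - 1/10) / real (N h))) \<le> \<theta>"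
    and zero: "\<And>h i. h \<in> R \<Longrightarrow> i < m h \<Longrightarrow> (deriv ^^ i) (cusp_expansion k h (N h) f) 0 = 0"
  shows "f = 0"
proof -
  have decay: "petersson k f (moebius_uhp h \<tau>) \<le> \<theta> * B"
    if h: "h \<in> R" and B: "\<And>\<tau>. Im (of_uhp \<tau>) = 1/10 \<Longrightarrow> petersson k f (moebius_uhp h \<tau>) \<le> B"
      and B0: "B \<ge> 0" and \<tau>: "Im (of_uhp \<tau>) \<ge> 1/5" for h B \<tau>
  proof -
    have hS: "h \<in> carrier SL2Z" using h R by blast
    obtain \<gamma> where \<gamma>: "\<gamma> \<in> \<Gamma>" "h ** translation (int (N h)) = \<gamma> ** h" "N h > 0" using N[OF h] by blast
    note ce = cusp_expansion[OF \<Gamma> f hS \<gamma>]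
    have "petersson k (slash k h f) \<tau> \<le> \<theta> * B"
      by (rule petersson_decay[OF ce zero[OF h]]) (use \<gamma> B B0 \<tau> cond[OF h] petersson_slash[OF hS] in auto)
    then show ?thesis by (simp add: petersson_slash[OF hS])
  qed
  \<comment> \<open>A line of fixed height is a compact circle in the q-disc. This first bound makes
    the supremum finite; without it the contraction below would prove nothing.\<close>
  have bounded: "\<exists>B\<ge>0. \<forall>\<tau>. Im (of_uhp \<tau>) = 1/10 \<longrightarrow> petersson k f (moebius_uhp h \<tau>) \<le> B" if h: "h \<in> R" for h
  proof -
    have hS: "h \<in> carrier SL2Z" using h R by blast
    obtain \<gamma> where \<gamma>: "\<gamma> \<in> \<Gamma>" "h ** translation (int (N h)) = \<gamma> ** h" "N h > 0" using N[OF h] by blast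
    note ce = cusp_expansion[OF \<Gamma> f hS \<gamma>]
    define r where "r = exp (- (2 * pi * (1/10) / real (N h)))"
    have r: "r < 1" using \<gamma>(3) by (simp add: r_def)
    have "continuous_on (sphere 0 r) (cusp_expansion k h (N h) f)"
      using r by (intro holomorphic_on_imp_continuous_on holomorphic_on_subset[OF ce(1)]) auto
    then have "bounded (cusp_expansion k h (N h) f ` sphere 0 r)"
      by (intro compact_imp_bounded compact_continuous_image) auto
    then obtain b where b: "\<And>q. q \<in> sphere 0 r \<Longrightarrow> norm (cusp_expansion k h (N h) f q) \<le> b"
      unfolding bounded_iff by blast
    have "petersson k f (moebius_uhp h \<tau>) \<le> \<bar>b\<bar> * (1/10) powr (of_int k / 2)" if "Im (of_uhp \<tau>) = 1/10" for \<tau>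
    proof -
      have "norm (exp (2 * of_real pi * \<i> * of_uhp \<tau> / of_real (real (N h)))) = r"
        using norm_q[of "real (N h)" "of_uhp \<tau>"] \<gamma>(3) that by (simp only: r_def of_nat_0_less_iff)
      then have "norm (slash k h f \<tau>) \<le> b"
        using b[of "exp (2 * of_real pi * \<i> * of_uhp \<tau> / of_real (real (N h)))"] ce(2)[of \<tau>] by simp
      then have "petersson k (slash k h f) \<tau> \<le> \<bar>b\<bar> * (1/10) powr (of_int k / 2)"
        unfolding petersson_def that by (intro mult_right_mono) auto
      then show ?thesis by (simp add: petersson_slash[OF hS])
    qed
    then show ?thesis by (intro exI[of _ "\<bar>b\<bar> * (1/10) powr (of_int k / 2)"]) auto
  qed
  \<comment> \<open>The inverse of the reducing g is decomposed as \<gamma> h, so that \<tau> is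
    \<gamma> applied to h applied to a point of height at least 1/5.\<close>
  have reduce: "\<exists>h\<in>R. \<exists>\<tau>'. Im (of_uhp \<tau>') \<ge> 1/5 \<and> petersson k f \<tau> = petersson k f (moebius_uhp h \<tau>')" for \<tau>
  proof -
    obtain g where g: "g \<in> carrier SL2Z" "Im (of_uhp (moebius_uhp g \<tau>)) \<ge> 1/5"
      using SL2Z_reduction by blast
    obtain \<gamma> h where \<gamma>: "\<gamma> \<in> \<Gamma>" "h \<in> R" "SL2Z_inv g = \<gamma> ** h" using R(3)[OF SL2Z_inv_closed[OF g(1)]] by blast
    have "\<gamma> \<in> carrier SL2Z" "h \<in> carrier SL2Z" using \<gamma> \<Gamma> R(2) by auto
    then have "moebius_uhp \<gamma> (moebius_uhp h (moebius_uhp g \<tau>)) = moebius_uhp (SL2Z_inv g) (moebius_uhp g \<tau>)"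
      unfolding \<gamma>(3) by (rule moebius_uhp_mult[symmetric])
    also have "\<dots> = \<tau>" by (rule moebius_uhp_inv(1)[OF g(1)])
    finally have "petersson k f \<tau> = petersson k f (moebius_uhp h (moebius_uhp g \<tau>))"
      using petersson_invariant[OF \<Gamma> f \<gamma>(1), of "moebius_uhp h (moebius_uhp g \<tau>)"] by simp
    then show ?thesis using \<gamma>(2) g(2) by blast
  qed
  have p0: "petersson k f \<tau> \<ge> 0" for \<tau> by (simp add: petersson_def)
  obtain b where b: "\<And>h. h \<in> R \<Longrightarrow> b h \<ge> 0"
    "\<And>h \<tau>. h \<in> R \<Longrightarrow> Im (of_uhp \<tau>) = 1/10 \<Longrightarrow> petersson k f (moebius_uhp h \<tau>) \<le> b h"
    using bounded by metis
  have bdd: "bdd_above (range (petersson k f))"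
  proof (rule bdd_aboveI2)
    fix \<tau>
    obtain h \<tau>' where h: "h \<in> R" "Im (of_uhp \<tau>') \<ge> 1/5" "petersson k f \<tau> = petersson k f (moebius_uhp h \<tau>')"
      using reduce by blast
    have "petersson k f \<tau> \<le> \<theta> * b h" unfolding h(3) by (rule decay[OF h(1) b(2)[OF h(1)] b(1)[OF h(1)] h(2)])
    also have "\<dots> \<le> \<theta> * sum b R" using R(1) b(1) h(1) \<theta>(1) by (intro mult_left_mono member_le_sum) auto
    finally show "petersson k f \<tau> \<le> \<theta> * sum b R" .
  qed
  define M where "M = (SUP \<tau>. petersson k f \<tau>)"
  have le: "petersson k f \<tau> \<le> M" for \<tau> unfolding M_def by (rule cSUP_upper[OF UNIV_I bdd])
  have M0: "M \<ge> 0" using order.trans[OF p0 le] .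
  have "petersson k f \<tau> \<le> \<theta> * M" for \<tau>
  proof -
    obtain h \<tau>' where h: "h \<in> R" "Im (of_uhp \<tau>') \<ge> 1/5" "petersson k f \<tau> = petersson k f (moebius_uhp h \<tau>')"
      using reduce by blast
    show ?thesis unfolding h(3) by (rule decay[OF h(1) le M0 h(2)])
  qed
  \<comment> \<open>The supremum itself now serves as the bound at height 1/10.\<close>
  then have "M \<le> \<theta> * M" unfolding M_def by (intro cSUP_least) auto
  then have "M * (1 - \<theta>) \<le> 0" by (simp add: algebra_simps)
  then have "M = 0" using \<theta> M0 by (simp add: mult_le_0_iff)
  then have "petersson k f \<tau> = 0" for \<tau> using le[of \<tau>] p0[of \<tau>] by simp
  then show ?thesis by (auto simp: petersson_def fun_eq_iff) (metis Im_of_uhp less_irrefl)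
qed

text \<open>With u = y - 1/10 one has 10 y = 1 + 10 u \<le> exp(10 u), so the weight factor is at
  most exp(5 |k| u). A decay rate c = 5 |k| + 1 beats it and leaves exp(-u) \<le>
  exp(-1/10).\<close>

lemma decay_condition:
  assumes "N > 0"
  shows "\<exists>m. \<forall>y\<ge>1/5. (10 * y) powr (of_int k / 2) * exp (- (2 * pi * real m * (y - 1/10) / real N)) \<le> exp (- (1/10))"
proof -
  define c where "c = 5 * \<bar>of_int k\<bar> + (1::real)"
  define m where "m = nat \<lceil>c * real N / (2 * pi)\<rceil>"
  have "c * real N / (2 * pi) \<le> real m" unfolding m_def by (rule real_nat_ceiling_ge)
  then have m: "2 * pi * real m / real N \<ge> c" using assms by (simp add: field_simps)
  have "(10 * y) powr (of_int k / 2) * exp (- (2 * pi * real m * (y - 1/10) / real N)) \<le> exp (- (1/10))"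
    if y: "y \<ge> 1/5" for y
  proof -
    define u where "u = y - 1/10"
    have u: "u \<ge> 1/10" using y by (simp add: u_def)
    have "(10 * y) powr (of_int k / 2) \<le> (10 * y) powr (\<bar>of_int k\<bar> / 2)"
      using y by (intro powr_mono) auto
    also have "\<dots> \<le> exp (10 * u) powr (\<bar>of_int k\<bar> / 2)"
      using y exp_ge_add_one_self[of "10 * u"] by (intro powr_mono2) (auto simp: u_def)
    also have "\<dots> = exp (5 * \<bar>of_int k\<bar> * u)" by (simp add: powr_def)
    finally have 1: "(10 * y) powr (of_int k / 2) \<le> exp (5 * \<bar>of_int k\<bar> * u)" .
    have "c * u \<le> 2 * pi * real m / real N * u" using m u by (intro mult_right_mono) auto
    then have 2: "exp (- (2 * pi * real m * (y - 1/10) / real N)) \<le> exp (- (c * u))" by (simp add: u_def)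
    have "(10 * y) powr (of_int k / 2) * exp (- (2 * pi * real m * (y - 1/10) / real N))
       \<le> exp (5 * \<bar>of_int k\<bar> * u) * exp (- (c * u))"
      by (intro mult_mono 1 2) auto
    also have "\<dots> = exp (- u)" by (simp add: c_def ring_distribs flip: exp_add)
    also have "\<dots> \<le> exp (- (1/10))" using u by simp
    finally show ?thesis .
  qed
  then show ?thesis by blast
qed

lemma modular_forms_negative_weight:
  assumes \<Gamma>: "subgroup \<Gamma> SL2Z" and fin: "finite (rcosets\<^bsub>SL2Z\<^esub> \<Gamma>)" and k: "k < 0"
    and f: "f \<in> scalar_modular_forms \<Gamma> k"
  shows "f = 0"
proof -
  have sub: "\<Gamma> \<subseteq> carrier SL2Z" using \<Gamma> by (rule subgroup.subset)
  obtain R where R: "finite R" "R \<subseteq> carrier SL2Z" "\<And>g. g \<in> carrier SL2Z \<Longrightarrow> \<exists>\<gamma>\<in>\<Gamma>. \<exists>h\<in>R. g = \<gamma> ** h"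
    using coset_representatives[OF \<Gamma> fin] by blast
  have "\<forall>h\<in>R. \<exists>N::nat. N > 0 \<and> (\<exists>\<gamma>\<in>\<Gamma>. h ** translation (int N) = \<gamma> ** h)"
    using cusp_width[OF \<Gamma> fin] R(2) by blast
  then obtain N where N: "\<And>h. h \<in> R \<Longrightarrow> N h > (0::nat) \<and> (\<exists>\<gamma>\<in>\<Gamma>. h ** translation (int (N h)) = \<gamma> ** h)"
    by metis
  have k': "real_of_int k < 0" using k by simp
  show ?thesis
  \<comment> \<open>With m = 0 the vanishing condition is empty, and 10 y \<ge> 2 with k < 0 bounds
    the weight factor by 2^(k/2).\<close>
  proof (rule modular_form_vanishes[OF sub f R N, where \<theta> = "2 powr (of_int k / 2)" and m = "\<lambda>_. 0"])
    show "2 powr (real_of_int k / 2) < 1" using k' by (simp add: powr_less_one)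
    show "(10 * y) powr (real_of_int k / 2) * exp (- (2 * pi * real 0 * (y - 1 / 10) / real (N h))) \<le> 2 powr (real_of_int k / 2)"
      if "1 / 5 \<le> y" for h y
      using that k' by (auto intro!: powr_mono2')
  qed auto
qed

section \<open>Finitely many Taylor coefficients determine a form\<close>

interpretation VF: vector_space scale_fun
  by unfold_locales (auto simp: scale_fun_def fun_eq_iff algebra_simps)

text \<open>The kernel of one functional has codimension at most 1, so removing functionals one by
  one costs one spanning vector each. Linearity is asked on S only, since Taylor coefficients at
  cusps are linear only on modular forms.\<close>

lemma (in vector_space) finite_span_of_functionals:
  fixes L :: "('b \<Rightarrow> 'a) set"
  assumes "finite L" "subspace S"
    and "\<And>l x y. l \<in> L \<Longrightarrow> x \<in> S \<Longrightarrow> y \<in> S \<Longrightarrow> l (x + y) = l x + l y"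
    and "\<And>l c x. l \<in> L \<Longrightarrow> x \<in> S \<Longrightarrow> l (scale c x) = c * l x"
    and "\<And>x. x \<in> S \<Longrightarrow> (\<forall>l\<in>L. l x = 0) \<Longrightarrow> x = 0"
  shows "\<exists>B. finite B \<and> S \<subseteq> span B"
  using assms
proof (induction L arbitrary: S rule: finite_induct)
  case empty
  then have "S \<subseteq> span {}" by auto
  then show ?case by blast
next
  case (insert l L)
  define S' where "S' = {x \<in> S. l x = 0}"
  have l0: "l 0 = 0"
    using insert.prems(3)[of l 0 0] insert.prems(1) subspace_0 by auto
  have "l (x + y) = l x + l y" "l (scale c x) = c * l x" if "x \<in> S" "y \<in> S" for x y c
    using insert.prems(2,3)[OF insertI1] that by auto
  then have "subspace S'"
    using insert.prems(1) l0 unfolding subspace_def S'_def by auto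
  then obtain B where B: "finite B" "S' \<subseteq> span B"
    using insert.IH[of S'] insert.prems unfolding S'_def by auto
  show ?case
  proof (cases "S' = S")
    case True
    then show ?thesis using B by blast
  next
    case False
    then obtain x0 where x0: "x0 \<in> S" "l x0 \<noteq> 0" unfolding S'_def by auto
    have "S \<subseteq> span (insert x0 B)"
    proof
      fix x assume x: "x \<in> S"
      define c where "c = - (l x / l x0)"
      have cx: "scale c x0 \<in> S" by (rule subspace_scale[OF insert.prems(1) x0(1)])
      have "l (x + scale c x0) = l x + c * l x0"
        using insert.prems(2)[OF insertI1 x cx] insert.prems(3)[OF insertI1 x0(1)] by simp
      then have "l (x + scale c x0) = 0" using x0(2) by (simp add: c_def)
      then have "x + scale c x0 \<in> S'"
        unfolding S'_def using subspace_add[OF insert.prems(1) x cx] by blast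
      then have "x + scale c x0 \<in> span (insert x0 B)" using B(2) span_mono[of B "insert x0 B"] by auto
      then have "(x + scale c x0) - scale c x0 \<in> span (insert x0 B)"
        by (rule span_diff) (intro span_scale span_base insertI1)
      then show "x \<in> span (insert x0 B)" by simp
    qed
    then show ?thesis using B(1) by blast
  qed
qed

lemma scalar_subspace: "VF.subspace (scalar_modular_forms \<Gamma> k)"
  unfolding VF.subspace_def using scalar_additive[of \<Gamma> k] scalar_scale by (auto simp: additive_set_def)

text \<open>Every q except 0 comes from some z, and continuity settles q = 0. This uniqueness is
  what makes expansions obtained by choice linear in the form.\<close>

lemma disc_eqI:
  fixes h :: real
  assumes h: "h > 0" and hol: "G1 holomorphic_on ball 0 1" "G2 holomorphic_on ball 0 1"
    and eq: "\<And>z. Im z > 0 \<Longrightarrow> G1 (exp (2 * of_real pi * \<i> * z / of_real h)) = G2 (exp (2 * of_real pi * \<i> * z / of_real h))"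
    and q: "q \<in> ball 0 1"
  shows "G1 q = G2 q"
proof -
  have nz: "G1 q = G2 q" if q: "q \<in> ball 0 1" "q \<noteq> 0" for q
  proof -
    obtain z where z: "exp (2 * of_real pi * \<i> * z / of_real h) = q" using q_surj[OF h q(2)] by metis
    have "exp (- (2 * pi * Im z / h)) < 1" using q norm_q[OF h, of z] by (simp only: z) auto
    then have "Im z > 0" using h by (simp add: zero_less_divide_iff zero_less_mult_iff)
    then show ?thesis using eq z by metis
  qed
  show ?thesis
  proof (cases "q = 0")
    case True
    have "(G1 \<longlongrightarrow> G1 0) (at 0)" "(G2 \<longlongrightarrow> G2 0) (at 0)"
      using hol[THEN holomorphic_on_imp_continuous_on] by (auto simp: continuous_on_eq_continuous_at isCont_def)
    moreover have "\<forall>\<^sub>F q in at 0. G1 q = G2 q"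
      unfolding eventually_at using nz by (intro exI[of _ 1]) auto
    ultimately have "(G2 \<longlongrightarrow> G1 0) (at 0)" using tendsto_cong by metis
    then show ?thesis using \<open>(G2 \<longlongrightarrow> G2 0) (at 0)\<close> True tendsto_unique[of "at (0::complex)"] by auto
  qed (use nz q in auto)
qed

theorem modular_forms_finite_dim:
  assumes \<Gamma>: "subgroup \<Gamma> SL2Z" and fin: "finite (rcosets\<^bsub>SL2Z\<^esub> \<Gamma>)"
  shows "\<exists>B. finite B \<and> scalar_modular_forms \<Gamma> k \<subseteq> VF.span B"
proof -
  have sub: "\<Gamma> \<subseteq> carrier SL2Z" using \<Gamma> by (rule subgroup.subset)
  obtain R where R: "finite R" "R \<subseteq> carrier SL2Z" "\<And>g. g \<in> carrier SL2Z \<Longrightarrow> \<exists>\<gamma>\<in>\<Gamma>. \<exists>h\<in>R. g = \<gamma> ** h"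
    using coset_representatives[OF \<Gamma> fin] by blast
  have "\<forall>h\<in>R. \<exists>N::nat. N > 0 \<and> (\<exists>\<gamma>\<in>\<Gamma>. h ** translation (int N) = \<gamma> ** h)"
    using cusp_width[OF \<Gamma> fin] R(2) by blast
  then obtain N where N: "\<And>h. h \<in> R \<Longrightarrow> N h > (0::nat) \<and> (\<exists>\<gamma>\<in>\<Gamma>. h ** translation (int (N h)) = \<gamma> ** h)"
    by metis
  have "\<forall>h\<in>R. \<exists>m. \<forall>y\<ge>1/5. (10 * y) powr (of_int k / 2) * exp (- (2 * pi * real m * (y - 1/10) / real (N h))) \<le> exp (- (1/10))"
    using decay_condition N by blast
  then obtain m where m: "\<And>h y. h \<in> R \<Longrightarrow> y \<ge> 1/5 \<Longrightarrow>
    (10 * y) powr (of_int k / 2) * exp (- (2 * pi * real (m h) * (y - 1/10) / real (N h))) \<le> exp (- (1/10))"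
    by metis
  \<comment> \<open>The functionals: Taylor coefficients below order \<open>m h\<close> at each
    chart h, finitely many in all and separating forms by
    \<open>modular_form_vanishes\<close>.\<close>
  define coef where "coef = (\<lambda>(h, i) f. (deriv ^^ i) (cusp_expansion k h (N h) f) 0)"
  define I where "I = (SIGMA h:R. {..<m h})"
  let ?S = "scalar_modular_forms \<Gamma> k"
  note add_closed = VF.subspace_add[OF scalar_subspace[of \<Gamma> k]] and scale_closed = VF.subspace_scale[OF scalar_subspace[of \<Gamma> k]]
  have ce: "cusp_expansion k h (N h) f holomorphic_on ball 0 1"
    "Im z > 0 \<Longrightarrow> cusp_expansion k h (N h) f (exp (2 * of_real pi * \<i> * z / of_real (real (N h)))) = slash k h f (Abs_uhp z)"
    if h: "h \<in> R" and f: "f \<in> ?S" for h f z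
  proof -
    have hS: "h \<in> carrier SL2Z" using h R by blast
    obtain \<gamma> where \<gamma>: "\<gamma> \<in> \<Gamma>" "h ** translation (int (N h)) = \<gamma> ** h" "N h > 0" using N[OF h] by blast
    show "cusp_expansion k h (N h) f holomorphic_on ball 0 1"
      by (rule cusp_expansion(1)[OF sub f hS \<gamma>])
    show "Im z > 0 \<Longrightarrow> cusp_expansion k h (N h) f (exp (2 * of_real pi * \<i> * z / of_real (real (N h)))) = slash k h f (Abs_uhp z)"
      using cusp_expansion(2)[OF sub f hS \<gamma>, of "Abs_uhp z"] by (simp add: Abs_uhp_inverse)
  qed
  show ?thesis
  proof (rule VF.finite_span_of_functionals[of "coef ` I"])
    show "finite (coef ` I)" using R(1) by (auto simp: I_def)
    show "VF.subspace ?S" by (rule scalar_subspace)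
  next
    fix l f g assume "l \<in> coef ` I" and f: "f \<in> ?S" and g: "g \<in> ?S"
    then obtain h i where l: "l = coef (h, i)" and h: "h \<in> R" by (auto simp: I_def)
    have "N h > 0" using N[OF h] by blast
    have "(deriv ^^ i) (cusp_expansion k h (N h) (f + g)) 0 =
      (deriv ^^ i) (\<lambda>w. cusp_expansion k h (N h) f w + cusp_expansion k h (N h) g w) 0"
    proof (intro higher_deriv_transform_within_open[of _ "ball 0 1"])
      have fg: "f + g \<in> ?S" by (rule add_closed[OF f g])
      show hol: "cusp_expansion k h (N h) (f + g) holomorphic_on ball 0 1"
        "(\<lambda>w. cusp_expansion k h (N h) f w + cusp_expansion k h (N h) g w) holomorphic_on ball 0 1"
        by (rule ce(1)[OF h fg], rule holomorphic_on_add[OF ce(1)[OF h f] ce(1)[OF h g]])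
      fix w :: complex assume "w \<in> ball 0 1"
      then show "cusp_expansion k h (N h) (f + g) w = cusp_expansion k h (N h) f w + cusp_expansion k h (N h) g w"
        by (rule disc_eqI[of "real (N h)", OF _ hol, rotated 2])
           (use \<open>N h > 0\<close> in \<open>simp_all add: ce(2)[OF h] f g fg slash_def distrib_left del: of_real_of_nat_eq\<close>)
    qed auto
    also have "\<dots> = (deriv ^^ i) (cusp_expansion k h (N h) f) 0 + (deriv ^^ i) (cusp_expansion k h (N h) g) 0"
      by (rule higher_deriv_add[OF ce(1)[OF h f] ce(1)[OF h g]]) auto
    finally show "l (f + g) = l f + l g" by (simp add: l coef_def)
  next
    fix l c f assume "l \<in> coef ` I" and f: "f \<in> ?S"
    then obtain h i where l: "l = coef (h, i)" and h: "h \<in> R" by (auto simp: I_def)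
    have "N h > 0" using N[OF h] by blast
    have "(deriv ^^ i) (cusp_expansion k h (N h) (scale_fun c f)) 0 =
      (deriv ^^ i) (\<lambda>w. c * cusp_expansion k h (N h) f w) 0"
    proof (intro higher_deriv_transform_within_open[of _ "ball 0 1"])
      have sf: "scale_fun c f \<tau> = c * f \<tau>" for \<tau> by (simp add: scale_fun_def)
      have cf: "scale_fun c f \<in> ?S" by (rule scale_closed[OF f])
      show hol: "cusp_expansion k h (N h) (scale_fun c f) holomorphic_on ball 0 1"
        "(\<lambda>w. c * cusp_expansion k h (N h) f w) holomorphic_on ball 0 1"
        by (rule ce(1)[OF h cf], rule holomorphic_on_mult[OF holomorphic_on_const ce(1)[OF h f]])
      fix w :: complex assume "w \<in> ball 0 1"
      then show "cusp_expansion k h (N h) (scale_fun c f) w = c * cusp_expansion k h (N h) f w"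
        by (rule disc_eqI[of "real (N h)", OF _ hol, rotated 2])
           (use \<open>N h > 0\<close> in \<open>simp_all add: ce(2)[OF h] f cf slash_def sf del: of_real_of_nat_eq\<close>)
    qed auto
    also have "\<dots> = c * (deriv ^^ i) (cusp_expansion k h (N h) f) 0"
      by (rule higher_deriv_cmult[OF ce(1)[OF h f]]) auto
    finally show "l (scale_fun c f) = c * l f" by (simp add: l coef_def)
  next
    fix f assume f: "f \<in> ?S" and z: "\<forall>l\<in>coef ` I. l f = 0"
    show "f = 0"
      by (rule modular_form_vanishes[OF sub f R N, where \<theta> = "exp (- (1/10))" and m = m])
         (use m z in \<open>auto simp: I_def coef_def\<close>)
  qed
qed

section \<open>Hilbert series\<close>

interpretation VS: vector_space scale_sym_fun
  by unfold_locales (auto simp: scale_sym_fun_def fun_eq_iff scale_sym_add scale_sym_add_left)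

lemma sum_fun_apply: "(\<Sum>i\<in>I. g i) \<tau> = (\<Sum>i\<in>I. g i \<tau>)"
  for g :: "'i \<Rightarrow> 'b \<Rightarrow> 'c::comm_monoid_add"
  by (induction I rule: infinite_finite_induct) auto

lemma phi_form_sum: "phi_form n a (\<Sum>b\<in>I. scale_fun (u b) (g b)) = (\<Sum>b\<in>I. scale_sym_fun (u b) (phi_form n a (g b)))"
proof (induction I rule: infinite_finite_induct)
  case (insert x F)
  then show ?case
    by (simp add: phi_form_def scale_fun_def scale_sym_fun_def fun_eq_iff scale_sym_add_left)
qed (auto simp: phi_form_def fun_eq_iff)

text \<open>Bases of the scalar spaces in the weights d - (2 a - n), carried over by
  \<open>phi_form n a\<close>, combine to a basis; \<open>phi_coord\<close> separates the blocks and
  proves independence.\<close>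

lemma rho_forms_dim:
  assumes \<Gamma>: "\<Gamma> \<subseteq> carrier SL2Z"
    and fd: "\<And>k. \<exists>B. finite B \<and> scalar_modular_forms \<Gamma> k \<subseteq> VF.span B"
  shows "VS.dim (rho_modular_forms \<Gamma> n d) = (\<Sum>a\<le>n. VF.dim (scalar_modular_forms \<Gamma> (d - (2 * int a - int n))))"
proof -
  let ?S = "\<lambda>a. scalar_modular_forms \<Gamma> (d - (2 * int a - int n))"
  have "\<exists>B. finite B \<and> B \<subseteq> ?S a \<and> VF.independent B \<and> ?S a \<subseteq> VF.span B \<and> card B = VF.dim (?S a)" for a
  proof -
    obtain B where B: "B \<subseteq> ?S a" "VF.independent B" "?S a \<subseteq> VF.span B" "card B = VF.dim (?S a)"
      using VF.basis_exists[of "?S a"] by blast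
    obtain B' where B': "finite B'" "?S a \<subseteq> VF.span B'" using fd by blast
    have "finite B" using VF.independent_span_bound[OF B'(1) B(2)] B(1) B'(2) by blast
    then show ?thesis using B by blast
  qed
  then obtain B where B: "\<And>a. finite (B a)" "\<And>a. B a \<subseteq> ?S a" "\<And>a. VF.independent (B a)"
    "\<And>a. ?S a \<subseteq> VF.span (B a)" "\<And>a. card (B a) = VF.dim (?S a)"
    by metis
  define P where "P = (SIGMA a:{..n}. B a)"
  define \<beta> where "\<beta> = (\<lambda>(a, b). phi_form n a b)"
  have finP: "finite P" using B(1) by (auto simp: P_def)
  have sumP: "(\<Sum>p\<in>P. scale_sym_fun (u p) (\<beta> p)) = (\<Sum>a\<le>n. phi_form n a (\<Sum>b\<in>B a. scale_fun (u (a, b)) b))" for u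
    unfolding P_def phi_form_sum by (simp add: sum.Sigma B(1) \<beta>_def case_prod_unfold)
  have indep: "u p = 0" if "(\<Sum>p\<in>P. scale_sym_fun (u p) (\<beta> p)) = 0" "p \<in> P" for u p
  proof -
    from that(2) obtain a b where p: "p = (a, b)" "a \<le> n" "b \<in> B a" by (auto simp: P_def)
    let ?f = "\<lambda>a. \<Sum>b\<in>B a. scale_fun (u (a, b)) b"
    have "(\<lambda>\<tau>. \<Sum>a\<le>n. phi_form n a (?f a) \<tau>) = 0"
      using that(1) unfolding sumP by (auto simp: fun_eq_iff sum_fun_apply)
    then have "?f a = phi_coord n a 0" using phi_coord_form[OF p(2), of ?f] by simp
    then have "?f a = 0" by (simp add: phi_coord_0)
    then show ?thesis using VF.independentD[OF B(3)[of a] B(1)[of a] subset_refl, of "\<lambda>b. u (a, b)" b] p by simp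
  qed
  \<comment> \<open>Two indices with the same image would give the relation with coefficients 1 and
    -1. Injectivity turns independence of the indexed family into independence of its image and
    gives the count.\<close>
  have inj: "inj_on \<beta> P"
  proof (rule inj_onI, rule ccontr)
    fix p p' assume p: "p \<in> P" "p' \<in> P" "\<beta> p = \<beta> p'" "p \<noteq> p'"
    let ?u = "\<lambda>x. if x = p then 1 else if x = p' then -1 else (0::complex)"
    have "(\<Sum>x\<in>P. scale_sym_fun (?u x) (\<beta> x)) = (\<Sum>x\<in>{p, p'}. scale_sym_fun (?u x) (\<beta> x))"
      by (rule sum.mono_neutral_right[OF finP]) (use p in auto)
    also have "\<dots> = 0" using p(3,4) by (simp add: VS.scale_minus_left)
    finally show False using indep[of ?u p] p(1) by simp
  qed
  have "VS.dim (rho_modular_forms \<Gamma> n d) = card (\<beta> ` P)"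
  proof (rule VS.dim_unique[OF _ _ _ refl])
    show "\<beta> ` P \<subseteq> rho_modular_forms \<Gamma> n d"
    proof clarify
      fix a b assume "(a, b) \<in> P"
      then have ab: "a \<le> n" "b \<in> ?S a" using B(2) by (auto simp: P_def)
      from phi_form_modular[OF \<Gamma> ab(2,1)] show "\<beta> (a, b) \<in> rho_modular_forms \<Gamma> n d"
        by (simp add: \<beta>_def)
    qed
    show "rho_modular_forms \<Gamma> n d \<subseteq> VS.span (\<beta> ` P)"
    proof
      fix F assume F: "F \<in> rho_modular_forms \<Gamma> n d"
      have "phi_form n a (phi_coord n a F) \<in> VS.span (\<beta> ` P)" if a: "a \<le> n" for a
      proof -
        have "phi_coord n a F \<in> VF.span (B a)" using phi_coord_modular[OF \<Gamma> F a] B(4) by blast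
        then obtain u where "phi_coord n a F = (\<Sum>b\<in>B a. scale_fun (u b) b)"
          unfolding VF.span_finite[OF B(1)] by blast
        then have "phi_form n a (phi_coord n a F) = (\<Sum>b\<in>B a. scale_sym_fun (u b) (\<beta> (a, b)))"
          by (simp add: phi_form_sum \<beta>_def)
        also have "\<dots> \<in> VS.span (\<beta> ` P)"
          using a by (intro VS.span_sum VS.span_scale VS.span_base) (auto simp: P_def)
        finally show ?thesis .
      qed
      then have "(\<Sum>a\<le>n. phi_form n a (phi_coord n a F)) \<in> VS.span (\<beta> ` P)" by (intro VS.span_sum) auto
      moreover have "(\<Sum>a\<le>n. phi_form n a (phi_coord n a F)) = F"
        using F by (auto simp: fun_eq_iff sum_fun_apply phi_form_coord rho_modular_forms_iff)
      ultimately show "F \<in> VS.span (\<beta> ` P)" by simp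
    qed
    show "VS.independent (\<beta> ` P)"
    proof (rule VS.independent_if_scalars_zero)
      show "finite (\<beta> ` P)" using finP by simp
      fix u x assume "(\<Sum>x\<in>\<beta> ` P. scale_sym_fun (u x) x) = 0" "x \<in> \<beta> ` P"
      then obtain p where "(\<Sum>p\<in>P. scale_sym_fun (u (\<beta> p)) (\<beta> p)) = 0" "p \<in> P" "x = \<beta> p"
        by (auto simp: sum.reindex[OF inj])
      then show "u x = 0" using indep[of "\<lambda>p. u (\<beta> p)" p] by simp
    qed
  qed
  also have "\<dots> = card P" by (rule card_image[OF inj])
  also have "\<dots> = (\<Sum>a\<le>n. card (B a))" by (simp add: P_def B(1))
  finally show ?thesis by (simp add: B(5))
qed

text \<open>The dimensions form a Laurent series because they vanish below degree 0 for scalar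
  forms, hence below -n for vector-valued ones; the formula then is \<open>rho_forms_dim\<close>
  read coefficientwise, with powers of the variable as shifts.\<close>

theorem rho_forms_hilbert_series:
  assumes \<Gamma>: "subgroup \<Gamma> SL2Z" and fin: "finite (rcosets\<^bsub>SL2Z\<^esub> \<Gamma>)"
  shows "hilbert_series scale_sym_fun (rho_modular_forms \<Gamma> n) =
           (\<Sum>j\<le>n. fls_X_intpow (2 * int j - int n)) *
           hilbert_series scale_fun (scalar_modular_forms \<Gamma>)"
proof (rule fls_eqI)
  fix d
  have sub: "\<Gamma> \<subseteq> carrier SL2Z" using \<Gamma> by (rule subgroup.subset)
  note dim = rho_forms_dim[OF sub modular_forms_finite_dim[OF \<Gamma> fin]]
  have neg: "VF.dim (scalar_modular_forms \<Gamma> k) = 0" if "k < 0" for k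
  proof -
    have "scalar_modular_forms \<Gamma> k \<subseteq> VF.span {}"
      using modular_forms_negative_weight[OF \<Gamma> fin that] by auto
    from VF.dim_le_card[OF this] show ?thesis by simp
  qed
  have 1: "fls_nth (hilbert_series scale_fun (scalar_modular_forms \<Gamma>)) k = int (VF.dim (scalar_modular_forms \<Gamma> k))" for k
    unfolding hilbert_series_def
    by (rule nth_Abs_fls_lower_bound[of 0]) (simp add: neg)
  have 2: "fls_nth (hilbert_series scale_sym_fun (rho_modular_forms \<Gamma> n)) d = int (VS.dim (rho_modular_forms \<Gamma> n d))"
    unfolding hilbert_series_def
    by (rule nth_Abs_fls_lower_bound[of "- int n"]) (auto simp: dim neg)
  have s: "fls_nth (\<Sum>j\<le>n. g j) d = (\<Sum>j\<le>n. fls_nth (g j) d)" for g :: "nat \<Rightarrow> int fls"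
    by (induction n) auto
  have X: "fls_nth (fls_X_intpow w * H) d = fls_nth H (d - w)" for w and H :: "int fls"
    by (simp add: fls_X_intpow_times_conv_shift)
  show "fls_nth (hilbert_series scale_sym_fun (rho_modular_forms \<Gamma> n)) d =
    fls_nth ((\<Sum>j\<le>n. fls_X_intpow (2 * int j - int n)) * hilbert_series scale_fun (scalar_modular_forms \<Gamma>)) d"
    by (simp only: 2 dim sum_distrib_right s X 1 of_nat_sum)
qed

theorem theorem3p2:
  fixes \<Gamma> :: "(int^2^2) set" and n :: nat
  assumes "subgroup \<Gamma> SL2Z"
    and "finite (rcosets\<^bsub>SL2Z\<^esub> \<Gamma>)"
  shows "graded_module_iso
           (modular_ring \<Gamma>) (homogeneous_part (scalar_modular_forms \<Gamma>))
           (tensor_module \<Gamma> n) (tensor_part \<Gamma> n)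
           (rho_module \<Gamma> n) (homogeneous_part (rho_modular_forms \<Gamma> n))
           (Phi n) \<and>
         free_module_of_rank (modular_ring \<Gamma>) (rho_module \<Gamma> n) (n + 1) \<and>
         hilbert_series scale_sym_fun (rho_modular_forms \<Gamma> n) =
           (\<Sum>j\<le>n. fls_X_intpow (2 * int j - int n)) *
           hilbert_series scale_fun (scalar_modular_forms \<Gamma>)"
  using Phi_graded_module_iso rho_module_free rho_forms_hilbert_series[OF assms]
    subgroup.subset[OF assms(1)] by blast

end
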